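(* Let $\lambda=(c_0,d_0,b_0^\rho,b_0^\phi)\in\mathbb{R}^4$, and for some $\delta>0$ let $(u_\lambda,p_\lambda)\in C^\infty(\Omega_\delta\setminus\{x'=0\})$ be the $(-1)$-homogeneous axisymmetric solution of $$-\Delta u+(u\cdot\nabla)u+\nabla p=0,\qquad\operatorname{div}u=0$$ in $\Omega_\delta\setminus\{x'=0\}$ which satisfies $|u_\lambda|=o(|x'|^{-1})$ as $x'\to0$ for each fixed $x_3>0$ and has parameter $\lambda$ (in the sense defined in the context). Then $$-\Delta u_\lambda+u_\lambda\cdot\nabla u_\lambda+\nabla p_\lambda=-2\pi c_0\,\partial_{x_3}\big(\ln|x_3|\,\delta_{x'=0}\big)e_3,\qquad\operatorname{div}u_\lambda=0$$ in the sense of distributions in $\Omega_\delta$; that is, for every $\varphi\in C_c^\infty(\Omega_\delta)$ and $j=1,2,3$ (summing over the repeated index $i=1,2,3$), $$\int_{\Omega_\delta}\big(\nabla u_\lambda^j\cdot\nabla\varphi-u_\lambda^iu_\lambda^j\,\partial_i\varphi-p_\lambda\,\partial_j\varphi\big)\,dx=2\pi c_0\,\delta_{j3}\int_0^\infty\ln|x_3|\,\partial_3\varphi(0,0,x_3)\,dx_3,$$ and $$\int_{\Omega_\delta}u_\lambda\cdot\nabla\varphi\,dx=0.$$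
   Context: Write $x=(x_1,x_2,x_3)\in\mathbb{R}^3$, $x'=(x_1,x_2)$, $r=|x'|$; $\phi$ is the azimuthal angle about the $x_3$-axis. Set $\rho=r/x_3$ for $x_3>0$. With $(e_r,e_\phi,e_3)$ the cylindrical orthonormal frame and $e_\rho:=e_r$, write $u=u^\rho e_\rho+u^\phi e_\phi+u^3e_3$; $u^1,u^2,u^3$ are Cartesian components. For $\delta>0$, $\Omega_\delta=\{x\in\mathbb{R}^3:|x'|<\delta x_3,\ x_3>0\}$ (this contains the positive $x_3$-axis but not the origin). $\delta_{x'=0}$ is the Dirac measure in the $x'$ variable supported on the positive $x_3$-axis, and $\delta_{j3}$ is the Kronecker delta. A function $f$ is $(-\alpha)$-homogeneous if $f(sx)=s^{-\alpha}f(x)$ for all $s>0$. A solution $(u,p)$ is $(-1)$-homogeneous if $u$ is $(-1)$-homogeneous and $p$ is $(-2)$-homogeneous; it is axisymmetric if $u^\rho,u^\phi,u^3,p$ are independent of $\phi$. $(u,p)$ has parameter $\lambda=(c_0,d_0,b_0^\rho,b_0^\phi)$ if on $\{x_3=1\}$: $c_0=\lim_{\rho\to0^+}\rho\partial_\rho p$, $d_0=\lim_{\rho\to0^+}(p-c_0\ln\rho)$, $b_0^\rho=\lim_{\rho\to0^+}\frac1\rho(u^\rho-\frac12c_0\rho\ln\rho)$, $b_0^\phi=\lim_{\rho\to0^+}\frac1\rho u^\phi$. (For each $\lambda$ such a solution exists and is unique on $\Omega_\delta\setminus\{x'=0\}$ for some $\delta>0$.) *)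

theory Defs
  imports "HOL-Analysis.Analysis" "HOL-Library.Landau_Symbols"
begin

text \<open>
  Differential operators on \<open>\<real>\<^sup>n\<close>. They are meaningful at points of differentiability only;
  elsewhere \<^const>\<open>frechet_derivative\<close> is an unspecified function.
\<close>

definition partial_deriv :: "'n::finite \<Rightarrow> (real ^ 'n \<Rightarrow> 'b::real_normed_vector) \<Rightarrow> real ^ 'n \<Rightarrow> 'b"
  where "partial_deriv i f x = frechet_derivative f (at x) (axis i 1)"

definition grad :: "(real ^ 'n::finite \<Rightarrow> real) \<Rightarrow> real ^ 'n \<Rightarrow> real ^ 'n"
  where "grad f x = (\<chi> i. partial_deriv i f x)"

definition divergence :: "(real ^ 'n::finite \<Rightarrow> real ^ 'n) \<Rightarrow> real ^ 'n \<Rightarrow> real"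
  where "divergence u x = (\<Sum>i\<in>UNIV. partial_deriv i u x $ i)"

definition laplacian :: "(real ^ 'n::finite \<Rightarrow> 'b::real_normed_vector) \<Rightarrow> real ^ 'n \<Rightarrow> 'b"
  where "laplacian f x = (\<Sum>i\<in>UNIV. partial_deriv i (partial_deriv i f) x)"

definition convection :: "(real ^ 'n::finite \<Rightarrow> real ^ 'n) \<Rightarrow> real ^ 'n \<Rightarrow> real ^ 'n"
  where "convection u x = (\<Sum>i\<in>UNIV. u x $ i *\<^sub>R partial_deriv i u x)"

text \<open>\<open>C_diff_on k S f\<close> says that \<open>f\<close> is of class \<open>C\<^sup>k\<close> on the set \<open>S\<close>, which is assumed open.\<close>

fun C_diff_on ::
  "nat \<Rightarrow> (real ^ 'n::finite) set \<Rightarrow> (real ^ 'n \<Rightarrow> 'b::real_normed_vector) \<Rightarrow> bool"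
  where
    "C_diff_on 0 S f \<longleftrightarrow> continuous_on S f"
  | "C_diff_on (Suc k) S f \<longleftrightarrow>
       (\<forall>x\<in>S. f differentiable (at x)) \<and> (\<forall>i. C_diff_on k S (partial_deriv i f))"

definition smooth_on :: "(real ^ 'n::finite) set \<Rightarrow> (real ^ 'n \<Rightarrow> 'b::real_normed_vector) \<Rightarrow> bool"
  where "smooth_on S f \<longleftrightarrow> (\<forall>k. C_diff_on k S f)"

text \<open>
  The space \<open>C\<^sub>c\<^sup>\<infinity>(S)\<close>, \<open>S\<close> open; its members are regarded as functions on the whole space,
  vanishing outside \<open>S\<close>.
\<close>

definition test_functions :: "(real ^ 'n::finite) set \<Rightarrow> (real ^ 'n \<Rightarrow> real) set"
  where "test_functions S =
    {f. smooth_on UNIV f \<and> compact (closure {x. f x \<noteq> 0}) \<and> closure {x. f x \<noteq> 0} \<subseteq> S}"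

definition homogeneous_on ::
  "real \<Rightarrow> (real ^ 'n::finite) set \<Rightarrow> (real ^ 'n \<Rightarrow> 'b::real_normed_vector) \<Rightarrow> bool"
  where "homogeneous_on d S f \<longleftrightarrow> (\<forall>x\<in>S. \<forall>s>0. f (s *\<^sub>R x) = s powr d *\<^sub>R f x)"

definition navier_stokes_on ::
  "(real ^ 'n::finite) set \<Rightarrow> (real ^ 'n \<Rightarrow> real ^ 'n) \<Rightarrow> (real ^ 'n \<Rightarrow> real) \<Rightarrow> bool"
  where "navier_stokes_on S u p \<longleftrightarrow>
    (\<forall>x\<in>S. - laplacian u x + convection u x + grad p x = 0 \<and> divergence u x = 0)"

definition radius :: "real ^ 3 \<Rightarrow> real"
  where "radius x = sqrt ((x $ 1)\<^sup>2 + (x $ 2)\<^sup>2)"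

definition cyl :: "real \<Rightarrow> real \<Rightarrow> real \<Rightarrow> real ^ 3"
  where "cyl r \<phi> z = vector [r * cos \<phi>, r * sin \<phi>, z]"

definition Cone :: "real \<Rightarrow> (real ^ 3) set"
  where "Cone \<delta> = {x. radius x < \<delta> * x $ 3 \<and> x $ 3 > 0}"

definition x3_axis :: "(real ^ 3) set"
  where "x3_axis = {x. x $ 1 = 0 \<and> x $ 2 = 0}"

text \<open>
  The components \<open>u\<^sup>\<rho> = u \<bullet> e\<^sub>r\<close> and \<open>u\<^sup>\<phi> = u \<bullet> e\<^sub>\<phi>\<close>, as functions of the Cartesian point;
  the frame exists off the \<open>x\<^sub>3\<close>-axis only.
\<close>

definition rho_component :: "(real ^ 3 \<Rightarrow> real ^ 3) \<Rightarrow> real ^ 3 \<Rightarrow> real"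
  where "rho_component u x = u x \<bullet> vector [x $ 1 / radius x, x $ 2 / radius x, 0]"

definition phi_component :: "(real ^ 3 \<Rightarrow> real ^ 3) \<Rightarrow> real ^ 3 \<Rightarrow> real"
  where "phi_component u x = u x \<bullet> vector [- (x $ 2) / radius x, x $ 1 / radius x, 0]"

definition angle_independent_on :: "(real ^ 3) set \<Rightarrow> (real ^ 3 \<Rightarrow> real) \<Rightarrow> bool"
  where "angle_independent_on S f \<longleftrightarrow>
    (\<forall>r \<phi> \<psi> z. r > 0 \<longrightarrow> cyl r \<phi> z \<in> S \<longrightarrow> cyl r \<psi> z \<in> S \<longrightarrow> f (cyl r \<phi> z) = f (cyl r \<psi> z))"

definition axisymmetric_on ::
  "(real ^ 3) set \<Rightarrow> (real ^ 3 \<Rightarrow> real ^ 3) \<Rightarrow> (real ^ 3 \<Rightarrow> real) \<Rightarrow> bool"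
  where "axisymmetric_on S u p \<longleftrightarrow>
    angle_independent_on S (rho_component u) \<and> angle_independent_on S (phi_component u) \<and>
    angle_independent_on S (\<lambda>x. u x $ 3) \<and> angle_independent_on S p"

text \<open>
  On the plane \<open>x\<^sub>3 = 1\<close> the variable \<open>\<rho> = r / x\<^sub>3\<close> is \<open>r\<close>. The limits are required along every
  ray \<open>\<phi> = const\<close>; for axisymmetric \<open>(u, p)\<close> they do not depend on \<open>\<phi>\<close>.
\<close>

definition has_parameter ::
  "(real ^ 3 \<Rightarrow> real ^ 3) \<Rightarrow> (real ^ 3 \<Rightarrow> real) \<Rightarrow> real \<times> real \<times> real \<times> real \<Rightarrow> bool"
  where "has_parameter u p = (\<lambda>(c0, d0, b0\<rho>, b0\<phi>). \<forall>\<phi>.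
    ((\<lambda>\<rho>. \<rho> * deriv (\<lambda>s. p (cyl s \<phi> 1)) \<rho>) \<longlongrightarrow> c0) (at_right 0) \<and>
    ((\<lambda>\<rho>. p (cyl \<rho> \<phi> 1) - c0 * ln \<rho>) \<longlongrightarrow> d0) (at_right 0) \<and>
    ((\<lambda>\<rho>. 1 / \<rho> * (rho_component u (cyl \<rho> \<phi> 1) - 1 / 2 * c0 * \<rho> * ln \<rho>)) \<longlongrightarrow> b0\<rho>) (at_right 0) \<and>
    ((\<lambda>\<rho>. 1 / \<rho> * phi_component u (cyl \<rho> \<phi> 1)) \<longlongrightarrow> b0\<phi>) (at_right 0))"

end

theory Submission
  imports Defs "HOL-Real_Asymp.Real_Asymp"
begin

text \<open>
  By homogeneity and axisymmetry the flow is determined by its profile \<open>f \<rho> = u (\<rho>, 0, 1)\<close>. The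
  divergence equation, integrated from the axis, turns the prescribed behaviour of \<open>u\<^sup>\<rho>\<close> into
  \<open>u\<^sup>3 \<sim> c\<^sub>0 ln \<rho>\<close>. The momentum equation becomes a linear first-order system for
  \<open>g = \<rho> f'\<close> with coefficients \<open>O(\<rho>\<^sup>-\<^sup>1\<^sup>/\<^sup>2)\<close>, so \<open>g\<close> has a limit at the axis, and the
  asymptotics of \<open>f\<close> identify it as \<open>(0, 0, c\<^sub>0)\<close>.

  For each \<open>j\<close> the stress \<open>\<Phi>\<^sub>i = \<partial>\<^sub>i u\<^sup>j - u\<^sup>i u\<^sup>j - \<delta>\<^sub>i\<^sub>j p\<close> is divergence free off the axis, and its radial
  part \<open>x\<^sub>1 \<Phi>\<^sub>1 + x\<^sub>2 \<Phi>\<^sub>2\<close> tends to \<open>c\<^sub>0 \<delta>\<^sub>j\<^sub>3 / x\<^sub>3\<close> at the axis. Testing against \<open>\<phi>\<close> times a cutoff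
  that vanishes for \<open>|x'| < \<epsilon>\<close>, the gradient of the cutoff is, after rescaling \<open>x'\<close> by \<open>\<epsilon>\<close>, an
  approximate delta on the axis of total mass \<open>2 \<pi>\<close>; it picks up the flux
  \<open>2 \<pi> c\<^sub>0 \<integral> \<phi>(0, 0, z) / z dz\<close>, which equals \<open>- 2 \<pi> c\<^sub>0 \<integral> ln z \<partial>\<^sub>3 \<phi>(0, 0, z) dz\<close>.
\<close>

subsection \<open>Limits at the origin of an interval\<close>

text \<open>The parameter prescribes limits of \<open>u\<close>, of \<open>p\<close> and of a
  derivative of \<open>p\<close>, whereas the singular term comes from a derivative of
  \<open>u\<close>, and an asymptotic expansion cannot be differentiated. Hence the detour: the
  equation shows that \<open>g\<close> converges, and only then does l'Hopital's rule let its limit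
  be read off from \<open>f\<close>. The obstacle is the term
  \<open>turn3 (turn3 (f \<rho>)) / \<rho>\<close> of the cylindrical Laplacian. It is tame because
  turning twice removes the vertical component, the one that may be unbounded, while the horizontal
  ones are O(\<rho> |ln \<rho>|). Logarithms are traded for small powers throughout, which is the
  origin of the exponents 1/4, 1/2 and 5/4. The growth condition |u| = o(1/|x'|) fixes the constant
  of integration in the divergence equation. Since u and p grow at most logarithmically at the axis,
  the convective and pressure parts of the radial stress vanish there and the viscous part alone
  leaves a trace. In the mass 2 \<pi> the factor 2 is the slope of |x'|^2 and \<pi> is the area of
  the unit disc.\<close>

lemma bounded_near_0:
  fixes h :: "real \<Rightarrow> 'a::real_normed_vector"
  assumes "continuous_on {0<..<d} h" "(h \<longlongrightarrow> L) (at_right 0)" "d' < d"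
  obtains C where "C > 0" "\<And>t. 0 < t \<Longrightarrow> t \<le> d' \<Longrightarrow> norm (h t) \<le> C"
proof -
  have "\<forall>\<^sub>F t in at_right 0. dist (h t) L < 1"
    using assms(2) by (rule tendstoD) simp
  then obtain b where b: "b > 0" "\<And>t. 0 < t \<Longrightarrow> t < b \<Longrightarrow> dist (h t) L < 1"
    by (auto simp: eventually_at_right_field)
  have "compact (h ` {b..d'})"
    by (rule compact_continuous_image[OF continuous_on_subset[OF assms(1)]]) (use b assms in auto)
  then obtain C where C: "\<And>y. y \<in> h ` {b..d'} \<Longrightarrow> norm y \<le> C"
    using compact_imp_bounded bounded_iff by metis
  show thesis
  proof (rule that)
    show "\<bar>C\<bar> + norm L + 1 > 0" by (smt (verit) norm_ge_zero)
    fix t assume t: "0 < t" "t \<le> d'"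
    show "norm (h t) \<le> \<bar>C\<bar> + norm L + 1"
    proof (cases "t < b")
      case True
      then have "norm (h t - L) < 1" using b t by (auto simp: dist_norm)
      then show ?thesis using norm_triangle_sub[of "h t" L] by linarith
    next
      case False
      then have "norm (h t) \<le> C" using t by (intro C) auto
      then show ?thesis by (smt (verit) norm_ge_zero)
    qed
  qed
qed

text \<open>
  \<open>ln (1 + |g|\<^sup>2) + 8 M \<surd>t\<close> is nondecreasing, so \<open>g\<close> is bounded near 0; then \<open>\<tau> \<mapsto> g (\<tau>\<^sup>2)\<close> is Lipschitz.
\<close>

lemma gronwall_limit_at_0:
  fixes g :: "real \<Rightarrow> 'a::euclidean_space"
  assumes c: "c > 0"
    and g': "\<And>t. 0 < t \<Longrightarrow> t < c \<Longrightarrow> (g has_vector_derivative g' t) (at t)"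
    and le: "\<And>t. 0 < t \<Longrightarrow> t < c \<Longrightarrow> norm (g' t) \<le> M / sqrt t * (1 + norm (g t))"
  obtains l where "(g \<longlongrightarrow> l) (at_right 0)"
proof -
  define b where "b = c / 2"
  have b: "0 < b" "b < c" using c by (auto simp: b_def)
  \<comment> \<open>The hypothesis at a single point forces the sign of \<open>M\<close>: its left
    side is a norm.\<close>
  have M0: "M \<ge> 0"
  proof -
    have "0 \<le> M / sqrt b * (1 + norm (g b))" using le[OF b] by (smt (verit) norm_ge_zero)
    then show ?thesis using b
      by (simp add: zero_le_mult_iff zero_le_divide_iff) (smt (verit) norm_ge_zero)
  qed
  \<comment> \<open>The constant 8: \<open>\<bar>g \<bullet> g'\<bar>\<close> is at most
    \<open>2 * M / sqrt t * (1 + g \<bullet> g)\<close>, so the logarithm has slope at least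
    \<open>- 4 * M / sqrt t\<close>, and \<open>8 * M * sqrt t\<close> has slope
    \<open>4 * M / sqrt t\<close>.\<close>
  define m where "m t = ln (1 + g t \<bullet> g t) + 8 * M * sqrt t" for t
  have m_mono: "m t \<le> m b" if t: "0 < t" "t \<le> b" for t
  proof (rule DERIV_nonneg_imp_nondecreasing[OF t(2)])
    fix x assume x: "t \<le> x" "x \<le> b"
    then have x0: "0 < x" "x < c" using t b by auto
    have pos: "1 + g x \<bullet> g x > 0" by (smt (verit) inner_ge_zero)
    have gi: "((\<lambda>t. g t \<bullet> g t) has_real_derivative 2 * (g x \<bullet> g' x)) (at x)"
    proof -
      have "((\<lambda>t. g t \<bullet> g t) has_derivative (\<lambda>h. g x \<bullet> (h *\<^sub>R g' x) + (h *\<^sub>R g' x) \<bullet> g x)) (at x)"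
        using g'[OF x0] unfolding has_vector_derivative_def by (intro has_derivative_inner)
      then show ?thesis
        unfolding has_field_derivative_def
        by (rule has_derivative_eq_rhs) (auto simp: inner_commute algebra_simps)
    qed
    have "(m has_real_derivative 2 * (g x \<bullet> g' x) / (1 + g x \<bullet> g x) + 8 * M * (inverse (sqrt x) / 2)) (at x)"
      unfolding m_def using x0 pos
      by (auto intro!: derivative_eq_intros gi simp: field_simps)
    moreover have "2 * (g x \<bullet> g' x) / (1 + g x \<bullet> g x) + 8 * M * (inverse (sqrt x) / 2) \<ge> 0"
    proof -
      define n where "n = norm (g x)"
      have n0: "n \<ge> 0" by (simp add: n_def)
      have gg: "g x \<bullet> g x = n\<^sup>2" by (simp add: n_def power2_norm_eq_inner)
      have "\<bar>g x \<bullet> g' x\<bar> \<le> n * norm (g' x)" unfolding n_def by (rule Cauchy_Schwarz_ineq2)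
      also have "\<dots> \<le> n * (M / sqrt x * (1 + n))"
        using le[OF x0] n0 by (intro mult_left_mono) (auto simp: n_def)
      also have "\<dots> = M / sqrt x * (n * (1 + n))" by simp
      also have "\<dots> \<le> M / sqrt x * (2 * (1 + n\<^sup>2))"
      proof (rule mult_left_mono)
        have "0 \<le> (n - 1)\<^sup>2 " by simp
        then have "n * 2 \<le> 1 + n\<^sup>2" by (simp add: power2_eq_square algebra_simps)
        then have "n \<le> 1 + n\<^sup>2" using n0 by linarith
        then show "n * (1 + n) \<le> 2 * (1 + n\<^sup>2)" by (simp add: power2_eq_square algebra_simps)
        show "0 \<le> M / sqrt x" using M0 x0 by simp
      qed
      finally have "\<bar>g x \<bullet> g' x\<bar> \<le> 2 * (M / sqrt x) * (1 + n\<^sup>2)" by (simp add: field_simps)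
      then have "- (2 * (M / sqrt x)) * (1 + n\<^sup>2) \<le> g x \<bullet> g' x" by linarith
      then have "- (2 * (M / sqrt x)) \<le> (g x \<bullet> g' x) / (1 + n\<^sup>2)"
        using pos gg by (simp add: pos_le_divide_eq)
      then show ?thesis unfolding gg by (simp add: field_simps)
    qed
    ultimately show "\<exists>y. DERIV m x :> y \<and> y \<ge> 0" by blast
  qed
  define B where "B = sqrt (exp (m b))"
  have B: "norm (g t) \<le> B" if t: "0 < t" "t \<le> b" for t
  proof -
    have "ln (1 + g t \<bullet> g t) \<le> m b"
      using m_mono[OF t] M0 t unfolding m_def[of t] by (smt (verit) mult_nonneg_nonneg real_sqrt_ge_zero)
    then have "1 + g t \<bullet> g t \<le> exp (m b)"
      using inner_ge_zero[of "g t"] by (metis add_pos_nonneg exp_le_cancel_iff exp_ln zero_less_one)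
    then show ?thesis unfolding B_def norm_eq_sqrt_inner by simp
  qed
  define N where "N = M * (1 + B)"
  have N: "norm (g' t) \<le> N / sqrt t" if t: "0 < t" "t \<le> b" for t
  proof -
    have "norm (g' t) \<le> M / sqrt t * (1 + norm (g t))" using le t b by auto
    also have "\<dots> \<le> M / sqrt t * (1 + B)" using B[OF t] M0 t by (intro mult_left_mono) auto
    finally show ?thesis by (simp add: N_def)
  qed
  \<comment> \<open>The factor \<open>2 * \<tau>\<close> of the chain rule cancels the weight
    \<open>1 / sqrt t = 1 / \<tau>\<close>, so the derivative of \<open>h\<close> is bounded by
    \<open>2 * N\<close>.\<close>
  define h where "h \<tau> = g (\<tau>\<^sup>2)" for \<tau>
  define X where "X = {0<..<sqrt b}"
  have X2: "0 < \<tau>\<^sup>2 \<and> \<tau>\<^sup>2 < b" if "\<tau> \<in> X" for \<tau>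
    using that b power_strict_mono[of \<tau> "sqrt b" 2] unfolding X_def by auto
  have h': "(h has_derivative (\<lambda>y. y *\<^sub>R ((2 * \<tau>) *\<^sub>R g' (\<tau>\<^sup>2)))) (at \<tau> within X)" if "\<tau> \<in> X" for \<tau>
  proof -
    have "((\<lambda>\<tau>. \<tau>\<^sup>2) has_vector_derivative 2 * \<tau>) (at \<tau>)"
      by (auto intro!: derivative_eq_intros simp: has_real_derivative_iff_has_vector_derivative[symmetric])
    from vector_diff_chain_at[OF this, of g "g' (\<tau>\<^sup>2)"] g' X2[OF that] b
    have "(h has_vector_derivative ((2 * \<tau>) *\<^sub>R g' (\<tau>\<^sup>2))) (at \<tau>)"
      by (auto simp: h_def[abs_def] o_def)
    then show ?thesis unfolding has_vector_derivative_def by (rule has_derivative_at_withinI)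
  qed
  have lip: "norm (h x - h y) \<le> (2 * N) * norm (x - y)" if "x \<in> X" "y \<in> X" for x y
  proof (rule differentiable_bound[OF _ h' _ that])
    show "convex X" by (simp add: X_def)
    fix \<tau> assume t: "\<tau> \<in> X"
    then have tp: "\<tau> > 0" by (simp add: X_def)
    show "onorm (\<lambda>y. y *\<^sub>R ((2 * \<tau>) *\<^sub>R g' (\<tau>\<^sup>2))) \<le> 2 * N"
    proof (rule onorm_le)
      fix y :: real
      have "norm (g' (\<tau>\<^sup>2)) \<le> N / \<tau>" using N[of "\<tau>\<^sup>2"] X2[OF t] tp by simp
      then have "\<tau> * norm (g' (\<tau>\<^sup>2)) \<le> N" using tp by (simp add: field_simps)
      then have "\<bar>y\<bar> * (2 * (\<tau> * norm (g' (\<tau>\<^sup>2)))) \<le> \<bar>y\<bar> * (2 * N)" by (intro mult_left_mono) auto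
      then show "norm (y *\<^sub>R ((2 * \<tau>) *\<^sub>R g' (\<tau>\<^sup>2))) \<le> 2 * N * norm y"
        using tp by (simp add: abs_mult algebra_simps)
    qed
  qed
  \<comment> \<open>The limit comes from completeness: a uniformly continuous function extends to
    the closure, and no candidate for the value is needed.\<close>
  have "uniformly_continuous_on X h"
    by (rule lipschitz_on_uniformly_continuous[of "\<bar>2 * N\<bar>"])
       (rule lipschitz_onI, use lip in \<open>auto simp: dist_norm intro!: order_trans[OF lip] mult_right_mono\<close>)
  moreover have "0 \<in> closure X" using b by (simp add: X_def closure_greaterThanLessThan)
  ultimately obtain l where l: "(h \<longlongrightarrow> l) (at 0 within X)"
    by (rule uniformly_continuous_on_extension_at_closure)
  have "at 0 within X = at_right 0"
    unfolding X_def using b by (intro at_within_nhd[of _ "{..<sqrt b}"]) auto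
  then have l: "(h \<longlongrightarrow> l) (at_right 0)" using l by simp
  have "filterlim sqrt (at_right 0) (at_right (0::real))"
    unfolding filterlim_at by (auto simp: eventually_at_filter intro!: tendsto_eq_intros)
  from filterlim_compose[OF l this] have "((\<lambda>t. h (sqrt t)) \<longlongrightarrow> l) (at_right 0)" .
  then have "(g \<longlongrightarrow> l) (at_right 0)"
    by (rule Lim_transform_eventually) (auto simp: h_def eventually_at_right_less eventually_at_filter)
  then show thesis by (rule that)
qed

subsection \<open>Integration in cylindrical coordinates and by parts\<close>

lemma vector_3_axis:
  "(vector [a, b, c] :: real ^ 3) = a *\<^sub>R axis 1 1 + b *\<^sub>R axis 2 1 + c *\<^sub>R axis 3 1"
  by (simp add: vec_eq_iff forall_3 axis_def)

lemma Basis_vec_real: "(Basis :: (real ^ 'n) set) = range (\<lambda>i. axis i 1)"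
  by (auto simp: Basis_vec_def)

lemma prod_3: "prod f (UNIV :: 3 set) = f 1 * f 2 * f 3"
  unfolding UNIV_3 by (simp add: ac_simps)

lemma integral_mult_pair:
  fixes f :: "'a \<Rightarrow> real" and g :: "'b \<Rightarrow> real"
  assumes "sigma_finite_measure M" "sigma_finite_measure N"
    and f: "integrable M f" and g: "integrable N g"
  shows "integrable (M \<Otimes>\<^sub>M N) (\<lambda>z. f (fst z) * g (snd z))"
    and "(\<integral>z. f (fst z) * g (snd z) \<partial>(M \<Otimes>\<^sub>M N)) = (\<integral>x. f x \<partial>M) * (\<integral>y. g y \<partial>N)"
proof -
  interpret pair_sigma_finite M N
    using assms(1,2) by (rule pair_sigma_finite.intro)
  have [measurable]: "f \<in> borel_measurable M" "g \<in> borel_measurable N"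
    using f g by (auto intro: borel_measurable_integrable)
  show int: "integrable (M \<Otimes>\<^sub>M N) (\<lambda>z. f (fst z) * g (snd z))"
  proof (rule Fubini_integrable)
    show "integrable M (\<lambda>x. \<integral>y. norm (f (fst (x, y)) * g (snd (x, y))) \<partial>N)"
      using f g by (simp add: abs_mult)
    show "AE x in M. integrable N (\<lambda>y. f (fst (x, y)) * g (snd (x, y)))"
      using g by simp
  qed measurable
  show "(\<integral>z. f (fst z) * g (snd z) \<partial>(M \<Otimes>\<^sub>M N)) = (\<integral>x. f x \<partial>M) * (\<integral>y. g y \<partial>N)"
    using integral_fst'[OF int] by simp
qed

lemma borel_measurable_sum_squares [measurable]:
  "(\<lambda>z :: real \<times> real. (fst z)\<^sup>2 + (snd z)\<^sup>2) \<in> borel_measurable borel"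
  by (intro borel_measurable_continuous_onI continuous_intros)

text \<open>Polar coordinates without a Jacobian: the disc |w|^2 < t has area \<pi> t for t > 0 and
  is empty otherwise, and the open half-lines generate the Borel sets. This is why the cutoffs and
  weights below are functions of the squared radius.\<close>

lemma distr_sum_squares:
  "distr (lborel :: (real \<times> real) measure) borel (\<lambda>z. (fst z)\<^sup>2 + (snd z)\<^sup>2)
     = density lborel (\<lambda>t. ennreal (pi * indicator {0<..} t))" (is "?M = ?N")
proof (rule measure_eqI_generator_eq)
  let ?E = "range (lessThan :: real \<Rightarrow> real set)"
  show "Int_stable ?E"
  proof (rule Int_stableI)
    fix A B assume "A \<in> ?E" "B \<in> ?E"
    then obtain a b where "A = {..<a}" "B = {..<b}" by auto
    then have "A \<inter> B = {..<min a b}" by auto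
    then show "A \<inter> B \<in> ?E" by blast
  qed
  show "?E \<subseteq> Pow UNIV" "sets ?M = sigma_sets UNIV ?E" "sets ?N = sigma_sets UNIV ?E"
    by (simp_all add: borel_Iio)
  show "range (\<lambda>n::nat. {..<real n}) \<subseteq> ?E" by auto
  show "(\<Union>n::nat. {..<real n}) = UNIV" using reals_Archimedean2 by auto
  have M: "emeasure ?M {..<t} = ennreal (pi * max 0 t)" for t
  proof -
    have "emeasure ?M {..<t} = emeasure lborel {z :: real \<times> real. (fst z)\<^sup>2 + (snd z)\<^sup>2 < t}"
      by (subst emeasure_distr) (auto intro!: arg_cong[of _ _ "emeasure lborel"])
    also have "{z :: real \<times> real. (fst z)\<^sup>2 + (snd z)\<^sup>2 < t} = ball 0 (sqrt (max 0 t))"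
      by (auto simp: norm_prod_def max_def not_le) (smt (verit) zero_le_power2)+
    also have "emeasure lborel \<dots> = ennreal (pi * max 0 t)"
      by (subst emeasure_ball) (auto simp: unit_ball_vol_2)
    finally show ?thesis .
  qed
  have N: "emeasure ?N {..<t} = ennreal (pi * max 0 t)" for t
  proof -
    have "emeasure ?N {..<t} = (\<integral>\<^sup>+x. ennreal (pi * indicator {0<..} x) * indicator {..<t} x \<partial>lborel)"
      by (subst emeasure_density) auto
    also have "\<dots> = (\<integral>\<^sup>+x. ennreal pi * indicator {0<..<t} x \<partial>lborel)"
      by (intro nn_integral_cong) (auto simp: indicator_def)
    also have "\<dots> = ennreal pi * emeasure lborel {0<..<t}"
      by (subst nn_integral_cmult_indicator) auto
    also have "\<dots> = ennreal (pi * max 0 t)"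
      by (cases "t \<ge> 0") (auto simp: ennreal_mult max_def)
    finally show ?thesis .
  qed
  show "emeasure ?M X = emeasure ?N X" if "X \<in> ?E" for X
    using that M N by auto
  show "emeasure ?M {..<real i} \<noteq> \<infinity>" for i :: nat
    using M by simp
qed

text \<open>Presents space as plane times line, so that product measure arguments apply. Both
  measures give a box the product of its side lengths, which determines Lebesgue measure.\<close>

lemma lborel_vec3:
  "(lborel :: (real ^ 3) measure) =
     distr (lborel :: ((real \<times> real) \<times> real) measure) borel
       (\<lambda>z. vector [fst (fst z), snd (fst z), snd z])" (is "_ = distr _ _ ?T")
proof (rule lborel_eqI)
  have [measurable]: "?T \<in> borel \<rightarrow>\<^sub>M borel"
    unfolding vector_3_axis by (intro borel_measurable_continuous_onI continuous_intros)
  fix l u :: "real ^ 3" assume lu: "\<And>b. b \<in> Basis \<Longrightarrow> l \<bullet> b \<le> u \<bullet> b"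
  have le: "l $ i \<le> u $ i" for i
    using lu[of "axis i 1"] by (simp add: inner_axis)
  have "emeasure (distr lborel borel ?T) (box l u)
    = emeasure lborel (({l $ 1<..<u $ 1} \<times> {l $ 2<..<u $ 2}) \<times> {l $ 3<..<u $ 3})"
    by (subst emeasure_distr)
       (auto simp: mem_box_cart forall_3 intro!: arg_cong[of _ _ "emeasure lborel"])
  also have "\<dots> = ennreal (u $ 1 - l $ 1) * ennreal (u $ 2 - l $ 2) * ennreal (u $ 3 - l $ 3)"
    using le by (simp add: lborel_prod[symmetric] lborel.emeasure_pair_measure_Times)
  also have "\<dots> = (\<Prod>b\<in>Basis. (u - l) \<bullet> b)"
  proof -
    have "(\<Prod>b\<in>Basis. (u - l) \<bullet> b) = (\<Prod>i\<in>UNIV. (u - l) $ i)"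
    proof -
      show ?thesis unfolding Basis_vec_real
        by (simp add: prod.reindex inj_on_def axis_eq_axis inner_axis)
    qed
    also have "\<dots> = (u $ 1 - l $ 1) * (u $ 2 - l $ 2) * (u $ 3 - l $ 3)"
      by (simp add: prod_3)
    finally show ?thesis using le by (simp add: ennreal_mult)
  qed
  finally show "emeasure (distr lborel borel ?T) (box l u) = (\<Prod>b\<in>Basis. (u - l) \<bullet> b)" .
qed simp

text \<open>Fubini, with the planar factor pushed forward to the half-line of squared radii. It
  serves twice: for the integrable weight near the axis and for the mass 2 \<pi> of the limiting
  flux.\<close>

lemma integral_axisymmetric:
  fixes h k :: "real \<Rightarrow> real"
  assumes h: "set_integrable lborel {0<..} h" and k: "integrable lborel k"
    and [measurable]: "h \<in> borel_measurable borel"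
  shows "integrable lborel (\<lambda>x :: real ^ 3. h ((x $ 1)\<^sup>2 + (x $ 2)\<^sup>2) * k (x $ 3))" (is ?int)
    and "(\<integral>x. h ((x $ 1)\<^sup>2 + (x $ 2)\<^sup>2) * k (x $ 3) \<partial>(lborel :: (real ^ 3) measure))
       = pi * (LINT t:{0<..}|lborel. h t) * (\<integral>z. k z \<partial>lborel)" (is ?eq)
proof -
  have [measurable]: "k \<in> borel_measurable borel" using k by auto
  let ?T = "\<lambda>z :: (real \<times> real) \<times> real. vector [fst (fst z), snd (fst z), snd z] :: real ^ 3"
  have [measurable]: "?T \<in> borel \<rightarrow>\<^sub>M borel"
    unfolding vector_3_axis by (intro borel_measurable_continuous_onI continuous_intros)
  let ?H = "\<lambda>w :: real \<times> real. h ((fst w)\<^sup>2 + (snd w)\<^sup>2)"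
  let ?q = "\<lambda>w :: real \<times> real. (fst w)\<^sup>2 + (snd w)\<^sup>2"
  have 1: "integrable (distr lborel borel ?q) h"
    unfolding distr_sum_squares using h
    by (subst integrable_real_density)
       (auto simp: set_integrable_def mult.commute mult.left_commute)
  then have H: "integrable lborel ?H"
    by (subst (asm) integrable_distr_eq) auto
  have "(\<integral>w. ?H w \<partial>lborel) = (\<integral>t. h t \<partial>distr lborel borel ?q)"
    by (subst integral_distr) auto
  also have "\<dots> = pi * (LINT t:{0<..}|lborel. h t)"
    unfolding distr_sum_squares
    by (subst integral_real_density)
       (auto simp: set_lebesgue_integral_def mult.assoc simp flip: integral_mult_right_zero)
  finally have H_eq: "(\<integral>w. ?H w \<partial>lborel) = pi * (LINT t:{0<..}|lborel. h t)" .
  note P = integral_mult_pair[OF lborel.sigma_finite_measure_axioms lborel.sigma_finite_measure_axioms H k,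
     unfolded lborel_prod]
  let ?f = "\<lambda>x :: real ^ 3. h ((x $ 1)\<^sup>2 + (x $ 2)\<^sup>2) * k (x $ 3)"
  have [measurable]: "?f \<in> borel_measurable borel" by measurable
  have comp: "?f (?T z) = h ((fst (fst z))\<^sup>2 + (snd (fst z))\<^sup>2) * k (snd z)" for z
    by simp
  show ?int
    by (subst lborel_vec3, subst integrable_distr_eq) (use P(1) in \<open>auto simp: comp\<close>)
  have "(\<integral>x. ?f x \<partial>lborel) = (\<integral>z. ?f (?T z) \<partial>lborel)"
    by (subst lborel_vec3, subst integral_distr) auto
  also have "\<dots> = pi * (LINT t:{0<..}|lborel. h t) * (\<integral>z. k z \<partial>lborel)"
    using P(2) unfolding H_eq comp by simp
  finally show ?eq .
qed

lemma integral_scale_horizontal: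
  fixes f :: "real ^ 3 \<Rightarrow> real"
  assumes "\<epsilon> > 0" and [measurable]: "f \<in> borel_measurable borel"
  shows "(\<integral>x. f x \<partial>lborel) = \<epsilon>\<^sup>2 * (\<integral>y. f (vector [\<epsilon> * y $ 1, \<epsilon> * y $ 2, y $ 3]) \<partial>(lborel :: (real ^ 3) measure))"
proof -
  \<comment> \<open>One stretching factor per basis vector, the form in which the affine change of
    variables is available: the horizontal axes are scaled, the third is kept, and the determinant
    is \<open>\<epsilon>\<^sup>2\<close>.\<close>
  define c :: "real ^ 3 \<Rightarrow> real" where "c j = (if j = axis 3 1 then 1 else \<epsilon>)" for j
  define T where "T x = 0 + (\<Sum>j\<in>Basis. (c j * (x \<bullet> j)) *\<^sub>R j)" for x :: "real ^ 3"
  have T: "T x = vector [\<epsilon> * x $ 1, \<epsilon> * x $ 2, x $ 3]" for x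
  proof -
    have "T x = (\<Sum>i\<in>UNIV. (c (axis i 1) * x $ i) *\<^sub>R axis i 1)"
      unfolding T_def Basis_vec_real
      by (simp add: sum.reindex inj_on_def axis_eq_axis inner_axis)
    then show ?thesis
      unfolding vector_3_axis sum_3 by (simp add: c_def axis_eq_axis)
  qed
  have prodc: "(\<Prod>j\<in>Basis. \<bar>c j\<bar>) = \<epsilon>\<^sup>2"
    unfolding Basis_vec_real
    using assms(1)
    by (subst prod.reindex) (auto simp: inj_on_def axis_eq_axis prod_3 c_def power2_eq_square)
  have lb: "lborel = density (distr lborel borel T) (\<lambda>_. ennreal (\<epsilon>\<^sup>2))"
    using lborel_affine_euclidean[of c 0] assms(1) unfolding T_def[abs_def] prodc[symmetric]
    by (simp add: c_def)
  have [measurable]: "T \<in> borel \<rightarrow>\<^sub>M borel"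
    unfolding T_def[abs_def] by simp
  have "(\<integral>x. f x \<partial>lborel) = (\<integral>x. \<epsilon>\<^sup>2 * f x \<partial>distr lborel borel T)"
    by (subst lb, subst integral_real_density) auto
  also have "\<dots> = (\<integral>x. \<epsilon>\<^sup>2 * f (T x) \<partial>lborel)"
    by (subst integral_distr) auto
  finally show ?thesis by (simp add: T)
qed

text \<open>By translation invariance every difference quotient of \<open>F\<close> has integral 0.\<close>

lemma integral_directional_derivative_0:
  fixes F :: "'a::euclidean_space \<Rightarrow> real"
  assumes F: "\<And>x. (F has_derivative F' x) (at x)"
    and D: "continuous_on UNIV (\<lambda>x. F' x e)"
    and T: "compact T" "\<And>x. x \<notin> T \<Longrightarrow> F x = 0"
  shows "integrable lborel (\<lambda>x. F' x e)" and "(\<integral>x. F' x e \<partial>lborel) = 0"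
proof -
  have F'0: "F' x e = 0" if "x \<notin> T" for x
  proof -
    have "open (- T)" using T(1) by (simp add: compact_imp_closed open_Compl)
    then have "(F has_derivative (\<lambda>_. 0)) (at x)"
      using T(2) that by (intro has_derivative_transform_within_open[OF has_derivative_const]) auto
    then show ?thesis using F has_derivative_unique by metis
  qed
  have cF: "continuous_on UNIV F"
    using F by (meson continuous_at_imp_continuous_on has_derivative_continuous)
  have [measurable]: "F \<in> borel_measurable borel" "(\<lambda>x. F' x e) \<in> borel_measurable borel"
    using cF D by (auto intro: borel_measurable_continuous_onI)
  have cs: "compact ((\<lambda>x. F' x e) ` T)"
    using compact_continuous_image[OF continuous_on_subset[OF D] T(1)] by auto
  obtain B where B: "\<And>x. \<bar>F' x e\<bar> \<le> B" "B \<ge> 0"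
  proof -
    obtain B where B: "\<And>y. y \<in> (\<lambda>x. F' x e) ` T \<Longrightarrow> norm y \<le> B" using compact_imp_bounded[OF cs] bounded_iff by metis
    show thesis
    proof (rule that[of "\<bar>B\<bar>"])
      fix x show "\<bar>F' x e\<bar> \<le> \<bar>B\<bar>"
        using B[of "F' x e"] F'0[of x] by (cases "x \<in> T") auto
    qed simp
  qed
  obtain R where R: "\<And>x. x \<in> T \<Longrightarrow> norm x \<le> R" using compact_imp_bounded[OF T(1)] bounded_iff by metis
  \<comment> \<open>A constant on a ball majorises all difference quotients. Their step length is at
    most 1, so \<open>norm e\<close> added to the bound \<open>R\<close> for \<open>T\<close> leaves
    room for the shifted point.\<close>
  define w where "w x = B * indicator (cball 0 (R + norm e)) x" for x :: 'a
  have w: "integrable lborel w"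
    unfolding w_def using emeasure_lborel_cball_finite[of "0::'a" "R + norm e"]
    by (auto intro!: integrable_mult_right integrable_real_indicator)
  define t where "t n = inverse (real (Suc n))" for n
  have t: "0 < t n" "t n \<le> 1" for n by (auto simp: t_def field_simps)
  have t0: "t \<longlonglongrightarrow> 0" unfolding t_def by (rule LIMSEQ_inverse_real_of_nat)
  define s where "s n x = (F (x + t n *\<^sub>R e) - F x) / t n" for n x
  have line: "((\<lambda>r. F (x + r *\<^sub>R e)) has_derivative (\<lambda>h. h * F' (x + r *\<^sub>R e) e)) (at r)" for x r
  proof -
    interpret bounded_linear "F' (x + r *\<^sub>R e)" using F has_derivative_bounded_linear by blast
    have "((\<lambda>r. x + r *\<^sub>R e) has_derivative (\<lambda>h. h *\<^sub>R e)) (at r)"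
      by (auto intro!: derivative_eq_intros)
    from has_derivative_compose[OF this F] show ?thesis
      by (simp add: scaleR)
  qed
  have s_lim: "(\<lambda>n. s n x) \<longlonglongrightarrow> F' x e" for x
  proof -
    have "((\<lambda>r. F (x + r *\<^sub>R e)) has_real_derivative F' x e) (at 0)"
      using line[of x 0] by (simp add: has_field_derivative_def mult.commute[of _ "F' x e"] fun_eq_iff)
    then have "((\<lambda>r. (F (x + (0 + r) *\<^sub>R e) - F (x + 0 *\<^sub>R e)) / r) \<longlongrightarrow> F' x e) (at 0)"
      unfolding DERIV_def .
    then have "((\<lambda>r. (F (x + r *\<^sub>R e) - F x) / r) \<longlongrightarrow> F' x e) (at 0)" by simp
    moreover have "filterlim t (at 0) sequentially"
      using t0 t(1) by (auto simp: filterlim_at intro!: always_eventually) (metis less_irrefl)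
    ultimately show ?thesis
      unfolding s_def by (rule filterlim_compose)
  qed
  \<comment> \<open>The mean value theorem turns each difference quotient into a value of the
    derivative at an intermediate point, so the bound \<open>B\<close> for the derivative
    applies.\<close>
  have s_bound: "norm (s n x) \<le> w x" for n x
  proof -
    have tn: "t n > 0" "t n \<le> 1" by (rule t)+
    have "\<exists>z. 0 < z \<and> z < t n \<and> F (x + t n *\<^sub>R e) - F (x + 0 *\<^sub>R e) = (t n - 0) * F' (x + z *\<^sub>R e) e"
    proof -
      have "\<exists>z. 0 < z \<and> z < t n \<and> F (x + t n *\<^sub>R e) - F (x + 0 *\<^sub>R e) = (\<lambda>h. h * F' (x + z *\<^sub>R e) e) (t n - 0)"
        by (rule mvt[OF tn(1)])
           (auto intro!: has_derivative_at_withinI[OF line] continuous_at_imp_continuous_on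
             has_derivative_continuous[OF line])
      then show ?thesis by simp
    qed
    then obtain z where z: "0 < z" "z < t n" "s n x = F' (x + z *\<^sub>R e) e"
      using tn by (auto simp: s_def)
    show ?thesis
    proof (cases "norm x \<le> R + norm e")
      case True
      then show ?thesis using z B by (simp add: w_def)
    next
      case False
      have "norm x \<le> norm (x + z *\<^sub>R e) + norm e"
      proof -
        have "norm x \<le> norm (x + z *\<^sub>R e) + norm (z *\<^sub>R e)"
          using norm_triangle_ineq4[of "x + z *\<^sub>R e" "z *\<^sub>R e"] by simp
        also have "norm (z *\<^sub>R e) \<le> norm e"
          using z tn by (simp add: mult_left_le_one_le)
        finally show ?thesis by simp
      qed
      then have "x + z *\<^sub>R e \<notin> T" using False R by force
      then show ?thesis using z F'0 False B by (simp add: w_def)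
    qed
  qed
  have Fi: "integrable lborel F"
  proof -
    obtain C where C: "\<And>y. y \<in> F ` T \<Longrightarrow> norm y \<le> C"
      using compact_imp_bounded[OF compact_continuous_image[OF continuous_on_subset[OF cF] T(1)]] bounded_iff by (metis top_greatest)
    have "integrable lborel (\<lambda>x. \<bar>C\<bar> * indicator (cball 0 R) (x :: 'a))"
      using emeasure_lborel_cball_finite[of "0::'a" R]
      by (auto intro!: integrable_mult_right integrable_real_indicator)
    then show ?thesis
    proof (rule Bochner_Integration.integrable_bound)
      show "AE x in lborel. norm (F x) \<le> norm (\<bar>C\<bar> * indicator (cball 0 R) x)"
      proof (intro always_eventually allI)
        fix x show "norm (F x) \<le> norm (\<bar>C\<bar> * indicator (cball 0 R) x)"
          using C[of "F x"] T(2)[of x] R[of x] by (cases "x \<in> T") auto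
      qed
    qed measurable
  qed
  have Ft: "integrable lborel (\<lambda>x. F (x + r *\<^sub>R e))" "(\<integral>x. F (x + r *\<^sub>R e) \<partial>lborel) = (\<integral>x. F x \<partial>lborel)" for r
  proof -
    have "integrable (distr lborel borel ((+) (r *\<^sub>R e))) F"
      using Fi by (simp add: lborel_distr_plus)
    then show "integrable lborel (\<lambda>x. F (x + r *\<^sub>R e))"
      by (subst (asm) integrable_distr_eq) (auto simp: add.commute)
    have "(\<integral>x. F x \<partial>lborel) = (\<integral>x. F x \<partial>distr lborel borel ((+) (r *\<^sub>R e)))"
      by (simp add: lborel_distr_plus)
    also have "\<dots> = (\<integral>x. F (x + r *\<^sub>R e) \<partial>lborel)"
      by (subst integral_distr) (auto simp: add.commute)
    finally show "(\<integral>x. F (x + r *\<^sub>R e) \<partial>lborel) = (\<integral>x. F x \<partial>lborel)" ..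
  qed
  have s_int: "(\<integral>x. s n x \<partial>lborel) = 0" for n
    unfolding s_def using Ft Fi by simp
  have [measurable]: "s n \<in> borel_measurable lborel" for n
    unfolding s_def[abs_def] by measurable
  show "integrable lborel (\<lambda>x. F' x e)"
    by (rule integrable_dominated_convergence[OF _ _ w, of _ s]) (use s_lim s_bound in auto)
  have "(\<lambda>n. \<integral>x. s n x \<partial>lborel) \<longlonglongrightarrow> (\<integral>x. F' x e \<partial>lborel)"
    by (rule integral_dominated_convergence[OF _ _ w]) (use s_lim s_bound in auto)
  then show "(\<integral>x. F' x e \<partial>lborel) = 0"
    unfolding s_int by (simp add: LIMSEQ_const_iff)
qed

subsection \<open>The equations for the profile\<close>

lemma has_derivative_partial_deriv:
  fixes f :: "real ^ 'n::finite \<Rightarrow> 'b::real_normed_vector"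
  assumes "f differentiable (at x)"
  shows "(f has_derivative (\<lambda>h. \<Sum>i\<in>UNIV. h $ i *\<^sub>R partial_deriv i f x)) (at x)"
proof -
  have f: "(f has_derivative frechet_derivative f (at x)) (at x)"
    using assms by (simp add: frechet_derivative_works)
  then interpret bounded_linear "frechet_derivative f (at x)" by (rule has_derivative_bounded_linear)
  have "frechet_derivative f (at x) h = (\<Sum>i\<in>UNIV. h $ i *\<^sub>R partial_deriv i f x)" for h
  proof -
    have "frechet_derivative f (at x) h = frechet_derivative f (at x) (\<Sum>i\<in>UNIV. h $ i *\<^sub>R axis i 1)"
      by (simp add: basis_expansion flip: scalar_mult_eq_scaleR)
    then show ?thesis by (simp add: sum scaleR partial_deriv_def)
  qed
  then have "frechet_derivative f (at x) = (\<lambda>h. \<Sum>i\<in>UNIV. h $ i *\<^sub>R partial_deriv i f x)" by auto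
  with f show ?thesis by simp
qed

lemma partial_deriv_eqI:
  assumes "(f has_derivative f') (at x)"
  shows "partial_deriv i f x = f' (axis i 1)"
  using frechet_derivative_at[OF assms] by (simp add: partial_deriv_def)

lemma has_vector_derivative_along:
  fixes f :: "real ^ 'n::finite \<Rightarrow> 'b::real_normed_vector"
  assumes "f differentiable (at (\<gamma> t))" "(\<gamma> has_vector_derivative v) (at t)"
  shows "((\<lambda>t. f (\<gamma> t)) has_vector_derivative (\<Sum>i\<in>UNIV. v $ i *\<^sub>R partial_deriv i f (\<gamma> t))) (at t)"
proof -
  have "((\<lambda>t. f (\<gamma> t)) has_derivative (\<lambda>h. \<Sum>i\<in>UNIV. (h *\<^sub>R v) $ i *\<^sub>R partial_deriv i f (\<gamma> t))) (at t)"
    using has_derivative_compose[OF assms(2)[unfolded has_vector_derivative_def] has_derivative_partial_deriv[OF assms(1)]] .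
  then show ?thesis
    unfolding has_vector_derivative_def
    by (rule has_derivative_eq_rhs) (simp add: fun_eq_iff scaleR_sum_right)
qed

lemma partial_deriv_nth:
  assumes "f differentiable (at x)"
  shows "partial_deriv i (\<lambda>y. f y $ j) x = partial_deriv i f x $ j"
proof -
  have "((\<lambda>y. f y $ j) has_derivative (\<lambda>h. frechet_derivative f (at x) h $ j)) (at x)"
    using assms by (intro bounded_linear.has_derivative[OF bounded_linear_vec_nth]) (simp add: frechet_derivative_works)
  from partial_deriv_eqI[OF this] show ?thesis by (simp add: partial_deriv_def)
qed

lemma smooth_on_partial_deriv: "smooth_on S f \<Longrightarrow> smooth_on S (partial_deriv i f)"
  unfolding smooth_on_def by (metis C_diff_on.simps(2))

lemma smooth_on_differentiable: "smooth_on S f \<Longrightarrow> x \<in> S \<Longrightarrow> f differentiable (at x)"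
  unfolding smooth_on_def by (metis C_diff_on.simps(2))

lemma smooth_on_continuous: "smooth_on S f \<Longrightarrow> continuous_on S f"
  unfolding smooth_on_def by (metis C_diff_on.simps(1))

section \<open>Rotations about the axis and cylindrical coordinates\<close>

definition rotate3 :: "real \<Rightarrow> real ^ 3 \<Rightarrow> real ^ 3"
  where "rotate3 \<theta> v = vector [cos \<theta> * v $ 1 - sin \<theta> * v $ 2, sin \<theta> * v $ 1 + cos \<theta> * v $ 2, v $ 3]"

text \<open>The infinitesimal generator of the rotations, that is, the cross product of the vertical
  unit vector with \<open>v\<close>.\<close>

definition turn3 :: "real ^ 3 \<Rightarrow> real ^ 3"
  where "turn3 v = vector [- v $ 2, v $ 1, 0]"

lemma rotate3_simps [simp]:
  "rotate3 \<theta> v $ 1 = cos \<theta> * v $ 1 - sin \<theta> * v $ 2"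
  "rotate3 \<theta> v $ 2 = sin \<theta> * v $ 1 + cos \<theta> * v $ 2"
  "rotate3 \<theta> v $ 3 = v $ 3"
  by (simp_all add: rotate3_def)

lemma turn3_simps [simp]: "turn3 v $ 1 = - v $ 2" "turn3 v $ 2 = v $ 1" "turn3 v $ 3 = 0"
  by (simp_all add: turn3_def)

lemma cyl_simps [simp]: "cyl r \<theta> z $ 1 = r * cos \<theta>" "cyl r \<theta> z $ 2 = r * sin \<theta>" "cyl r \<theta> z $ 3 = z"
  by (simp_all add: cyl_def)

lemma norm_vec3: "norm (v :: real ^ 3) = sqrt ((v $ 1)\<^sup>2 + (v $ 2)\<^sup>2 + (v $ 3)\<^sup>2)"
  by (simp add: norm_vec_def L2_set_def sum_3)

lemma norm_rotate3 [simp]: "norm (rotate3 \<theta> v) = norm v"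
proof -
  have "(cos \<theta> * v $ 1 - sin \<theta> * v $ 2)\<^sup>2 + (sin \<theta> * v $ 1 + cos \<theta> * v $ 2)\<^sup>2
    = ((cos \<theta>)\<^sup>2 + (sin \<theta>)\<^sup>2) * ((v $ 1)\<^sup>2 + (v $ 2)\<^sup>2)"
    by algebra
  then show ?thesis by (simp add: norm_vec3)
qed

lemma norm_turn3_le: "norm (turn3 v) \<le> norm v"
  by (simp add: norm_vec3)

lemma linear_turn3: "linear turn3"
  by (intro linearI) (simp_all add: vec_eq_iff forall_3)

lemma rotate3_scaleR: "rotate3 \<theta> (c *\<^sub>R v) = c *\<^sub>R rotate3 \<theta> v"
  by (simp add: vec_eq_iff forall_3 algebra_simps)

lemma rotate3_cyl: "rotate3 \<theta> (cyl r \<psi> z) = cyl r (\<theta> + \<psi>) z"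
  by (simp add: vec_eq_iff forall_3 sin_add cos_add algebra_simps)

lemma rotate3_rotate3: "rotate3 \<theta> (rotate3 \<psi> v) = rotate3 (\<theta> + \<psi>) v"
  by (simp add: vec_eq_iff forall_3 sin_add cos_add algebra_simps)

lemma rotate3_0 [simp]: "rotate3 0 v = v"
  by (simp add: vec_eq_iff forall_3)

lemma scaleR_cyl: "s *\<^sub>R cyl r \<theta> z = cyl (s * r) \<theta> (s * z)"
  by (simp add: vec_eq_iff forall_3)

lemma cyl_eq_axis: "cyl r \<theta> z = (r * cos \<theta>) *\<^sub>R axis 1 1 + (r * sin \<theta>) *\<^sub>R axis 2 1 + z *\<^sub>R axis 3 1"
  by (simp add: cyl_def vector_3_axis)

lemma radius_cyl [simp]: "radius (cyl r \<theta> z) = \<bar>r\<bar>"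
proof -
  have "(r * cos \<theta>)\<^sup>2 + (r * sin \<theta>)\<^sup>2 = r\<^sup>2"
    using sin_cos_squared_add[of \<theta>] by (simp add: power_mult_distrib flip: distrib_left)
  then show ?thesis by (simp add: radius_def)
qed

lemma radius_nonneg [simp]: "radius x \<ge> 0"
  by (simp add: radius_def)

lemma radius_eq_0_iff: "radius x = 0 \<longleftrightarrow> x \<in> x3_axis"
  by (simp add: radius_def x3_axis_def sum_power2_eq_zero_iff)

lemma radius_squared: "(radius x)\<^sup>2 = (x $ 1)\<^sup>2 + (x $ 2)\<^sup>2"
  by (simp add: radius_def)

lemma abs_nth_le_radius: "\<bar>x $ 1\<bar> \<le> radius x" "\<bar>x $ 2\<bar> \<le> radius x"
  by (auto simp: radius_def real_le_rsqrt)

lemma abs_horizontal_inner_le: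
  "\<bar>x $ 1 * v $ 1 + x $ 2 * v $ 2\<bar> \<le> 2 * (radius x * norm (v :: real ^ 3))"
proof -
  have "\<bar>x $ 1 * v $ 1\<bar> \<le> radius x * norm v" "\<bar>x $ 2 * v $ 2\<bar> \<le> radius x * norm v"
    unfolding abs_mult using abs_nth_le_radius[of x] component_le_norm_cart[of v]
    by (auto intro!: mult_mono)
  then show ?thesis by linarith
qed

lemma polar_form:
  obtains \<theta> where "x = cyl (radius x) \<theta> (x $ 3)"
proof (cases "radius x = 0")
  case True
  then have "x $ 1 = 0" "x $ 2 = 0" by (auto simp: radius_eq_0_iff x3_axis_def)
  then show thesis by (intro that[of 0]) (auto simp: vec_eq_iff forall_3 True)
next
  case False
  then have "(x $ 1 / radius x)\<^sup>2 + (x $ 2 / radius x)\<^sup>2 = 1"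
    by (simp add: power_divide flip: add_divide_distrib radius_squared)
  then obtain \<theta> where "x $ 1 / radius x = cos \<theta>" "x $ 2 / radius x = sin \<theta>"
    using sincos_total_2pi by metis
  then show thesis using False by (intro that[of \<theta>]) (auto simp: vec_eq_iff forall_3 field_simps)
qed

lemma continuous_on_radius [continuous_intros]: "continuous_on A radius"
  unfolding radius_def[abs_def] by (intro continuous_intros)

lemma open_Cone: "open (Cone \<delta>)"
proof -
  have "Cone \<delta> = {x. radius x < \<delta> * x $ 3} \<inter> {x. 0 < x $ 3}" by (auto simp: Cone_def)
  also have "open \<dots>" by (intro open_Int open_Collect_less continuous_intros)
  finally show ?thesis .
qed

lemma closed_x3_axis: "closed x3_axis"
proof -
  have "x3_axis = {x. radius x = 0}" by (auto simp: radius_eq_0_iff)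
  also have "closed \<dots>" by (intro closed_Collect_eq continuous_intros)
  finally show ?thesis .
qed

section \<open>Reduction of the flow to its profile\<close>

locale axisymmetric_homogeneous_flow =
  fixes \<delta> :: real and u :: "real ^ 3 \<Rightarrow> real ^ 3" and p :: "real ^ 3 \<Rightarrow> real"
  assumes \<delta>_pos: "\<delta> > 0"
    and smooth_u: "smooth_on (Cone \<delta> - x3_axis) u"
    and smooth_p: "smooth_on (Cone \<delta> - x3_axis) p"
    and homogeneous_u: "homogeneous_on (-1) (Cone \<delta> - x3_axis) u"
    and homogeneous_p: "homogeneous_on (-2) (Cone \<delta> - x3_axis) p"
    and axisymmetric: "axisymmetric_on (Cone \<delta> - x3_axis) u p"
    and navier_stokes: "navier_stokes_on (Cone \<delta> - x3_axis) u p"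
begin

definition S :: "(real ^ 3) set" where "S = Cone \<delta> - x3_axis"

lemmas flow = smooth_u smooth_p homogeneous_u homogeneous_p axisymmetric navier_stokes
lemmas flow_S = flow[folded S_def]

lemma open_S: "open S"
  using open_Cone closed_x3_axis by (simp add: S_def open_Diff)

lemma S_iff: "x \<in> S \<longleftrightarrow> 0 < radius x \<and> radius x < \<delta> * x $ 3"
proof -
  have "x $ 3 > 0" if "0 < radius x" "radius x < \<delta> * x $ 3"
    using that \<delta>_pos by (metis dual_order.strict_trans zero_less_mult_pos)
  then show ?thesis
    using radius_eq_0_iff[of x] radius_nonneg[of x] by (auto simp: S_def Cone_def less_le simp del: radius_nonneg)
qed

lemma cyl_in_S: "r > 0 \<Longrightarrow> cyl r \<theta> z \<in> S \<longleftrightarrow> r < \<delta> * z"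
  by (simp add: S_iff)

text \<open>\<open>f1\<close>, \<open>f2\<close> and \<open>P1\<close> are partial derivatives of
  the flow, the quantities in which the equations are written. That they are the derivatives of
  \<open>f\<close>, \<open>f1\<close> and \<open>P\<close> is then an instance of the chain rule
  along a horizontal ray.\<close>

definition f :: "real \<Rightarrow> real ^ 3" where "f \<rho> = u (cyl \<rho> 0 1)"
definition f1 :: "real \<Rightarrow> real ^ 3" where "f1 \<rho> = partial_deriv 1 u (cyl \<rho> 0 1)"
definition f2 :: "real \<Rightarrow> real ^ 3" where "f2 \<rho> = partial_deriv 1 (partial_deriv 1 u) (cyl \<rho> 0 1)"
definition P :: "real \<Rightarrow> real" where "P \<rho> = p (cyl \<rho> 0 1)"
definition P1 :: "real \<Rightarrow> real" where "P1 \<rho> = partial_deriv 1 p (cyl \<rho> 0 1)"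

lemma rho_component_cyl:
  "r > 0 \<Longrightarrow> rho_component v (cyl r \<theta> z) = v (cyl r \<theta> z) $ 1 * cos \<theta> + v (cyl r \<theta> z) $ 2 * sin \<theta>"
  by (simp add: rho_component_def inner_vec_def sum_3)

lemma phi_component_cyl:
  "r > 0 \<Longrightarrow> phi_component v (cyl r \<theta> z) = - v (cyl r \<theta> z) $ 1 * sin \<theta> + v (cyl r \<theta> z) $ 2 * cos \<theta>"
  by (simp add: phi_component_def inner_vec_def sum_3)

lemma u_cyl_rotate:
  assumes "0 < r" "r < \<delta> * z"
  shows "u (cyl r \<theta> z) = rotate3 \<theta> (u (cyl r 0 z))"
proof -
  let ?a = "u (cyl r \<theta> z)" and ?b = "u (cyl r 0 z)"
  have S: "cyl r \<theta> z \<in> S" "cyl r 0 z \<in> S" using assms by (simp_all add: cyl_in_S)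
  note ax = flow_S(5)[unfolded axisymmetric_on_def angle_independent_on_def]
  have "rho_component u (cyl r \<theta> z) = rho_component u (cyl r 0 z)"
    "phi_component u (cyl r \<theta> z) = phi_component u (cyl r 0 z)"
    using ax assms(1) S by blast+
  then have 1: "?a $ 1 * cos \<theta> + ?a $ 2 * sin \<theta> = ?b $ 1"
    and 2: "- ?a $ 1 * sin \<theta> + ?a $ 2 * cos \<theta> = ?b $ 2"
    using assms(1) by (simp_all add: rho_component_cyl phi_component_cyl)
  have 3: "?a $ 3 = ?b $ 3"
    using ax assms(1) S by blast
  have cs: "cos \<theta> * cos \<theta> = 1 - sin \<theta> * sin \<theta>"
    using sin_cos_squared_add[of \<theta>] by (simp add: power2_eq_square)
  show ?thesis
    unfolding vec_eq_iff forall_3 rotate3_simps 1[symmetric] 2[symmetric] 3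
    by (simp add: algebra_simps) (simp add: cs algebra_simps flip: mult.assoc)
qed

lemma p_cyl_rotate:
  assumes "0 < r" "r < \<delta> * z"
  shows "p (cyl r \<theta> z) = p (cyl r 0 z)"
  using flow_S(5)[unfolded axisymmetric_on_def angle_independent_on_def] assms cyl_in_S by meson

lemma u_scaleR: "x \<in> S \<Longrightarrow> s > 0 \<Longrightarrow> u (s *\<^sub>R x) = (1 / s) *\<^sub>R u x"
  using flow_S(3) by (auto simp: homogeneous_on_def powr_minus_divide)

lemma p_scaleR: "x \<in> S \<Longrightarrow> s > 0 \<Longrightarrow> p (s *\<^sub>R x) = (1 / s\<^sup>2) * p x"
  using flow_S(4) by (auto simp: homogeneous_on_def powr_minus_divide powr_numeral)

text \<open>Axisymmetry moves the point to the half-plane \<phi> = 0 and homogeneity moves it to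
  height 1. Every later statement about \<open>u\<close> near the axis becomes through this a
  statement about \<open>f\<close> near 0.\<close>

lemma u_cyl:
  assumes "0 < r" "r < \<delta> * z"
  shows "u (cyl r \<theta> z) = (1 / z) *\<^sub>R rotate3 \<theta> (f (r / z))"
proof -
  have z: "z > 0" using assms \<delta>_pos by (metis dual_order.strict_trans zero_less_mult_pos)
  have "cyl (r / z) 0 1 \<in> S" using assms z by (subst cyl_in_S) (auto simp: field_simps)
  from u_scaleR[OF this z] have "u (cyl r 0 z) = (1 / z) *\<^sub>R f (r / z)"
    using z by (simp add: scaleR_cyl f_def)
  then show ?thesis using u_cyl_rotate[OF assms, of \<theta>] by (simp add: rotate3_scaleR)
qed

lemma p_cyl:
  assumes "0 < r" "r < \<delta> * z"
  shows "p (cyl r \<theta> z) = (1 / z\<^sup>2) * P (r / z)"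
proof -
  have z: "z > 0" using assms \<delta>_pos by (metis dual_order.strict_trans zero_less_mult_pos)
  have "cyl (r / z) 0 1 \<in> S" using assms z by (subst cyl_in_S) (auto simp: field_simps)
  from p_scaleR[OF this z] have "p (cyl r 0 z) = (1 / z\<^sup>2) * P (r / z)"
    using z by (simp add: scaleR_cyl P_def)
  then show ?thesis using p_cyl_rotate[OF assms, of \<theta>] by simp
qed

lemma u_rotate3:
  assumes "x \<in> S" shows "u (rotate3 \<theta> x) = rotate3 \<theta> (u x)"
proof -
  obtain \<psi> where \<psi>: "x = cyl (radius x) \<psi> (x $ 3)" by (rule polar_form)
  have r: "0 < radius x" "radius x < \<delta> * x $ 3" using assms by (auto simp: S_iff)
  show ?thesis
    using u_cyl_rotate[OF r, of \<psi>] u_cyl_rotate[OF r, of "\<theta> + \<psi>"] rotate3_cyl[of \<theta> "radius x" \<psi> "x $ 3"]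
    unfolding \<psi>[symmetric] by (simp add: rotate3_rotate3)
qed

lemma differentiable_u [simp]: "x \<in> S \<Longrightarrow> u differentiable (at x)"
  and differentiable_du [simp]: "x \<in> S \<Longrightarrow> partial_deriv i u differentiable (at x)"
  and differentiable_p [simp]: "x \<in> S \<Longrightarrow> p differentiable (at x)"
  using flow_S(1,2) by (blast intro: smooth_on_differentiable smooth_on_partial_deriv)+

text \<open>Axisymmetry in infinitesimal form: both sides are derivatives at angle 0 of
  \<open>u (rotate3 \<theta> x) = rotate3 \<theta> (u x)\<close>. At points with
  \<open>x $ 2 = 0\<close> it gives \<open>partial_deriv 2 u x\<close> algebraically in terms of
  \<open>u x\<close>.\<close>

lemma rotation_identity:
  assumes x: "x \<in> S"
  shows "x $ 1 *\<^sub>R partial_deriv 2 u x - x $ 2 *\<^sub>R partial_deriv 1 u x = turn3 (u x)"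
proof -
  have d: "((\<lambda>\<theta>. rotate3 \<theta> v) has_vector_derivative turn3 v) (at 0)" for v :: "real ^ 3"
    unfolding rotate3_def turn3_def vector_3_axis
    by (auto intro!: derivative_eq_intros simp: has_vector_derivative_def vec_eq_iff forall_3 axis_def)
  have "((\<lambda>\<theta>. u (rotate3 \<theta> x)) has_vector_derivative
      (\<Sum>i\<in>UNIV. turn3 x $ i *\<^sub>R partial_deriv i u (rotate3 0 x))) (at 0)"
    by (rule has_vector_derivative_along) (use x d in auto)
  then have "((\<lambda>\<theta>. rotate3 \<theta> (u x)) has_vector_derivative
      (\<Sum>i\<in>UNIV. turn3 x $ i *\<^sub>R partial_deriv i u x)) (at 0)"
    using x by (simp add: u_rotate3)
  from vector_derivative_unique_at[OF this d] show ?thesis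
    by (simp add: sum_3)
qed

lemma has_vector_derivative_f: "0 < \<rho> \<Longrightarrow> \<rho> < \<delta> \<Longrightarrow> (f has_vector_derivative f1 \<rho>) (at \<rho>)"
  and has_vector_derivative_f1: "0 < \<rho> \<Longrightarrow> \<rho> < \<delta> \<Longrightarrow> (f1 has_vector_derivative f2 \<rho>) (at \<rho>)"
  and has_vector_derivative_P: "0 < \<rho> \<Longrightarrow> \<rho> < \<delta> \<Longrightarrow> (P has_vector_derivative P1 \<rho>) (at \<rho>)"
proof -
  assume \<rho>: "0 < \<rho>" "\<rho> < \<delta>"
  have q: "((\<lambda>\<rho>. cyl \<rho> 0 1) has_vector_derivative axis 1 1) (at \<rho>)"
    unfolding cyl_eq_axis
    by (auto intro!: derivative_eq_intros simp: has_vector_derivative_def)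
  have S: "cyl \<rho> 0 1 \<in> S" using \<rho> by (subst cyl_in_S) auto
  show "(f has_vector_derivative f1 \<rho>) (at \<rho>)"
    using has_vector_derivative_along[OF _ q, of u] S
    by (simp add: f_def[abs_def] f1_def sum_3 axis_def)
  show "(f1 has_vector_derivative f2 \<rho>) (at \<rho>)"
    using has_vector_derivative_along[OF _ q, of "partial_deriv 1 u"] S
    by (simp add: f1_def[abs_def] f2_def sum_3 axis_def)
  show "(P has_vector_derivative P1 \<rho>) (at \<rho>)"
    using has_vector_derivative_along[OF _ q, of p] S
    by (simp add: P_def[abs_def] P1_def sum_3 axis_def)
qed

lemma vertical_curve: "((\<lambda>z. cyl \<rho> 0 z) has_vector_derivative axis 3 1) (at z)"
  unfolding cyl_eq_axis
  by (auto intro!: derivative_eq_intros simp: has_vector_derivative_def)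

lemma has_vector_derivative_profile:
  fixes h :: "real \<Rightarrow> 'b::real_normed_vector"
  assumes "(h has_vector_derivative h') (at (\<rho> / z))" "z > 0"
  shows "((\<lambda>z. h (\<rho> / z)) has_vector_derivative (- \<rho> / z\<^sup>2) *\<^sub>R h') (at z)"
proof -
  have "((\<lambda>z. \<rho> / z) has_vector_derivative (- \<rho> / z\<^sup>2)) (at z)"
    using assms(2) unfolding has_real_derivative_iff_has_vector_derivative[symmetric]
    by (auto intro!: derivative_eq_intros simp: power2_eq_square)
  from vector_diff_chain_at[OF this assms(1)] show ?thesis by (simp add: o_def)
qed

text \<open>Differentiate \<open>(1 / z) *\<^sub>R f (\<rho> / z)\<close> along a vertical line. All
  heights are covered, not only \<open>z = 1\<close>, because the formula is differentiated once
  more to obtain the second vertical derivative.\<close>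

lemma partial_deriv_3_u:
  assumes "0 < \<rho>" "\<rho> < \<delta> * z"
  shows "partial_deriv 3 u (cyl \<rho> 0 z) = - (1 / z\<^sup>2) *\<^sub>R (f (\<rho> / z) + (\<rho> / z) *\<^sub>R f1 (\<rho> / z))"
proof -
  have z: "z > 0" using assms \<delta>_pos by (metis dual_order.strict_trans zero_less_mult_pos)
  have \<rho>z: "0 < \<rho> / z" "\<rho> / z < \<delta>" using assms z by (auto simp: field_simps)
  have S: "cyl \<rho> 0 z \<in> S" using assms by (subst cyl_in_S) auto
  have "((\<lambda>z. u (cyl \<rho> 0 z)) has_vector_derivative partial_deriv 3 u (cyl \<rho> 0 z)) (at z)"
    using has_vector_derivative_along[OF _ vertical_curve, of u \<rho> z] S
    by (simp add: sum_3 axis_def)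
  moreover have "((\<lambda>z. u (cyl \<rho> 0 z)) has_vector_derivative
     - (1 / z\<^sup>2) *\<^sub>R f (\<rho> / z) + (1 / z) *\<^sub>R ((- \<rho> / z\<^sup>2) *\<^sub>R f1 (\<rho> / z))) (at z)"
  \<comment> \<open>These are exactly the heights \<open>y\<close> with
    \<open>\<rho> < \<delta> * y\<close>, at which the point stays in the cone and the scaling
    formula holds.\<close>
  proof (rule has_vector_derivative_transform_within_open[where S = "{\<rho> / \<delta><..}"])
    have "((\<lambda>z. 1 / z) has_real_derivative - (1 / z\<^sup>2)) (at z)"
      using z by (auto intro!: derivative_eq_intros simp: power2_eq_square)
    from has_vector_derivative_scaleR[OF this has_vector_derivative_profile[OF has_vector_derivative_f[OF \<rho>z] z]]
    show "((\<lambda>z. (1 / z) *\<^sub>R f (\<rho> / z)) has_vector_derivative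
       - (1 / z\<^sup>2) *\<^sub>R f (\<rho> / z) + (1 / z) *\<^sub>R ((- \<rho> / z\<^sup>2) *\<^sub>R f1 (\<rho> / z))) (at z)"
      by (simp add: add.commute)
    show "z \<in> {\<rho> / \<delta><..}" using assms \<delta>_pos by (simp add: field_simps)
    show "(1 / y) *\<^sub>R f (\<rho> / y) = u (cyl \<rho> 0 y)" if "y \<in> {\<rho> / \<delta><..}" for y
      using that \<delta>_pos assms(1) u_cyl[of \<rho> y 0] by (simp add: field_simps)
  qed simp
  ultimately have "partial_deriv 3 u (cyl \<rho> 0 z) =
     - (1 / z\<^sup>2) *\<^sub>R f (\<rho> / z) + (1 / z) *\<^sub>R ((- \<rho> / z\<^sup>2) *\<^sub>R f1 (\<rho> / z))"
    by (rule vector_derivative_unique_at)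
  also have "\<dots> = - (1 / z\<^sup>2) *\<^sub>R (f (\<rho> / z) + (\<rho> / z) *\<^sub>R f1 (\<rho> / z))"
    by (simp add: scaleR_add_right)
  finally show ?thesis .
qed

lemma partial_deriv_33_u:
  assumes \<rho>: "0 < \<rho>" "\<rho> < \<delta>"
  shows "partial_deriv 3 (partial_deriv 3 u) (cyl \<rho> 0 1) = 2 *\<^sub>R f \<rho> + (4 * \<rho>) *\<^sub>R f1 \<rho> + \<rho>\<^sup>2 *\<^sub>R f2 \<rho>"
proof -
  have S: "cyl \<rho> 0 1 \<in> S" using \<rho> by (subst cyl_in_S) auto
  have "((\<lambda>z. partial_deriv 3 u (cyl \<rho> 0 z)) has_vector_derivative
      partial_deriv 3 (partial_deriv 3 u) (cyl \<rho> 0 1)) (at 1)"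
    using has_vector_derivative_along[OF _ vertical_curve, of "partial_deriv 3 u" \<rho> 1] S
    by (simp add: sum_3 axis_def)
  moreover have "((\<lambda>z. partial_deriv 3 u (cyl \<rho> 0 z)) has_vector_derivative
      2 *\<^sub>R (f \<rho> + \<rho> *\<^sub>R f1 \<rho>) - ((- \<rho>) *\<^sub>R f1 \<rho> + ((- \<rho>) *\<^sub>R f1 \<rho> + \<rho> *\<^sub>R (- \<rho>) *\<^sub>R f2 \<rho>))) (at 1)"
  proof (rule has_vector_derivative_transform_within_open[where S = "{\<rho> / \<delta><..}"])
    have a: "((\<lambda>z. - (1 / z\<^sup>2)) has_real_derivative 2) (at 1)"
      by (auto intro!: derivative_eq_intros simp: power2_eq_square)
    have b: "((\<lambda>z. \<rho> / z) has_real_derivative - \<rho>) (at 1)"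
      by (auto intro!: derivative_eq_intros simp: power2_eq_square)
    have c: "((\<lambda>z. f (\<rho> / z)) has_vector_derivative (- \<rho>) *\<^sub>R f1 \<rho>) (at 1)"
      using has_vector_derivative_profile[of f "f1 \<rho>" \<rho> 1] has_vector_derivative_f[OF \<rho>] by simp
    have d: "((\<lambda>z. f1 (\<rho> / z)) has_vector_derivative (- \<rho>) *\<^sub>R f2 \<rho>) (at 1)"
      using has_vector_derivative_profile[of f1 "f2 \<rho>" \<rho> 1] has_vector_derivative_f1[OF \<rho>] by simp
    from has_vector_derivative_scaleR[OF a has_vector_derivative_add[OF c has_vector_derivative_scaleR[OF b d]]]
    show "((\<lambda>z. - (1 / z\<^sup>2) *\<^sub>R (f (\<rho> / z) + (\<rho> / z) *\<^sub>R f1 (\<rho> / z))) has_vector_derivative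
      2 *\<^sub>R (f \<rho> + \<rho> *\<^sub>R f1 \<rho>) - ((- \<rho>) *\<^sub>R f1 \<rho> + ((- \<rho>) *\<^sub>R f1 \<rho> + \<rho> *\<^sub>R (- \<rho>) *\<^sub>R f2 \<rho>))) (at 1)"
      by (simp add: algebra_simps)
    show "1 \<in> {\<rho> / \<delta><..}" using assms \<delta>_pos by (simp add: field_simps)
    show "- (1 / y\<^sup>2) *\<^sub>R (f (\<rho> / y) + (\<rho> / y) *\<^sub>R f1 (\<rho> / y)) = partial_deriv 3 u (cyl \<rho> 0 y)"
      if "y \<in> {\<rho> / \<delta><..}" for y
      using that \<delta>_pos assms(1) partial_deriv_3_u[of \<rho> y] by (simp add: field_simps)
  qed simp
  ultimately have "partial_deriv 3 (partial_deriv 3 u) (cyl \<rho> 0 1) =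
      2 *\<^sub>R (f \<rho> + \<rho> *\<^sub>R f1 \<rho>) - ((- \<rho>) *\<^sub>R f1 \<rho> + ((- \<rho>) *\<^sub>R f1 \<rho> + \<rho> *\<^sub>R (- \<rho>) *\<^sub>R f2 \<rho>))"
    by (rule vector_derivative_unique_at)
  then show ?thesis
    by (simp add: vec_eq_iff power2_eq_square algebra_simps)
qed

lemma partial_deriv_2_u:
  assumes \<rho>: "0 < \<rho>" "\<rho> < \<delta>"
  shows "partial_deriv 2 u (cyl \<rho> 0 1) = (1 / \<rho>) *\<^sub>R turn3 (f \<rho>)"
proof -
  have "cyl \<rho> 0 1 \<in> S" using \<rho> by (subst cyl_in_S) auto
  from rotation_identity[OF this] have "\<rho> *\<^sub>R partial_deriv 2 u (cyl \<rho> 0 1) = turn3 (f \<rho>)"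
    by (simp add: f_def)
  then show ?thesis using \<rho> by (metis divide_inverse less_irrefl mult_1 scaleR_left_imp_eq scaleR_scaleR right_inverse scaleR_one inverse_eq_divide)
qed

text \<open>Differentiate the rotation identity in the second direction at a point with
  \<open>x $ 2 = 0\<close>. The mixed derivative is multiplied by 0, the product rule leaves
  \<open>f1\<close>, and \<open>turn3\<close> applied twice produces the terms - u/r^2 by which the
  cylindrical vector Laplacian differs from the scalar one in the horizontal components.\<close>

lemma partial_deriv_22_u:
  assumes \<rho>: "0 < \<rho>" "\<rho> < \<delta>"
  shows "\<rho> *\<^sub>R partial_deriv 2 (partial_deriv 2 u) (cyl \<rho> 0 1) = f1 \<rho> + (1 / \<rho>) *\<^sub>R turn3 (turn3 (f \<rho>))"
proof -
  let ?q = "cyl \<rho> 0 1"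
  have S: "?q \<in> S" using \<rho> by (subst cyl_in_S) auto
  define \<gamma> where "\<gamma> t = ?q + t *\<^sub>R axis 2 1" for t :: real
  have \<gamma>0 [simp]: "\<gamma> 0 = ?q" by (simp add: \<gamma>_def)
  have \<gamma>_nth [simp]: "\<gamma> t $ 1 = \<rho>" "\<gamma> t $ 2 = t" "\<gamma> t $ 3 = 1" for t by (simp_all add: \<gamma>_def axis_def)
  have \<gamma>': "(\<gamma> has_vector_derivative axis 2 1) (at 0)"
    unfolding \<gamma>_def[abs_def] by (auto intro!: derivative_eq_intros simp: has_vector_derivative_def)
  have along: "((\<lambda>t. h (\<gamma> t)) has_vector_derivative partial_deriv 2 h ?q) (at 0)"
    if "h differentiable (at ?q)" for h :: "real ^ 3 \<Rightarrow> real ^ 3"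
    using has_vector_derivative_along[OF _ \<gamma>', of h] that by (simp add: sum_3 axis_def)
  have J: "((\<lambda>t. turn3 (u (\<gamma> t))) has_vector_derivative turn3 (partial_deriv 2 u ?q)) (at 0)"
    using along[of u] S bounded_linear.has_vector_derivative[OF linear_conv_bounded_linear[THEN iffD1, OF linear_turn3]] by auto
  have "((\<lambda>t. turn3 (u (\<gamma> t))) has_vector_derivative
     \<rho> *\<^sub>R partial_deriv 2 (partial_deriv 2 u) ?q - partial_deriv 1 u ?q) (at 0)"
  proof (rule has_vector_derivative_transform_within_open[where S = "\<gamma> -` S"])
    have "((\<lambda>t. \<rho> *\<^sub>R partial_deriv 2 u (\<gamma> t) - t *\<^sub>R partial_deriv 1 u (\<gamma> t)) has_vector_derivative
      (\<rho> *\<^sub>R partial_deriv 2 (partial_deriv 2 u) ?q + 0 *\<^sub>R partial_deriv 2 u (\<gamma> 0))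
       - (0 *\<^sub>R partial_deriv 2 (partial_deriv 1 u) ?q + 1 *\<^sub>R partial_deriv 1 u (\<gamma> 0))) (at 0)"
      by (intro has_vector_derivative_diff has_vector_derivative_scaleR along derivative_eq_intros) (use S in auto)
    then show "((\<lambda>t. \<rho> *\<^sub>R partial_deriv 2 u (\<gamma> t) - t *\<^sub>R partial_deriv 1 u (\<gamma> t)) has_vector_derivative
      \<rho> *\<^sub>R partial_deriv 2 (partial_deriv 2 u) ?q - partial_deriv 1 u ?q) (at 0)"
      by simp
    show "open (\<gamma> -` S)" unfolding \<gamma>_def[abs_def]
      by (intro open_vimage[OF open_S] continuous_intros)
    show "0 \<in> \<gamma> -` S" using S by simp
    show "\<rho> *\<^sub>R partial_deriv 2 u (\<gamma> t) - t *\<^sub>R partial_deriv 1 u (\<gamma> t) = turn3 (u (\<gamma> t))" if "t \<in> \<gamma> -` S" for t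
      using rotation_identity[of "\<gamma> t"] that by simp
  qed
  from vector_derivative_unique_at[OF this J]
  have "\<rho> *\<^sub>R partial_deriv 2 (partial_deriv 2 u) ?q = f1 \<rho> + turn3 (partial_deriv 2 u ?q)"
    by (simp add: f1_def algebra_simps)
  then show ?thesis
    by (simp add: partial_deriv_2_u[OF \<rho>] linear_scale[OF linear_turn3])
qed

lemma grad_p_profile:
  assumes \<rho>: "0 < \<rho>" "\<rho> < \<delta>"
  shows "grad p (cyl \<rho> 0 1) = vector [P1 \<rho>, 0, - 2 * P \<rho> - \<rho> * P1 \<rho>]"
proof -
  let ?q = "cyl \<rho> 0 1"
  have S: "?q \<in> S" using \<rho> by (subst cyl_in_S) auto
  have g2: "((\<lambda>\<theta>. cyl \<rho> \<theta> 1) has_vector_derivative \<rho> *\<^sub>R axis 2 1) (at 0)"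
    unfolding cyl_eq_axis by (auto intro!: derivative_eq_intros simp: has_vector_derivative_def fun_eq_iff)
  have "((\<lambda>\<theta>. p (cyl \<rho> \<theta> 1)) has_vector_derivative \<rho> * partial_deriv 2 p ?q) (at 0)"
    using has_vector_derivative_along[OF _ g2, of p] S by (simp add: sum_3 axis_def)
  moreover have "((\<lambda>\<theta>. p (cyl \<rho> \<theta> 1)) has_vector_derivative 0) (at 0)"
  proof -
    have "p (cyl \<rho> \<theta> 1) = p (cyl \<rho> 0 1)" for \<theta>
      using p_cyl_rotate[of \<rho> 1 \<theta>] \<rho> by simp
    then have "(\<lambda>\<theta>. p (cyl \<rho> \<theta> 1)) = (\<lambda>_. p (cyl \<rho> 0 1))" by blast
    then show ?thesis by simp
  qed
  ultimately have "partial_deriv 2 p ?q = 0"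
    using vector_derivative_unique_at \<rho> by fastforce
  moreover have "partial_deriv 3 p ?q = - 2 * P \<rho> - \<rho> * P1 \<rho>"
  proof -
    have "((\<lambda>z. p (cyl \<rho> 0 z)) has_vector_derivative partial_deriv 3 p ?q) (at 1)"
      using has_vector_derivative_along[OF _ vertical_curve, of p \<rho> 1] S by (simp add: sum_3 axis_def)
    moreover have "((\<lambda>z. p (cyl \<rho> 0 z)) has_vector_derivative - 2 * P \<rho> - \<rho> * P1 \<rho>) (at 1)"
    proof (rule has_vector_derivative_transform_within_open[where S = "{\<rho> / \<delta><..}"])
      have a: "((\<lambda>z. 1 / z\<^sup>2) has_real_derivative - 2) (at (1::real))"
        by (auto intro!: derivative_eq_intros simp: power2_eq_square)
      have c: "((\<lambda>z. P (\<rho> / z)) has_vector_derivative (- \<rho>) *\<^sub>R P1 \<rho>) (at 1)"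
        using has_vector_derivative_profile[of P "P1 \<rho>" \<rho> 1] has_vector_derivative_P[OF \<rho>] by simp
      have e: "- 2 * P \<rho> - \<rho> * P1 \<rho> = - (\<rho> * P1 \<rho>) - 2 * P \<rho>" by simp
      from has_vector_derivative_scaleR[OF a c]
      show "((\<lambda>z. 1 / z\<^sup>2 * P (\<rho> / z)) has_vector_derivative - 2 * P \<rho> - \<rho> * P1 \<rho>) (at 1)"
        unfolding e by simp
      show "1 \<in> {\<rho> / \<delta><..}" using assms \<delta>_pos by (simp add: field_simps)
      show "1 / y\<^sup>2 * P (\<rho> / y) = p (cyl \<rho> 0 y)" if "y \<in> {\<rho> / \<delta><..}" for y
        using that \<delta>_pos assms(1) p_cyl[of \<rho> y 0] by (simp add: field_simps)
    qed simp
    ultimately show ?thesis by (rule vector_derivative_unique_at)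
  qed
  ultimately show ?thesis by (simp add: grad_def vec_eq_iff forall_3 P1_def)
qed

text \<open>In other words, \<open>\<rho> * f \<rho> $ 3 - f \<rho> $ 1\<close> has the derivative
  \<open>f \<rho> $ 1 / \<rho>\<close>; this is the form that can be integrated from the
  axis.\<close>

lemma divergence_profile:
  assumes \<rho>: "0 < \<rho>" "\<rho> < \<delta>"
  shows "f1 \<rho> $ 1 + f \<rho> $ 1 / \<rho> - f \<rho> $ 3 - \<rho> * f1 \<rho> $ 3 = 0"
proof -
  have "cyl \<rho> 0 1 \<in> S" using \<rho> by (subst cyl_in_S) auto
  then have "divergence u (cyl \<rho> 0 1) = 0" using flow_S(6) by (auto simp: navier_stokes_on_def)
  then show ?thesis
    using partial_deriv_3_u[of \<rho> 1] \<rho>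
    by (simp add: divergence_def sum_3 partial_deriv_2_u f1_def)
qed

text \<open>The momentum equation at the point \<open>cyl \<rho> 0 1\<close>, multiplied by \<rho>.
  The bracket \<open>f1 \<rho> + \<rho> *\<^sub>R f2 \<rho>\<close> on the left is the derivative of
  \<open>\<rho> *\<^sub>R f1 \<rho>\<close>, in which the equation is thus of first order. The
  coefficient \<open>- 3 * \<rho>\<close> is \<open>- 4 * \<rho>\<close> from the second vertical
  derivative plus the \<rho> that completes the factor \<open>1 + \<rho>\<^sup>2\<close> on the
  left.\<close>

lemma momentum_profile:
  assumes \<rho>: "0 < \<rho>" "\<rho> < \<delta>"
  shows "(1 + \<rho>\<^sup>2) *\<^sub>R (f1 \<rho> + \<rho> *\<^sub>R f2 \<rho>) =
    (- 3 * \<rho> + f \<rho> $ 1 - \<rho> * f \<rho> $ 3) *\<^sub>R (\<rho> *\<^sub>R f1 \<rho>)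
    - (\<rho> * f \<rho> $ 3) *\<^sub>R f \<rho> + f \<rho> $ 2 *\<^sub>R turn3 (f \<rho>) - (1 / \<rho>) *\<^sub>R turn3 (turn3 (f \<rho>))
    - (2 * \<rho>) *\<^sub>R f \<rho> + \<rho> *\<^sub>R grad p (cyl \<rho> 0 1)"
proof -
  let ?q = "cyl \<rho> 0 1"
  define G where "G = grad p ?q"
  define Q where "Q = partial_deriv 2 (partial_deriv 2 u) ?q"
  have "?q \<in> S" using \<rho> by (subst cyl_in_S) auto
  then have "- laplacian u ?q + convection u ?q + G = 0"
    using flow_S(6) by (auto simp: navier_stokes_on_def G_def)
  moreover have "laplacian u ?q = f2 \<rho> + Q + (2 *\<^sub>R f \<rho> + (4 * \<rho>) *\<^sub>R f1 \<rho> + \<rho>\<^sup>2 *\<^sub>R f2 \<rho>)"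
    by (simp add: laplacian_def sum_3 partial_deriv_33_u[OF \<rho>] f2_def Q_def)
  moreover have "convection u ?q = f \<rho> $ 1 *\<^sub>R f1 \<rho> + f \<rho> $ 2 *\<^sub>R ((1 / \<rho>) *\<^sub>R turn3 (f \<rho>))
     - f \<rho> $ 3 *\<^sub>R (f \<rho> + \<rho> *\<^sub>R f1 \<rho>)"
    using partial_deriv_3_u[of \<rho> 1] \<rho>
    by (simp add: convection_def sum_3 partial_deriv_2_u f1_def f_def[symmetric] scaleR_diff_right scaleR_add_right)
  ultimately have eq: "- (f2 \<rho> + Q + (2 *\<^sub>R f \<rho> + (4 * \<rho>) *\<^sub>R f1 \<rho> + \<rho>\<^sup>2 *\<^sub>R f2 \<rho>))
     + (f \<rho> $ 1 *\<^sub>R f1 \<rho> + f \<rho> $ 2 *\<^sub>R ((1 / \<rho>) *\<^sub>R turn3 (f \<rho>)) - f \<rho> $ 3 *\<^sub>R (f \<rho> + \<rho> *\<^sub>R f1 \<rho>)) + G = 0"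
    by simp
  have Q: "\<rho> * Q $ i = f1 \<rho> $ i + (1 / \<rho>) * turn3 (turn3 (f \<rho>)) $ i" for i
    using arg_cong[OF partial_deriv_22_u[OF \<rho>], of "\<lambda>v. v $ i"] by (simp add: Q_def)
  show ?thesis unfolding G_def[symmetric]
  proof (subst vec_eq_iff, intro allI)
    fix i :: 3
    define a b c d e j jj q where "a = f \<rho> $ 1" and "b = f \<rho> $ 2" and "c = f \<rho> $ 3"
      and "d = f1 \<rho> $ i" and "e = f2 \<rho> $ i" and "j = turn3 (f \<rho>) $ i"
      and "jj = turn3 (turn3 (f \<rho>)) $ i" and "q = Q $ i"
    note defs = a_def b_def c_def d_def e_def j_def jj_def q_def
    have e1: "- (e + q + (2 * f \<rho> $ i + 4 * \<rho> * d + \<rho>\<^sup>2 * e))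
        + (a * d + b * (1 / \<rho> * j) - c * (f \<rho> $ i + \<rho> * d)) + G $ i = 0"
      using arg_cong[OF eq, of "\<lambda>v. v $ i"] by (simp add: defs algebra_simps)
    have e2: "\<rho> * q = d + 1 / \<rho> * jj" using Q[of i] by (simp add: defs)
    have "(1 + \<rho>\<^sup>2) * (d + \<rho> * e) = (- 3 * \<rho> + a - \<rho> * c) * (\<rho> * d) - \<rho> * c * f \<rho> $ i + b * j
       - 1 / \<rho> * jj - 2 * \<rho> * f \<rho> $ i + \<rho> * G $ i"
    proof -
      have "0 = \<rho> * (- (e + q + (2 * f \<rho> $ i + 4 * \<rho> * d + \<rho>\<^sup>2 * e))
        + (a * d + b * (1 / \<rho> * j) - c * (f \<rho> $ i + \<rho> * d)) + G $ i)" unfolding e1 by simp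
      also have "\<dots> = - \<rho> * e - \<rho> * q - 2 * \<rho> * f \<rho> $ i - 4 * \<rho>\<^sup>2 * d - \<rho> * \<rho>\<^sup>2 * e
        + \<rho> * a * d + b * j - \<rho> * c * f \<rho> $ i - \<rho>\<^sup>2 * c * d + \<rho> * G $ i"
        using \<rho> by (simp add: field_simps power2_eq_square)
      finally show ?thesis using e2 by (simp add: algebra_simps power2_eq_square)
    qed
    then show "((1 + \<rho>\<^sup>2) *\<^sub>R (f1 \<rho> + \<rho> *\<^sub>R f2 \<rho>)) $ i =
    ((- 3 * \<rho> + f \<rho> $ 1 - \<rho> * f \<rho> $ 3) *\<^sub>R (\<rho> *\<^sub>R f1 \<rho>)
    - (\<rho> * f \<rho> $ 3) *\<^sub>R f \<rho> + f \<rho> $ 2 *\<^sub>R turn3 (f \<rho>) - (1 / \<rho>) *\<^sub>R turn3 (turn3 (f \<rho>))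
    - (2 * \<rho>) *\<^sub>R f \<rho> + \<rho> *\<^sub>R G) $ i"
      by (simp add: defs)
  qed
qed

end

subsection \<open>Asymptotics at the axis\<close>

lemma norm_vec3_le: "norm (v :: real ^ 3) \<le> \<bar>v $ 1\<bar> + \<bar>v $ 2\<bar> + \<bar>v $ 3\<bar>"
  using norm_le_l1_cart[of v] by (simp add: sum_3)

context axisymmetric_homogeneous_flow
begin

text \<open>The derivative of the profile with respect to ln \<rho>: growth like c ln \<rho> shows
  up as the finite limit c.\<close>

definition g :: "real \<Rightarrow> real ^ 3" where "g \<rho> = \<rho> *\<^sub>R f1 \<rho>"

lemma has_vector_derivative_g:
  assumes "0 < \<rho>" "\<rho> < \<delta>"
  shows "(g has_vector_derivative (f1 \<rho> + \<rho> *\<^sub>R f2 \<rho>)) (at \<rho>)"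
proof -
  have "((\<lambda>\<rho>. \<rho> *\<^sub>R f1 \<rho>) has_vector_derivative (\<rho> *\<^sub>R f2 \<rho> + 1 *\<^sub>R f1 \<rho>)) (at \<rho>)"
    by (intro has_vector_derivative_scaleR has_vector_derivative_f1 assms) (auto intro!: derivative_eq_intros)
  then show ?thesis by (simp add: g_def[abs_def] add.commute)
qed

lemma eventually_in_profile: "eventually (\<lambda>\<rho>. 0 < \<rho> \<and> \<rho> < \<delta>) (at_right 0)"
  using \<delta>_pos eventually_at_right_real by fastforce

lemma DERIV_f: "0 < \<rho> \<Longrightarrow> \<rho> < \<delta> \<Longrightarrow> ((\<lambda>\<rho>. f \<rho> $ i) has_real_derivative f1 \<rho> $ i) (at \<rho>)"
  using bounded_linear.has_vector_derivative[OF bounded_linear_vec_nth has_vector_derivative_f]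
  by (simp add: has_real_derivative_iff_has_vector_derivative)

text \<open>Both sides are the derivative of \<open>u\<close> at \<open>t = 1\<close> under the
  horizontal dilation by \<open>t\<close> at fixed height and angle. It carries the behaviour of
  \<open>g\<close> from one ray to the whole punctured cone.\<close>

lemma radial_derivative:
  fixes r z \<theta> :: real
  assumes "0 < r" "r < \<delta> * z"
  defines "x \<equiv> cyl r \<theta> z"
  shows "x $ 1 *\<^sub>R partial_deriv 1 u x + x $ 2 *\<^sub>R partial_deriv 2 u x = (1 / z) *\<^sub>R rotate3 \<theta> (g (r / z))"
proof -
  have z: "z > 0" using assms \<delta>_pos by (metis dual_order.strict_trans zero_less_mult_pos)
  have rz: "0 < r / z" "r / z < \<delta>" using assms z by (auto simp: field_simps)
  have S: "x \<in> S" unfolding x_def using assms by (subst cyl_in_S) auto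
  define v where "v = (r * cos \<theta>) *\<^sub>R axis 1 1 + (r * sin \<theta>) *\<^sub>R (axis 2 1 :: real ^ 3)"
  have "((\<lambda>t. cyl (t * r) \<theta> z) has_vector_derivative v) (at 1)"
    unfolding cyl_eq_axis v_def
    by (auto intro!: derivative_eq_intros simp: has_vector_derivative_def fun_eq_iff algebra_simps)
  from has_vector_derivative_along[OF _ this, of u] S
  have 1: "((\<lambda>t. u (cyl (t * r) \<theta> z)) has_vector_derivative
      (x $ 1 *\<^sub>R partial_deriv 1 u x + x $ 2 *\<^sub>R partial_deriv 2 u x)) (at 1)"
    by (simp add: sum_3 v_def x_def axis_def)
  have lin: "bounded_linear (\<lambda>w. (1 / z) *\<^sub>R rotate3 \<theta> w)"
    unfolding linear_conv_bounded_linear[symmetric]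
    using z by (intro linearI) (simp_all add: vec_eq_iff forall_3 field_simps)
  have "((\<lambda>t. u (cyl (t * r) \<theta> z)) has_vector_derivative (1 / z) *\<^sub>R rotate3 \<theta> (g (r / z))) (at 1)"
  proof (rule has_vector_derivative_transform_within_open[where S = "{0<..<\<delta> * z / r}"])
    have "((\<lambda>t. t * r / z) has_vector_derivative r / z) (at 1)"
      unfolding has_real_derivative_iff_has_vector_derivative[symmetric]
      using z by (auto intro!: derivative_eq_intros)
    from vector_diff_chain_at[OF this, of f "f1 (r / z)"] has_vector_derivative_f[OF rz]
    have "((\<lambda>t. f (t * r / z)) has_vector_derivative g (r / z)) (at 1)"
      by (simp add: o_def g_def)
    from bounded_linear.has_vector_derivative[OF lin this]
    show "((\<lambda>t. (1 / z) *\<^sub>R rotate3 \<theta> (f (t * r / z))) has_vector_derivative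
      (1 / z) *\<^sub>R rotate3 \<theta> (g (r / z))) (at 1)" .
    show "1 \<in> {0<..<\<delta> * z / r}" using assms by simp
    show "(1 / z) *\<^sub>R rotate3 \<theta> (f (t * r / z)) = u (cyl (t * r) \<theta> z)" if "t \<in> {0<..<\<delta> * z / r}" for t
      using that assms(1) u_cyl[of "t * r" z \<theta>] by (simp add: field_simps)
  qed simp
  from vector_derivative_unique_at[OF 1 this] show ?thesis .
qed

text \<open>Euler's relation for degree -1. Its use is to recover the vertical derivative of
  \<open>u\<close> from the horizontal ones.\<close>

lemma Euler_identity:
  assumes x: "x \<in> S"
  shows "x $ 1 *\<^sub>R partial_deriv 1 u x + x $ 2 *\<^sub>R partial_deriv 2 u x + x $ 3 *\<^sub>R partial_deriv 3 u x = - u x"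
proof -
  have "((\<lambda>s. s *\<^sub>R x) has_vector_derivative x) (at 1)"
    by (auto intro!: derivative_eq_intros simp: has_vector_derivative_def)
  from has_vector_derivative_along[OF _ this, of u] x
  have 1: "((\<lambda>s. u (s *\<^sub>R x)) has_vector_derivative (\<Sum>i\<in>UNIV. x $ i *\<^sub>R partial_deriv i u x)) (at 1)"
    by simp
  have "((\<lambda>s. u (s *\<^sub>R x)) has_vector_derivative - u x) (at 1)"
  proof (rule has_vector_derivative_transform_within_open[where S = "{0<..}"])
    show "((\<lambda>s. (1 / s) *\<^sub>R u x) has_vector_derivative - u x) (at 1)"
      by (auto intro!: derivative_eq_intros simp: has_vector_derivative_def power2_eq_square)
    show "(1 / s) *\<^sub>R u x = u (s *\<^sub>R x)" if "s \<in> {0<..}" for s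
      using u_scaleR[OF x] that by simp
  qed auto
  from vector_derivative_unique_at[OF 1 this] show ?thesis by (simp add: sum_3)
qed

end

section \<open>Consequences of the prescribed parameter\<close>

locale parametrised_flow = axisymmetric_homogeneous_flow +
  fixes c0 d0 b0\<rho> b0\<phi> :: real
  assumes small: "\<And>z. z > 0 \<Longrightarrow>
      (\<lambda>x. norm (u x)) \<in> o[at (vector [0, 0, z]) within {x. x $ 3 = z}](\<lambda>x. inverse (radius x))"
    and parameter: "has_parameter u p (c0, d0, b0\<rho>, b0\<phi>)"
begin

lemma parameter_limits:
  shows "((\<lambda>\<rho>. \<rho> * P1 \<rho>) \<longlongrightarrow> c0) (at_right 0)"
    and "((\<lambda>\<rho>. P \<rho> - c0 * ln \<rho>) \<longlongrightarrow> d0) (at_right 0)"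
    and "((\<lambda>\<rho>. f \<rho> $ 1 / \<rho> - 1 / 2 * c0 * ln \<rho>) \<longlongrightarrow> b0\<rho>) (at_right 0)"
    and "((\<lambda>\<rho>. f \<rho> $ 2 / \<rho>) \<longlongrightarrow> b0\<phi>) (at_right 0)"
proof -
  \<comment> \<open>The ray of angle 0 carries the profile; there the radial and angular components
    of \<open>u\<close> are \<open>f \<rho> $ 1\<close> and \<open>f \<rho> $ 2\<close>.\<close>
  note par = spec[OF parameter[unfolded has_parameter_def prod.case], of 0]
  show "((\<lambda>\<rho>. P \<rho> - c0 * ln \<rho>) \<longlongrightarrow> d0) (at_right 0)"
    using par by (simp add: P_def)
  have "((\<lambda>\<rho>. \<rho> * deriv (\<lambda>s. p (cyl s 0 1)) \<rho>) \<longlongrightarrow> c0) (at_right 0)" using par by simp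
  then show "((\<lambda>\<rho>. \<rho> * P1 \<rho>) \<longlongrightarrow> c0) (at_right 0)"
  proof (rule Lim_transform_eventually)
    show "\<forall>\<^sub>F \<rho> in at_right 0. \<rho> * deriv (\<lambda>s. p (cyl s 0 1)) \<rho> = \<rho> * P1 \<rho>"
      using eventually_in_profile
    proof eventually_elim
      case (elim \<rho>)
      then have "(P has_real_derivative P1 \<rho>) (at \<rho>)"
        using has_vector_derivative_P by (simp add: has_real_derivative_iff_has_vector_derivative)
      then show ?case by (simp add: P_def[abs_def] DERIV_imp_deriv)
    qed
  qed
  have "((\<lambda>\<rho>. 1 / \<rho> * (rho_component u (cyl \<rho> 0 1) - 1 / 2 * c0 * \<rho> * ln \<rho>)) \<longlongrightarrow> b0\<rho>) (at_right 0)"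
    using par by simp
  then show "((\<lambda>\<rho>. f \<rho> $ 1 / \<rho> - 1 / 2 * c0 * ln \<rho>) \<longlongrightarrow> b0\<rho>) (at_right 0)"
    by (rule Lim_transform_eventually)
       (use eventually_in_profile in eventually_elim, simp add: rho_component_cyl f_def field_simps)
  have "((\<lambda>\<rho>. 1 / \<rho> * phi_component u (cyl \<rho> 0 1)) \<longlongrightarrow> b0\<phi>) (at_right 0)"
    using par by simp
  then show "((\<lambda>\<rho>. f \<rho> $ 2 / \<rho>) \<longlongrightarrow> b0\<phi>) (at_right 0)"
    by (rule Lim_transform_eventually)
       (use eventually_in_profile in eventually_elim, simp add: phi_component_cyl f_def)
qed

text \<open>The growth condition at height 1 along one ray. Its purpose is to exclude a vertical
  component of order 1/\<rho>, which the divergence equation by itself would admit as a constant of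
  integration.\<close>

lemma rho_f_tendsto_0: "((\<lambda>\<rho>. \<rho> *\<^sub>R f \<rho>) \<longlongrightarrow> 0) (at_right 0)"
proof (rule tendstoI)
  fix e :: real assume e: "e > 0"
  let ?F = "at (vector [0, 0, 1]) within {x :: real ^ 3. x $ 3 = 1}"
  have "filterlim (\<lambda>\<rho>. cyl \<rho> 0 1) ?F (at_right 0)"
    unfolding filterlim_at
  proof
    have "((\<lambda>\<rho>. cyl \<rho> 0 1) \<longlongrightarrow> cyl 0 0 1) (at_right 0)"
      unfolding cyl_eq_axis by (intro tendsto_intros)
    then show "((\<lambda>\<rho>. cyl \<rho> 0 1) \<longlongrightarrow> vector [0, 0, 1]) (at_right 0)" by (simp add: cyl_def)
    show "\<forall>\<^sub>F \<rho> in at_right 0. cyl \<rho> 0 1 \<in> {x. x $ 3 = 1} \<and> cyl \<rho> 0 1 \<noteq> vector [0, 0, 1]"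
      using eventually_in_profile by eventually_elim (auto simp: vec_eq_iff forall_3)
  qed
  moreover have "eventually (\<lambda>x. norm (norm (u x)) \<le> e / 2 * norm (inverse (radius x))) ?F"
    using small[of 1] e by (intro landau_o.smallD) auto
  ultimately have "\<forall>\<^sub>F \<rho> in at_right 0. norm (f \<rho>) \<le> e / 2 * norm (inverse (radius (cyl \<rho> 0 1)))"
    unfolding filterlim_iff f_def by fastforce
  then show "\<forall>\<^sub>F \<rho> in at_right 0. dist (\<rho> *\<^sub>R f \<rho>) 0 < e"
    using eventually_in_profile by eventually_elim (use e in \<open>simp add: field_simps\<close>)
qed

text \<open>The two quotients by \<open>sqrt \<rho>\<close> control the coefficients of the momentum
  equation. The other two feed l'Hopital's rule for the vertical component,
  \<open>ln \<rho> + 1\<close> being the derivative of \<open>\<rho> * ln \<rho>\<close>.\<close>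

lemma horizontal_asymptotics:
  shows "((\<lambda>\<rho>. f \<rho> $ 1 / sqrt \<rho>) \<longlongrightarrow> 0) (at_right 0)"
    and "((\<lambda>\<rho>. f \<rho> $ 1 / (\<rho> * ln \<rho>)) \<longlongrightarrow> c0 / 2) (at_right 0)"
    and "((\<lambda>\<rho>. (f \<rho> $ 1 / \<rho>) / (ln \<rho> + 1)) \<longlongrightarrow> c0 / 2) (at_right 0)"
    and "((\<lambda>\<rho>. f \<rho> $ 2 / sqrt \<rho>) \<longlongrightarrow> 0) (at_right 0)"
proof -
  \<comment> \<open>The remainder of the expansion, which converges to \<open>b0\<rho>\<close>; each
    limit below then splits into this remainder and an elementary function.\<close>
  define a where "a \<rho> = f \<rho> $ 1 / \<rho> - 1 / 2 * c0 * ln \<rho>" for \<rho>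
  have a: "(a \<longlongrightarrow> b0\<rho>) (at_right 0)" using parameter_limits(3) by (simp add: a_def[abs_def])
  have f: "f \<rho> $ 1 = \<rho> * (a \<rho> + 1 / 2 * c0 * ln \<rho>)" if "\<rho> > 0" for \<rho>
    using that by (simp add: a_def)
  have "((\<lambda>\<rho>. a \<rho> * sqrt \<rho> + 1 / 2 * c0 * (sqrt \<rho> * ln \<rho>)) \<longlongrightarrow> b0\<rho> * 0 + 1 / 2 * c0 * 0) (at_right 0)"
    by (intro tendsto_intros a) real_asymp+
  then have "((\<lambda>\<rho>. a \<rho> * sqrt \<rho> + 1 / 2 * c0 * (sqrt \<rho> * ln \<rho>)) \<longlongrightarrow> 0) (at_right 0)"
    by simp
  then show "((\<lambda>\<rho>. f \<rho> $ 1 / sqrt \<rho>) \<longlongrightarrow> 0) (at_right 0)"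
  proof (rule Lim_transform_eventually)
    show "\<forall>\<^sub>F \<rho> in at_right 0. a \<rho> * sqrt \<rho> + 1 / 2 * c0 * (sqrt \<rho> * ln \<rho>) = f \<rho> $ 1 / sqrt \<rho>"
      using eventually_in_profile
    proof eventually_elim
      case (elim \<rho>)
      then have "\<rho> / sqrt \<rho> = sqrt \<rho>" by (simp add: real_div_sqrt)
      have "f \<rho> $ 1 / sqrt \<rho> = \<rho> / sqrt \<rho> * (a \<rho> + 1 / 2 * c0 * ln \<rho>)"
        using elim by (simp add: f)
      then show ?case unfolding \<open>\<rho> / sqrt \<rho> = sqrt \<rho>\<close> by (simp add: algebra_simps)
    qed
  qed
  have "((\<lambda>\<rho>. a \<rho> * (1 / ln \<rho>) + 1 / 2 * c0 * 1) \<longlongrightarrow> b0\<rho> * 0 + 1 / 2 * c0 * 1) (at_right 0)"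
    by (intro tendsto_intros a) real_asymp+
  moreover have ln: "\<forall>\<^sub>F \<rho> in at_right 0. ln \<rho> < - (1::real)" by real_asymp
  ultimately have "((\<lambda>\<rho>. a \<rho> * (1 / ln \<rho>) + 1 / 2 * c0 * 1) \<longlongrightarrow> c0 / 2) (at_right 0)"
    by simp
  then show "((\<lambda>\<rho>. f \<rho> $ 1 / (\<rho> * ln \<rho>)) \<longlongrightarrow> c0 / 2) (at_right 0)"
  proof (rule Lim_transform_eventually)
    show "\<forall>\<^sub>F \<rho> in at_right 0. a \<rho> * (1 / ln \<rho>) + 1 / 2 * c0 * 1 = f \<rho> $ 1 / (\<rho> * ln \<rho>)"
      using eventually_in_profile ln
    proof eventually_elim
      case (elim \<rho>)
      then have "\<rho> \<noteq> 1" by auto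
      then show ?case using elim by (simp add: f add_divide_distrib)
    qed
  qed
  have "((\<lambda>\<rho>. a \<rho> * (1 / (ln \<rho> + 1)) + 1 / 2 * c0 * (ln \<rho> / (ln \<rho> + 1))) \<longlongrightarrow> b0\<rho> * 0 + 1 / 2 * c0 * 1) (at_right 0)"
    by (intro tendsto_intros a) real_asymp+
  then have "((\<lambda>\<rho>. a \<rho> * (1 / (ln \<rho> + 1)) + 1 / 2 * c0 * (ln \<rho> / (ln \<rho> + 1))) \<longlongrightarrow> c0 / 2) (at_right 0)"
    by simp
  then show "((\<lambda>\<rho>. (f \<rho> $ 1 / \<rho>) / (ln \<rho> + 1)) \<longlongrightarrow> c0 / 2) (at_right 0)"
    by (rule Lim_transform_eventually)
      (use eventually_in_profile in eventually_elim, simp add: f add_divide_distrib)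
  have "((\<lambda>\<rho>. (f \<rho> $ 2 / \<rho>) * sqrt \<rho>) \<longlongrightarrow> b0\<phi> * 0) (at_right 0)"
    by (intro tendsto_intros parameter_limits) real_asymp
  then have "((\<lambda>\<rho>. (f \<rho> $ 2 / \<rho>) * sqrt \<rho>) \<longlongrightarrow> 0) (at_right 0)" by simp
  then show "((\<lambda>\<rho>. f \<rho> $ 2 / sqrt \<rho>) \<longlongrightarrow> 0) (at_right 0)"
    by (rule Lim_transform_eventually)
      (use eventually_in_profile in eventually_elim, simp add: field_simps)
qed

lemma f_nth_1_tendsto_0: "((\<lambda>\<rho>. f \<rho> $ 1) \<longlongrightarrow> 0) (at_right 0)"
  and f_nth_2_tendsto_0: "((\<lambda>\<rho>. f \<rho> $ 2) \<longlongrightarrow> 0) (at_right 0)"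
proof -
  have s: "(sqrt \<longlongrightarrow> 0) (at_right 0)" by real_asymp
  have "((\<lambda>\<rho>. f \<rho> $ i) \<longlongrightarrow> 0) (at_right 0)" if "((\<lambda>\<rho>. f \<rho> $ i / sqrt \<rho>) \<longlongrightarrow> 0) (at_right 0)" for i
  proof -
    have "((\<lambda>\<rho>. f \<rho> $ i / sqrt \<rho> * sqrt \<rho>) \<longlongrightarrow> 0) (at_right 0)"
      using tendsto_mult[OF that s] by simp
    then show ?thesis
      by (rule Lim_transform_eventually) (use eventually_in_profile in eventually_elim, simp)
  qed
  then show "((\<lambda>\<rho>. f \<rho> $ 1) \<longlongrightarrow> 0) (at_right 0)" "((\<lambda>\<rho>. f \<rho> $ 2) \<longlongrightarrow> 0) (at_right 0)"
    using horizontal_asymptotics by auto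
qed

text \<open>L'Hopital's rule of type 0/0 for \<open>\<rho> * f \<rho> $ 3 - f \<rho> $ 1\<close>
  against \<open>\<rho> * ln \<rho>\<close>: the numerator vanishes at the axis by the growth
  condition, and its derivative \<open>f \<rho> $ 1 / \<rho>\<close> behaves like
  \<open>c0 / 2 * ln \<rho>\<close>. This accounts for one half of \<open>c0\<close>; adding
  \<open>f \<rho> $ 1\<close> back contributes the other half.\<close>

lemma vertical_asymptotics: "((\<lambda>\<rho>. f \<rho> $ 3 / ln \<rho>) \<longlongrightarrow> c0) (at_right 0)"
proof -
  have "((\<lambda>\<rho>. (\<rho> * f \<rho> $ 3 - f \<rho> $ 1) / (\<rho> * ln \<rho>)) \<longlongrightarrow> c0 / 2) (at_right 0)"
  proof (rule lhopital_right_0[where f' = "\<lambda>\<rho>. f \<rho> $ 1 / \<rho>" and g' = "\<lambda>\<rho>. ln \<rho> + 1"])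
    have "((\<lambda>\<rho>. \<rho> * f \<rho> $ 3) \<longlongrightarrow> 0) (at_right 0)"
      using tendsto_vec_nth[OF rho_f_tendsto_0, of 3] by simp
    from tendsto_diff[OF this f_nth_1_tendsto_0]
    show "((\<lambda>\<rho>. \<rho> * f \<rho> $ 3 - f \<rho> $ 1) \<longlongrightarrow> 0) (at_right 0)" by simp
    show "((\<lambda>\<rho>. \<rho> * ln \<rho>) \<longlongrightarrow> 0) (at_right (0::real))" by real_asymp
    have ln: "\<forall>\<^sub>F \<rho> in at_right 0. ln \<rho> < - (1::real)" by real_asymp
    then show "\<forall>\<^sub>F \<rho> in at_right 0. \<rho> * ln \<rho> \<noteq> (0::real)"
      using eventually_in_profile by eventually_elim auto
    show "\<forall>\<^sub>F \<rho> in at_right 0. ln \<rho> + 1 \<noteq> (0::real)"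
      using ln by eventually_elim auto
    show "\<forall>\<^sub>F \<rho> in at_right 0. ((\<lambda>\<rho>. \<rho> * f \<rho> $ 3 - f \<rho> $ 1) has_real_derivative f \<rho> $ 1 / \<rho>) (at \<rho>)"
      using eventually_in_profile
    proof eventually_elim
      case (elim \<rho>)
      have "((\<lambda>\<rho>. \<rho> * f \<rho> $ 3 - f \<rho> $ 1) has_real_derivative (1 * f \<rho> $ 3 + f1 \<rho> $ 3 * \<rho>) - f1 \<rho> $ 1) (at \<rho>)"
        using elim by (intro DERIV_diff DERIV_mult DERIV_ident DERIV_f) auto
      moreover have "(1 * f \<rho> $ 3 + f1 \<rho> $ 3 * \<rho>) - f1 \<rho> $ 1 = f \<rho> $ 1 / \<rho>"
        using divergence_profile[of \<rho>] elim by (simp add: algebra_simps)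
      ultimately show ?case by simp
    qed
    show "\<forall>\<^sub>F \<rho> in at_right 0. ((\<lambda>\<rho>. \<rho> * ln \<rho>) has_real_derivative ln \<rho> + 1) (at \<rho>)"
      using eventually_in_profile by eventually_elim (auto intro!: derivative_eq_intros)
    show "((\<lambda>\<rho>. f \<rho> $ 1 / \<rho> / (ln \<rho> + 1)) \<longlongrightarrow> c0 / 2) (at_right 0)"
      by (rule horizontal_asymptotics)
  qed
  from tendsto_add[OF this horizontal_asymptotics(2)]
  have "((\<lambda>\<rho>. (\<rho> * f \<rho> $ 3 - f \<rho> $ 1) / (\<rho> * ln \<rho>) + f \<rho> $ 1 / (\<rho> * ln \<rho>)) \<longlongrightarrow> c0) (at_right 0)"
    by simp
  then show ?thesis
    by (rule Lim_transform_eventually)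
      (use eventually_in_profile in eventually_elim, simp flip: add_divide_distrib)
qed

text \<open>The profile and the pressure grow at most like ln \<rho>, which any positive power
  absorbs. The exponents 1/4, 1/2 and 1 are used.\<close>

lemma f_powr_tendsto_0:
  assumes "a > 0"
  shows "((\<lambda>\<rho>. \<rho> powr a * f \<rho> $ 3) \<longlongrightarrow> 0) (at_right 0)"
    and "((\<lambda>\<rho>. \<rho> powr a *\<^sub>R f \<rho>) \<longlongrightarrow> 0) (at_right 0)"
    and "((\<lambda>\<rho>. \<rho> powr a * P \<rho>) \<longlongrightarrow> 0) (at_right 0)"
proof -
  have l: "((\<lambda>\<rho>. \<rho> powr a * ln \<rho>) \<longlongrightarrow> 0) (at_right 0)" using assms by real_asymp
  have p: "((\<lambda>\<rho>. \<rho> powr a) \<longlongrightarrow> 0) (at_right 0)" using assms by real_asymp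
  have ln: "\<forall>\<^sub>F \<rho> in at_right 0. ln \<rho> < (0::real)" by real_asymp
  have "((\<lambda>\<rho>. (\<rho> powr a * ln \<rho>) * (f \<rho> $ 3 / ln \<rho>)) \<longlongrightarrow> 0) (at_right 0)"
    using tendsto_mult[OF l vertical_asymptotics] by simp
  then show 3: "((\<lambda>\<rho>. \<rho> powr a * f \<rho> $ 3) \<longlongrightarrow> 0) (at_right 0)"
    by (rule Lim_transform_eventually) (use ln in eventually_elim, simp)
  show "((\<lambda>\<rho>. \<rho> powr a *\<^sub>R f \<rho>) \<longlongrightarrow> 0) (at_right 0)"
  proof (rule vec_tendstoI)
    fix i :: 3
    have "((\<lambda>\<rho>. \<rho> powr a * f \<rho> $ i) \<longlongrightarrow> 0) (at_right 0)"
      using exhaust_3[of i] 3 tendsto_mult[OF p f_nth_1_tendsto_0] tendsto_mult[OF p f_nth_2_tendsto_0] by auto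
    then show "((\<lambda>\<rho>. (\<rho> powr a *\<^sub>R f \<rho>) $ i) \<longlongrightarrow> 0 $ i) (at_right 0)" by simp
  qed
  have "((\<lambda>\<rho>. \<rho> powr a * (P \<rho> - c0 * ln \<rho>) + c0 * (\<rho> powr a * ln \<rho>)) \<longlongrightarrow> 0 * d0 + c0 * 0) (at_right 0)"
    by (intro tendsto_intros p l parameter_limits)
  then show "((\<lambda>\<rho>. \<rho> powr a * P \<rho>) \<longlongrightarrow> 0) (at_right 0)"
    by (simp add: algebra_simps)
qed

text \<open>After multiplication by \<open>sqrt \<rho>\<close>, each term on the right of the
  momentum equation is bounded by a constant or by a multiple of \<open>norm (g \<rho>)\<close>, and
  the factor \<open>1 + \<rho>\<^sup>2\<close> on the left only helps. This is the linear growth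
  condition needed for the limit of \<open>g\<close> at 0.\<close>

lemma g_derivative_bound:
  obtains c M where "c > 0" "c \<le> \<delta>"
    "\<And>\<rho>. 0 < \<rho> \<Longrightarrow> \<rho> < c \<Longrightarrow> norm (f1 \<rho> + \<rho> *\<^sub>R f2 \<rho>) \<le> M / sqrt \<rho> * (1 + norm (g \<rho>))"
proof -
  have le1: "\<forall>\<^sub>F \<rho> in at_right 0. \<bar>h \<rho>\<bar> < e" if "(h \<longlongrightarrow> 0) (at_right 0)" "e > 0" for h :: "real \<Rightarrow> real" and e
    using tendstoD[OF that] by simp
  have s3: "((\<lambda>\<rho>. sqrt \<rho> * f \<rho> $ 3) \<longlongrightarrow> 0) (at_right 0)"
    by (rule Lim_transform_eventually[OF f_powr_tendsto_0(1)[of "1/2"]])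
       (use eventually_in_profile in \<open>auto elim!: eventually_mono simp: powr_half_sqrt\<close>)
  have sP: "((\<lambda>\<rho>. \<rho> * P \<rho>) \<longlongrightarrow> 0) (at_right 0)"
    by (rule Lim_transform_eventually[OF f_powr_tendsto_0(3)[of 1]])
       (use eventually_in_profile in \<open>auto elim!: eventually_mono\<close>)
  have "\<forall>\<^sub>F \<rho> in at_right 0. \<bar>\<rho> * P1 \<rho> - c0\<bar> < 1"
    using tendstoD[OF parameter_limits(1), of 1] by (simp add: dist_norm)
  then have "\<forall>\<^sub>F \<rho> in at_right 0. \<bar>f \<rho> $ 1 / sqrt \<rho>\<bar> < 1 \<and> \<bar>f \<rho> $ 2 / sqrt \<rho>\<bar> < 1 \<and> \<bar>sqrt \<rho> * f \<rho> $ 3\<bar> < 1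
      \<and> \<bar>\<rho> * P1 \<rho> - c0\<bar> < 1 \<and> \<bar>\<rho> * P \<rho>\<bar> < 1 \<and> \<rho> < 1"
    by (intro eventually_conj le1[OF horizontal_asymptotics(1)] le1[OF horizontal_asymptotics(4)] le1[OF s3] le1[OF sP])
       (auto simp: eventually_at_right_field intro!: exI[of _ 1])
  then obtain c where c: "c > 0" "\<And>\<rho>. 0 < \<rho> \<Longrightarrow> \<rho> < c \<Longrightarrow> \<bar>f \<rho> $ 1 / sqrt \<rho>\<bar> < 1 \<and> \<bar>f \<rho> $ 2 / sqrt \<rho>\<bar> < 1
      \<and> \<bar>sqrt \<rho> * f \<rho> $ 3\<bar> < 1 \<and> \<bar>\<rho> * P1 \<rho> - c0\<bar> < 1 \<and> \<bar>\<rho> * P \<rho>\<bar> < 1 \<and> \<rho> < 1"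
    unfolding eventually_at_right_field by blast
  \<comment> \<open>Here 23 = 5 + 18: 5 bounds the coefficient of \<open>g \<rho>\<close>, and 18 =
    3 + 3 + 2 + 6 + 4 together with \<open>2 * \<bar>c0\<bar>\<close> bounds the terms
    \<open>?t2\<close> to \<open>?t6\<close>.\<close>
  define M where "M = 23 + 2 * \<bar>c0\<bar>"
  show thesis
  proof (rule that[of "min c \<delta>"])
    fix \<rho> assume "0 < \<rho>" "\<rho> < min c \<delta>"
    then have \<rho>: "0 < \<rho>" "\<rho> < c" "\<rho> < \<delta>" by auto
    define q where "q = sqrt \<rho>"
    have q: "q > 0" "q < 1" "\<rho> = q * q" using \<rho> c(2)[of \<rho>] by (auto simp: q_def)
    have r1: "\<rho> < 1" using c(2) \<rho> by blast
    have f1: "\<bar>f \<rho> $ 1\<bar> \<le> q" and f2: "\<bar>f \<rho> $ 2\<bar> \<le> q" and f3: "q * \<bar>f \<rho> $ 3\<bar> \<le> 1"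
      using c(2)[OF \<rho>(1,2)] q by (auto simp: q_def[symmetric] abs_mult abs_divide field_simps)
    have p1: "\<bar>\<rho> * P1 \<rho>\<bar> \<le> \<bar>c0\<bar> + 1" and p: "\<bar>\<rho> * P \<rho>\<bar> \<le> 1"
      using c(2)[OF \<rho>(1,2)] by linarith+
    have fl1: "\<bar>f \<rho> $ 1\<bar> \<le> 1" and fl2: "\<bar>f \<rho> $ 2\<bar> \<le> 1" using f1 f2 q by linarith+
    have "q * norm (f \<rho>) \<le> q * (\<bar>f \<rho> $ 1\<bar> + \<bar>f \<rho> $ 2\<bar> + \<bar>f \<rho> $ 3\<bar>)"
      using norm_vec3_le q by (intro mult_left_mono) auto
    also have "\<dots> \<le> 1 * 1 + 1 * 1 + 1"
      unfolding distrib_left using q fl1 fl2 by (intro add_mono mult_mono f3) auto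
    finally have f: "q * norm (f \<rho>) \<le> 3" by simp
    have qq: "q * q \<le> q" using q by (simp add: mult_left_le)
    have rf3: "\<rho> * \<bar>f \<rho> $ 3\<bar> \<le> 1"
      using mult_mono[of q 1 "q * \<bar>f \<rho> $ 3\<bar>" 1] f3 q by (simp add: mult.assoc)
    let ?G = "grad p (cyl \<rho> 0 1)"
    have G: "\<rho> * norm ?G \<le> 2 * \<bar>c0\<bar> + 4"
    proof -
      have "norm ?G \<le> \<bar>P1 \<rho>\<bar> + \<bar>- 2 * P \<rho> - \<rho> * P1 \<rho>\<bar>"
        using norm_vec3_le[of ?G] grad_p_profile[of \<rho>] \<rho> by simp
      also have "\<dots> \<le> \<bar>P1 \<rho>\<bar> + 2 * \<bar>P \<rho>\<bar> + \<rho> * \<bar>P1 \<rho>\<bar>"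
        using \<rho> abs_triangle_ineq4[of "- 2 * P \<rho>" "\<rho> * P1 \<rho>"] by (simp add: abs_mult)
      also have "\<dots> \<le> 2 * \<bar>P1 \<rho>\<bar> + 2 * \<bar>P \<rho>\<bar>"
        using mult_right_mono[of \<rho> 1 "\<bar>P1 \<rho>\<bar>"] r1 by simp
      finally have "\<rho> * norm ?G \<le> \<rho> * (2 * \<bar>P1 \<rho>\<bar> + 2 * \<bar>P \<rho>\<bar>)"
        using \<rho> by (intro mult_left_mono) auto
      also have "\<dots> = 2 * \<bar>\<rho> * P1 \<rho>\<bar> + 2 * \<bar>\<rho> * P \<rho>\<bar>" using \<rho> by (simp add: abs_mult algebra_simps)
      finally show ?thesis using p1 p by linarith
    qed
    define V where "V = f1 \<rho> + \<rho> *\<^sub>R f2 \<rho>"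
    let ?t1 = "(- 3 * \<rho> + f \<rho> $ 1 - \<rho> * f \<rho> $ 3) *\<^sub>R g \<rho>"
    let ?t2 = "(\<rho> * f \<rho> $ 3) *\<^sub>R f \<rho>" and ?t3 = "f \<rho> $ 2 *\<^sub>R turn3 (f \<rho>)"
    let ?t4 = "(1 / \<rho>) *\<^sub>R turn3 (turn3 (f \<rho>))" and ?t5 = "(2 * \<rho>) *\<^sub>R f \<rho>" and ?t6 = "\<rho> *\<^sub>R ?G"
    have mom: "(1 + \<rho>\<^sup>2) *\<^sub>R V = ?t1 - ?t2 + ?t3 - ?t4 - ?t5 + ?t6"
      using momentum_profile[OF \<rho>(1,3)] by (simp add: V_def g_def)
    have "norm V \<le> (1 + \<rho>\<^sup>2) * norm V" by (simp add: distrib_right)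
    also have "\<dots> = norm ((1 + \<rho>\<^sup>2) *\<^sub>R V)" by (simp add: abs_of_nonneg)
    also have "\<dots> \<le> norm ?t1 + norm ?t2 + norm ?t3 + norm ?t4 + norm ?t5 + norm ?t6"
      unfolding mom by (intro norm_triangle_mono norm_triangle_le norm_triangle_le_diff add_mono order_refl)
    finally have "q * norm V \<le> q * (norm ?t1 + norm ?t2 + norm ?t3 + norm ?t4 + norm ?t5 + norm ?t6)"
      using q by (intro mult_left_mono) auto
    moreover have "q * norm ?t1 \<le> 5 * norm (g \<rho>)"
    proof -
      have "\<bar>- 3 * \<rho> + f \<rho> $ 1 - \<rho> * f \<rho> $ 3\<bar> \<le> 3 * \<rho> + \<bar>f \<rho> $ 1\<bar> + \<rho> * \<bar>f \<rho> $ 3\<bar>"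
        using \<rho> abs_mult[of \<rho> "f \<rho> $ 3"] by linarith
      then have "\<bar>- 3 * \<rho> + f \<rho> $ 1 - \<rho> * f \<rho> $ 3\<bar> \<le> 5" using rf3 fl1 r1 by linarith
      then have "norm ?t1 \<le> 5 * norm (g \<rho>)"
        unfolding norm_scaleR real_norm_def by (rule mult_right_mono) simp
      moreover have "q * norm ?t1 \<le> 1 * norm ?t1"
        using q by (intro mult_right_mono) auto
      ultimately show ?thesis by linarith
    qed
    moreover have "q * norm ?t2 \<le> 3"
    proof -
      have "q * norm ?t2 = (\<rho> * \<bar>f \<rho> $ 3\<bar>) * (q * norm (f \<rho>))" using \<rho> by (simp add: abs_mult)
      also have "\<dots> \<le> 1 * 3" using rf3 f q \<rho> by (intro mult_mono) auto
      finally show ?thesis by simp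
    qed
    moreover have "q * norm ?t3 \<le> 3"
    proof -
      have "q * norm ?t3 = \<bar>f \<rho> $ 2\<bar> * (q * norm (turn3 (f \<rho>)))" by simp
      also have "\<dots> \<le> 1 * (q * norm (f \<rho>))"
        using fl2 q norm_turn3_le by (intro mult_mono mult_left_mono) auto
      finally show ?thesis using f by simp
    qed
    \<comment> \<open>The dangerous term with 1/\<rho>: two turns leave
      \<open>(- f \<rho> $ 1, - f \<rho> $ 2, 0)\<close>, of norm at most \<open>2 * q\<close>, and
      \<open>q * (1 / \<rho>) * (2 * q) = 2\<close>.\<close>
    moreover have "q * norm ?t4 \<le> 2"
    proof -
      have "norm (turn3 (turn3 (f \<rho>))) \<le> 2 * q"
        using norm_vec3_le[of "turn3 (turn3 (f \<rho>))"] f1 f2 by simp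
      moreover have "q * norm ?t4 = norm (turn3 (turn3 (f \<rho>))) / q"
        using q by simp
      ultimately show ?thesis using q by (simp add: pos_divide_le_eq)
    qed
    moreover have "q * norm ?t5 \<le> 6"
    proof -
      have "q * norm ?t5 = 2 * \<rho> * (q * norm (f \<rho>))" using \<rho> by simp
      also have "\<dots> \<le> 2 * 1 * 3" using f r1 q \<rho> by (intro mult_mono) auto
      finally show ?thesis by simp
    qed
    moreover have "q * norm ?t6 \<le> 2 * \<bar>c0\<bar> + 4"
    proof -
      have "q * norm ?t6 \<le> 1 * (\<rho> * norm ?G)" using q \<rho> by (simp add: mult_left_le_one_le)
      then show ?thesis using G by simp
    qed
    ultimately have "q * norm V \<le> 5 * norm (g \<rho>) + 18 + 2 * \<bar>c0\<bar>"
      by (simp add: distrib_left)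
    also have "\<dots> \<le> M * (1 + norm (g \<rho>))"
      unfolding M_def by (simp add: algebra_simps)
    finally show "norm (f1 \<rho> + \<rho> *\<^sub>R f2 \<rho>) \<le> M / sqrt \<rho> * (1 + norm (g \<rho>))"
      using q by (simp add: V_def q_def[symmetric] field_simps)
  qed (use c \<delta>_pos in auto)
qed

text \<open>That a limit \<open>l\<close> exists is the work of the differential inequality. Its
  value follows from l'Hopital's rule: if \<rho> f' tends to \<open>l\<close>, then f / ln \<rho>
  tends to \<open>l\<close> as well, and this quotient is known to tend to 0 horizontally and to
  \<open>c0\<close> vertically.\<close>

lemma g_tendsto: "(g \<longlongrightarrow> c0 *\<^sub>R axis 3 1) (at_right 0)"
proof -
  obtain c M where c: "c > 0" "c \<le> \<delta>"
    "\<And>\<rho>. 0 < \<rho> \<Longrightarrow> \<rho> < c \<Longrightarrow> norm (f1 \<rho> + \<rho> *\<^sub>R f2 \<rho>) \<le> M / sqrt \<rho> * (1 + norm (g \<rho>))"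
    using g_derivative_bound by blast
  obtain l where l: "(g \<longlongrightarrow> l) (at_right 0)"
    by (rule gronwall_limit_at_0[OF c(1) _ c(3)]) (use c(2) has_vector_derivative_g in auto)
  \<comment> \<open>The denominator is \<open>- ln \<rho>\<close>, since the rule asks for one that
    tends to plus infinity; hence the minus sign on \<open>l\<close>.\<close>
  have lim: "((\<lambda>\<rho>. f \<rho> $ i / (- ln \<rho>)) \<longlongrightarrow> - l $ i) (at_right 0)" for i
  proof (rule lhopital_right_at_top[where f' = "\<lambda>\<rho>. f1 \<rho> $ i" and g' = "\<lambda>\<rho>. - 1 / \<rho>"])
    show "LIM \<rho> at_right (0::real). - ln \<rho> :> at_top" by real_asymp
    show "\<forall>\<^sub>F \<rho> in at_right 0. - 1 / \<rho> \<noteq> (0::real)" using eventually_in_profile by eventually_elim auto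
    show "\<forall>\<^sub>F \<rho> in at_right 0. ((\<lambda>\<rho>. f \<rho> $ i) has_real_derivative f1 \<rho> $ i) (at \<rho>)"
      using eventually_in_profile by eventually_elim (simp add: DERIV_f)
    show "\<forall>\<^sub>F \<rho> in at_right 0. ((\<lambda>\<rho>. - ln \<rho>) has_real_derivative - 1 / \<rho>) (at \<rho>)"
      using eventually_in_profile by eventually_elim (auto intro!: derivative_eq_intros)
    show "((\<lambda>\<rho>. f1 \<rho> $ i / (- 1 / \<rho>)) \<longlongrightarrow> - l $ i) (at_right 0)"
      using tendsto_minus[OF tendsto_vec_nth[OF l, of i]] by (simp add: g_def mult.commute)
  qed
  have inv: "((\<lambda>\<rho>. 1 / (- ln \<rho>)) \<longlongrightarrow> 0) (at_right (0::real))" by real_asymp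
  have "l $ 1 = 0"
    using tendsto_unique[OF _ lim[of 1]] tendsto_mult[OF f_nth_1_tendsto_0 inv] by fastforce
  moreover have "l $ 2 = 0"
    using tendsto_unique[OF _ lim[of 2]] tendsto_mult[OF f_nth_2_tendsto_0 inv] by fastforce
  moreover have "l $ 3 = c0"
    using tendsto_unique[OF _ lim[of 3]] tendsto_minus[OF vertical_asymptotics] by fastforce
  ultimately have "l = c0 *\<^sub>R axis 3 1" by (simp add: vec_eq_iff forall_3 axis_def)
  then show ?thesis using l by simp
qed

end

subsection \<open>Flux of a divergence-free field through the axis\<close>

lemma integrable_continuous_compact_support:
  fixes h :: "'a::euclidean_space \<Rightarrow> real"
  assumes "continuous_on S h" "compact T" "T \<subseteq> S" "\<And>x. x \<in> S \<Longrightarrow> x \<notin> T \<Longrightarrow> h x = 0"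
  shows "integrable lborel (\<lambda>x. indicator S x * h x)"
proof -
  have "integrable lborel (\<lambda>x. indicator T x *\<^sub>R h x)"
    by (rule borel_integrable_compact[OF assms(2) continuous_on_subset[OF assms(1,3)]])
  moreover have "(\<lambda>x. indicator T x *\<^sub>R h x) = (\<lambda>x. indicator S x * h x)"
    using assms(3,4) by (force simp: indicator_def)
  ultimately show ?thesis by simp
qed

text \<open>As \<open>w\<close> vanishes off a compact subset of \<open>S\<close>, the product
  \<open>a * w\<close> extended by zero is differentiable on the whole space and no boundary term
  arises; \<open>a\<close> may be singular at the boundary of \<open>S\<close>. The lemma serves for
  the stress on the punctured cone and for \<open>ln\<close> on the half-line.\<close>

lemma integral_by_parts_open:
  fixes a w :: "'a::euclidean_space \<Rightarrow> real"
  assumes S: "open S"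
    and a: "\<And>x. x \<in> S \<Longrightarrow> (a has_derivative a' x) (at x)" "continuous_on S (\<lambda>x. a' x e)"
    and w: "\<And>x. (w has_derivative w' x) (at x)" "continuous_on UNIV (\<lambda>x. w' x e)"
    and T: "compact T" "T \<subseteq> S" "\<And>x. x \<notin> T \<Longrightarrow> w x = 0"
  shows "integrable lborel (\<lambda>x. indicator S x * (a x * w' x e))"
    and "integrable lborel (\<lambda>x. indicator S x * (a' x e * w x))"
    and "(\<integral>x. indicator S x * (a x * w' x e) \<partial>lborel) = - (\<integral>x. indicator S x * (a' x e * w x) \<partial>lborel)"
proof -
  have ca: "continuous_on S a"
    using a(1) by (meson continuous_at_imp_continuous_on has_derivative_continuous)
  have cw: "continuous_on S w"
    using w(1) by (meson continuous_at_imp_continuous_on has_derivative_continuous)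
  have opT: "open (- T)" using T(1) by (simp add: compact_imp_closed open_Compl)
  have w'0: "w' x e = 0" if "x \<notin> T" for x
  proof -
    have "(w has_derivative (\<lambda>_. 0)) (at x)"
      using T(3) that opT by (intro has_derivative_transform_within_open[OF has_derivative_const]) auto
    then show ?thesis using w(1) has_derivative_unique by metis
  qed
  have c1: "continuous_on S (\<lambda>x. a x * w' x e)" and c2: "continuous_on S (\<lambda>x. a' x e * w x)"
    by (auto intro!: continuous_intros ca cw a(2) continuous_on_subset[OF w(2)])
  show i1: "integrable lborel (\<lambda>x. indicator S x * (a x * w' x e))"
    by (rule integrable_continuous_compact_support[OF c1 T(1,2)]) (simp add: w'0)
  show i2: "integrable lborel (\<lambda>x. indicator S x * (a' x e * w x))"
    by (rule integrable_continuous_compact_support[OF c2 T(1,2)]) (simp add: T(3))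
  define F where "F x = (if x \<in> S then a x * w x else 0)" for x
  define F' where "F' x = (if x \<in> S then (\<lambda>h. a x * w' x h + a' x h * w x) else (\<lambda>_. 0))" for x
  have F: "(F has_derivative F' x) (at x)" for x
  proof (cases "x \<in> S")
    case True
    have "((\<lambda>x. a x * w x) has_derivative (\<lambda>h. a x * w' x h + a' x h * w x)) (at x)"
      by (rule has_derivative_mult[OF a(1)[OF True] w(1)])
    then have "(F has_derivative (\<lambda>h. a x * w' x h + a' x h * w x)) (at x)"
      by (rule has_derivative_transform_within_open[OF _ S True]) (simp add: F_def)
    then show ?thesis using True by (simp add: F'_def)
  next
    case False
    then have "x \<in> - T" using T(2) by auto
    then have "(F has_derivative (\<lambda>_. 0)) (at x)"
      by (intro has_derivative_transform_within_open[OF has_derivative_const opT]) (auto simp: F_def T(3))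
    then show ?thesis using False by (simp add: F'_def)
  qed
  \<comment> \<open>Two open sets cover the space; on the second the directional derivative of
    \<open>F\<close> is identically zero, so continuity holds on each and glues.\<close>
  have "continuous_on (S \<union> - T) (\<lambda>x. F' x e)"
  proof (rule continuous_on_open_Un[OF S opT])
    have "continuous_on S (\<lambda>x. a x * w' x e + a' x e * w x)" by (intro continuous_intros c1 c2)
    then show "continuous_on S (\<lambda>x. F' x e)"
      by (rule continuous_on_eq) (simp add: F'_def)
    show "continuous_on (- T) (\<lambda>x. F' x e)"
      by (rule continuous_on_eq[OF continuous_on_const[of _ 0]]) (auto simp: F'_def w'0 T(3))
  qed
  moreover have "S \<union> - T = UNIV" using T(2) by auto
  ultimately have "continuous_on UNIV (\<lambda>x. F' x e)" by simp
  then have "(\<integral>x. F' x e \<partial>lborel) = 0"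
    by (rule integral_directional_derivative_0(2)[OF F _ T(1)]) (auto simp: F_def T(3))
  moreover have "(\<lambda>x. F' x e) = (\<lambda>x. indicator S x * (a x * w' x e) + indicator S x * (a' x e * w x))"
    by (auto simp: F'_def indicator_def)
  ultimately show "(\<integral>x. indicator S x * (a x * w' x e) \<partial>lborel) = - (\<integral>x. indicator S x * (a' x e * w x) \<partial>lborel)"
    using i1 i2 by simp
qed

text \<open>
  A \<open>C\<^sup>1\<close> cutoff suffices, since the integrations by parts put only one derivative on it.
\<close>

definition ramp :: "real \<Rightarrow> real"
  where "ramp t = (max 0 (t - 1))\<^sup>2 / (1 + (max 0 (t - 1))\<^sup>2)"

definition ramp' :: "real \<Rightarrow> real"
  where "ramp' t = 2 * max 0 (t - 1) / (1 + (max 0 (t - 1))\<^sup>2)\<^sup>2"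

text \<open>Squaring removes the kink of the positive part at 0; this is the reason for the squares
  in \<open>ramp\<close>.\<close>

lemma DERIV_positive_part_squared: "((\<lambda>t::real. (max 0 t)\<^sup>2) has_real_derivative 2 * max 0 t) (at t)"
proof (cases t "0::real" rule: linorder_cases)
  case less
  have "((\<lambda>t::real. (max 0 t)\<^sup>2) has_real_derivative 0) (at t)"
    by (rule has_field_derivative_transform_within_open[OF DERIV_const[of 0], of "{..<0}"]) (use less in auto)
  then show ?thesis using less by simp
next
  case equal
  have "((\<lambda>h::real. (max 0 h)\<^sup>2 / h) \<longlongrightarrow> 0) (at 0)"
  proof (rule Lim_null_comparison)
    show "\<forall>\<^sub>F h in at 0. norm ((max 0 h)\<^sup>2 / h) \<le> \<bar>h :: real\<bar>"
      by (auto simp: eventually_at_filter max_def power2_eq_square intro!: always_eventually)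
    show "((\<lambda>h::real. \<bar>h\<bar>) \<longlongrightarrow> 0) (at 0)" by (auto intro!: tendsto_eq_intros)
  qed
  then show ?thesis using equal by (simp add: DERIV_def)
next
  case greater
  have "((\<lambda>t::real. t\<^sup>2) has_real_derivative 2 * t) (at t)"
    by (auto intro!: derivative_eq_intros)
  then have "((\<lambda>t::real. (max 0 t)\<^sup>2) has_real_derivative 2 * t) (at t)"
    by (rule has_field_derivative_transform_within_open[of _ _ _ "{0<..}"]) (use greater in auto)
  then show ?thesis using greater by simp
qed

lemma DERIV_ramp: "(ramp has_real_derivative ramp' t) (at t)"
proof -
  have m: "((\<lambda>t::real. (max 0 (t - 1))\<^sup>2) has_real_derivative 2 * max 0 (t - 1)) (at t)"
    using DERIV_chain2[OF DERIV_positive_part_squared[of "t - 1"] DERIV_diff[OF DERIV_ident DERIV_const]] by simp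
  have pos: "1 + (max 0 (t - 1))\<^sup>2 \<noteq> 0" by (smt (verit) zero_le_power2)
  have "(ramp has_real_derivative
     (2 * max 0 (t - 1) * (1 + (max 0 (t - 1))\<^sup>2) - (max 0 (t - 1))\<^sup>2 * (0 + 2 * max 0 (t - 1)))
       / ((1 + (max 0 (t - 1))\<^sup>2) * (1 + (max 0 (t - 1))\<^sup>2))) (at t)"
    unfolding ramp_def[abs_def] by (intro DERIV_divide DERIV_add DERIV_const m pos)
  moreover have "2 * max 0 (t - 1) * (1 + (max 0 (t - 1))\<^sup>2) - (max 0 (t - 1))\<^sup>2 * (0 + 2 * max 0 (t - 1)) = 2 * max 0 (t - 1)"
    by (simp add: algebra_simps)
  ultimately show ?thesis by (simp add: ramp'_def power2_eq_square)
qed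

lemma continuous_on_ramp': "continuous_on UNIV ramp'"
  unfolding ramp'_def[abs_def]
  by (intro continuous_intros) (smt (verit) zero_le_power2 zero_eq_power2)+

lemma ramp_le1: "t \<le> 1 \<Longrightarrow> ramp t = 0" and ramp'_le1: "t \<le> 1 \<Longrightarrow> ramp' t = 0"
  by (auto simp: ramp_def ramp'_def)

lemma ramp_bounds: "0 \<le> ramp t" "ramp t \<le> 1"
proof -
  have "0 < 1 + (max 0 (t - 1))\<^sup>2" by (smt (verit) zero_le_power2)
  then show "0 \<le> ramp t" "ramp t \<le> 1" by (auto simp: ramp_def)
qed

lemma ramp'_nonneg: "0 \<le> ramp' t"
  by (simp add: ramp'_def)

lemma ramp_tendsto: "(ramp \<longlongrightarrow> 1) at_top"
proof -
  have "((\<lambda>t::real. (t - 1)\<^sup>2 / (1 + (t - 1)\<^sup>2)) \<longlongrightarrow> 1) at_top" by real_asymp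
  then show ?thesis
    by (rule Lim_transform_eventually)
       (use eventually_ge_at_top[of "1::real"] in eventually_elim, simp add: ramp_def)
qed

text \<open>The mass is 1 because \<open>ramp\<close> climbs from 0 to 1. The derivative has a tail
  of order t^(-3) instead of compact support; integrability is enough for the dominated convergence
  that follows.\<close>

lemma integral_ramp':
  "set_integrable lborel {0<..} ramp'" "(LINT t:{0<..}|lborel. ramp' t) = 1"
proof -
  have [measurable]: "ramp' \<in> borel_measurable borel"
    using continuous_on_ramp' by (rule borel_measurable_continuous_onI)
  have nn: "(\<integral>\<^sup>+t. ennreal (ramp' t) * indicator {0..} t \<partial>lborel) = ennreal (1 - ramp 0)"
    by (rule nn_integral_FTC_atLeast[OF _ DERIV_ramp ramp'_nonneg ramp_tendsto]) measurable
  have eq: "(\<lambda>t. indicator {0<..} t *\<^sub>R ramp' t) = (\<lambda>t. ramp' t)"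
    by (rule ext) (auto simp: indicator_def ramp'_le1)
  have "(\<integral>\<^sup>+t. ennreal (ramp' t) \<partial>lborel) = (\<integral>\<^sup>+t. ennreal (ramp' t) * indicator {0..} t \<partial>lborel)"
    by (intro nn_integral_cong) (auto simp: indicator_def ramp'_le1)
  then have nn': "(\<integral>\<^sup>+t. ennreal (ramp' t) \<partial>lborel) = ennreal 1"
    using nn by (simp add: ramp_le1)
  then show "set_integrable lborel {0<..} ramp'"
    unfolding set_integrable_def eq
    by (intro integrableI_nonneg) (auto simp: ramp'_nonneg)
  show "(LINT t:{0<..}|lborel. ramp' t) = 1"
    unfolding set_lebesgue_integral_def eq
    by (rule integral_eq_nn_integral[THEN trans]) (use nn' in \<open>auto simp: ramp'_nonneg\<close>)
qed

text \<open>
  The exponent \<open>- 3 / 2\<close> is integrable on bounded parts of the cone, and near the axis it dominates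
  \<open>|\<nabla>u|\<close>, \<open>|u|\<^sup>2\<close> and \<open>|p|\<close>.
\<close>

lemma integrable_radius_powr:
  "integrable lborel (\<lambda>x :: real ^ 3. indicator {x. radius x \<le> R \<and> z0 \<le> x $ 3 \<and> x $ 3 \<le> z1} x * radius x powr (- 3 / 2))"
proof -
  \<comment> \<open>In the variable s = r^2 the weight r^(-3/2) reads s^(-3/4), and -3/4 >
    -1.\<close>
  define h where "h s = indicator {0..R\<^sup>2} s * s powr (- 3 / 4)" for s :: real
  have [measurable]: "h \<in> borel_measurable borel" unfolding h_def[abs_def] by measurable
  have "((\<lambda>s. s powr (- 3 / 4)) has_integral ((R\<^sup>2) powr (- 3 / 4 + 1) / (- 3 / 4 + 1))) {0..R\<^sup>2}"
    by (rule has_integral_powr_from_0) auto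
  then have "(\<lambda>s. s powr (- 3 / 4)) absolutely_integrable_on {0..R\<^sup>2}"
    by (intro nonnegative_absolutely_integrable_1) (auto intro: has_integral_integrable)
  then have "integrable lebesgue h"
    unfolding set_integrable_def h_def by simp
  then have "integrable lborel h" by (simp add: integrable_completion)
  then have h: "set_integrable lborel {0<..} h"
    unfolding set_integrable_def by (intro integrable_mult_indicator) auto
  define k where "k z = (indicator {z0..z1} z :: real)" for z :: real
  have k: "integrable lborel k" unfolding k_def by (intro integrable_real_indicator emeasure_bounded_finite) auto
  have int: "integrable lborel (\<lambda>x :: real ^ 3. h ((x $ 1)\<^sup>2 + (x $ 2)\<^sup>2) * k (x $ 3))"
    by (rule integral_axisymmetric(1)[OF h k]) fact
  have [measurable]: "radius \<in> borel_measurable borel"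
    by (intro borel_measurable_continuous_onI continuous_intros)
  show ?thesis
  proof (rule Bochner_Integration.integrable_bound[OF int])
    show "AE x in lborel. norm (indicator {x. radius x \<le> R \<and> z0 \<le> x $ 3 \<and> x $ 3 \<le> z1} x * radius x powr (- 3 / 2))
      \<le> norm (h ((x $ 1)\<^sup>2 + (x $ 2)\<^sup>2) * k (x $ 3))"
    proof (intro always_eventually allI)
      fix x :: "real ^ 3"
      have "((radius x)\<^sup>2) powr (- 3 / 4) = (radius x powr 2) powr (- 3 / 4)"
        by (simp add: powr_numeral)
      then have "((radius x)\<^sup>2) powr (- 3 / 4) = radius x powr (- 3 / 2)"
        unfolding powr_powr by simp
      moreover have "(radius x)\<^sup>2 \<le> R\<^sup>2" if "radius x \<le> R" using that by (intro power_mono) auto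
      ultimately show "norm (indicator {x. radius x \<le> R \<and> z0 \<le> x $ 3 \<and> x $ 3 \<le> z1} x * radius x powr (- 3 / 2))
        \<le> norm (h ((x $ 1)\<^sup>2 + (x $ 2)\<^sup>2) * k (x $ 3))"
        by (auto simp: h_def k_def indicator_def abs_mult radius_squared[symmetric])
    qed
  qed measurable
qed

section \<open>The axis as a null set, and compact subsets of the cone\<close>

lemma negligible_x3_axis: "negligible x3_axis"
  by (rule negligible_subset[OF negligible_standard_hyperplane_cart[of 1]]) (auto simp: x3_axis_def)

lemma AE_off_x3_axis: "AE x in lborel. x \<notin> x3_axis"
proof -
  have "x3_axis \<in> null_sets lborel"
    using negligible_x3_axis closed_x3_axis
    by (simp add: negligible_iff_null_sets null_sets_completion_iff)
  then show ?thesis by (rule AE_not_in)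
qed

text \<open>Nothing is known about \<open>F\<close> on the axis, where the derivatives inside it may
  be unspecified values. The axis is null, and for the completed measure arbitrary values on a null
  set disturb neither measurability nor the integral, so computations can be done with Borel
  functions on the punctured cone.\<close>

lemma lebesgue_off_axis:
  fixes F :: "real ^ 3 \<Rightarrow> real"
  assumes "integrable lborel (\<lambda>x. indicator (Cone \<delta> - x3_axis) x * F x)"
  shows "set_integrable lebesgue (Cone \<delta>) F"
    and "(LINT x:Cone \<delta>|lebesgue. F x) = (\<integral>x. indicator (Cone \<delta> - x3_axis) x * F x \<partial>lborel)"
proof -
  let ?G = "\<lambda>x. indicator (Cone \<delta> - x3_axis) x * F x"
  have eq: "indicator (Cone \<delta>) x *\<^sub>R ?G x = ?G x" for x by (auto simp: indicator_def)
  have int: "integrable lebesgue ?G"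
    using assms by (simp add: integrable_completion borel_measurable_integrable)
  then have G: "set_integrable lebesgue (Cone \<delta>) ?G" unfolding set_integrable_def eq .
  show F: "set_integrable lebesgue (Cone \<delta>) F"
    by (rule absolutely_integrable_spike[OF G negligible_x3_axis]) auto
  have "(LINT x:Cone \<delta>|lebesgue. F x) = integral (Cone \<delta>) F"
    by (rule set_lebesgue_integral_eq_integral(2)[OF F])
  also have "\<dots> = integral (Cone \<delta>) ?G"
    by (rule integral_spike[OF negligible_x3_axis]) auto
  also have "\<dots> = (LINT x:Cone \<delta>|lebesgue. ?G x)"
    by (rule set_lebesgue_integral_eq_integral(2)[OF G, symmetric])
  also have "\<dots> = (\<integral>x. ?G x \<partial>lebesgue)" unfolding set_lebesgue_integral_def eq ..
  also have "\<dots> = (\<integral>x. ?G x \<partial>lborel)"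
    using assms by (intro integral_completion) (auto simp: borel_measurable_integrable)
  finally show "(LINT x:Cone \<delta>|lebesgue. F x) = (\<integral>x. ?G x \<partial>lborel)" .
qed

text \<open>A compact set may meet the axis but stays away from the tip and from the lateral
  boundary. So heights have a positive lower bound, and r/x3 stays below some
  \<open>\<delta>' < \<delta>\<close>, a range on which the profile is controlled.\<close>

lemma compact_in_cone:
  assumes "compact K" "K \<subseteq> Cone \<delta>" "\<delta> > 0"
  obtains z0 z1 \<delta>' R where "0 < z0" "0 < \<delta>'" "\<delta>' < \<delta>"
    "\<And>x. x \<in> K \<Longrightarrow> z0 \<le> x $ 3 \<and> x $ 3 \<le> z1 \<and> radius x \<le> \<delta>' * x $ 3 \<and> radius x \<le> R"
proof (cases "K = {}")
  case True
  then show thesis using assms(3) by (intro that[of 1 "\<delta> / 2" 1 1]) auto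
next
  case False
  have pos: "x $ 3 > 0" "radius x / x $ 3 < \<delta>" if "x \<in> K" for x
    using that assms(2) by (auto simp: Cone_def field_simps)
  have c3: "continuous_on K (\<lambda>x. x $ 3)" by (intro continuous_intros)
  have cr: "continuous_on K (\<lambda>x. radius x / x $ 3)"
    using pos(1) by (intro continuous_intros) force
  obtain a where a: "a \<in> K" "\<And>x. x \<in> K \<Longrightarrow> a $ 3 \<le> x $ 3"
    using continuous_attains_inf[OF assms(1) False c3] by blast
  obtain b where b: "b \<in> K" "\<And>x. x \<in> K \<Longrightarrow> x $ 3 \<le> b $ 3"
    using continuous_attains_sup[OF assms(1) False c3] by blast
  obtain c where c: "c \<in> K" "\<And>x. x \<in> K \<Longrightarrow> radius x / x $ 3 \<le> radius c / c $ 3"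
    using continuous_attains_sup[OF assms(1) False cr] by blast
  obtain d where d: "d \<in> K" "\<And>x. x \<in> K \<Longrightarrow> radius x \<le> radius d"
    using continuous_attains_sup[OF assms(1) False continuous_on_radius] by blast
  \<comment> \<open>The maximum with \<open>\<delta> / 2\<close> keeps the constant positive when
    \<open>K\<close> lies on the axis.\<close>
  define \<delta>' where "\<delta>' = max (\<delta> / 2) (radius c / c $ 3)"
  show thesis
  proof (rule that[of "a $ 3" \<delta>' "b $ 3" "radius d"])
    fix x assume x: "x \<in> K"
    have "radius x / x $ 3 \<le> \<delta>'" using c(2)[OF x] by (simp add: \<delta>'_def)
    then have "radius x \<le> \<delta>' * x $ 3" using pos(1)[OF x] by (simp add: field_simps)
    then show "a $ 3 \<le> x $ 3 \<and> x $ 3 \<le> b $ 3 \<and> radius x \<le> \<delta>' * x $ 3 \<and> radius x \<le> radius d"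
      using a b d x by auto
  qed (use pos a c assms(3) in \<open>auto simp: \<delta>'_def\<close>)
qed

section \<open>Test functions, cutoffs and the flux identity\<close>

locale cone_test_function =
  fixes \<delta> :: real and \<phi> :: "real ^ 3 \<Rightarrow> real"
  assumes \<delta>_pos: "\<delta> > 0" and test: "\<phi> \<in> test_functions (Cone \<delta>)"
begin

definition K :: "(real ^ 3) set" where "K = closure {x. \<phi> x \<noteq> 0}"

lemma compact_K: "compact K" and K_subset: "K \<subseteq> Cone \<delta>" and smooth_\<phi>: "smooth_on UNIV \<phi>"
  using test unfolding test_functions_def K_def mem_Collect_eq by blast+

lemma \<phi>_eq_0: "x \<notin> K \<Longrightarrow> \<phi> x = 0"
  unfolding K_def using closure_subset[of "{x. \<phi> x \<noteq> 0}"] by blast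

lemma \<phi>_has_derivative: "(\<phi> has_derivative (\<lambda>h. \<Sum>i\<in>UNIV. h $ i *\<^sub>R partial_deriv i \<phi> x)) (at x)"
  by (intro has_derivative_partial_deriv smooth_on_differentiable[OF smooth_\<phi>]) simp

lemma continuous_\<phi>: "continuous_on A \<phi>" and continuous_d\<phi>: "continuous_on A (partial_deriv i \<phi>)"
  by (rule continuous_on_subset[OF smooth_on_continuous[OF smooth_\<phi>] subset_UNIV],
      rule continuous_on_subset[OF smooth_on_continuous[OF smooth_on_partial_deriv[OF smooth_\<phi>]] subset_UNIV])

lemma d\<phi>_eq_0: assumes "x \<notin> K" shows "partial_deriv i \<phi> x = 0"
proof -
  have "open (- K)" using compact_K by (simp add: compact_imp_closed open_Compl)
  then have "(\<phi> has_derivative (\<lambda>_. 0)) (at x)"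
    using assms \<phi>_eq_0 by (intro has_derivative_transform_within_open[OF has_derivative_const]) auto
  then show ?thesis using partial_deriv_eqI by fastforce
qed

lemma bounded_by:
  assumes "continuous_on UNIV h" "\<And>x. x \<notin> K \<Longrightarrow> h x = 0"
  obtains B :: real where "B \<ge> 0" "\<And>x. \<bar>h x\<bar> \<le> B"
proof -
  have "compact (h ` K)" using compact_continuous_image[OF continuous_on_subset[OF assms(1)] compact_K] by auto
  then obtain B where B: "\<And>y. y \<in> h ` K \<Longrightarrow> norm y \<le> B" using compact_imp_bounded bounded_iff by metis
  show thesis
  proof (rule that[of "\<bar>B\<bar>"])
    fix x show "\<bar>h x\<bar> \<le> \<bar>B\<bar>" using B[of "h x"] assms(2)[of x] by (cases "x \<in> K") auto
  qed simp
qed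

abbreviation S :: "(real ^ 3) set" where "S \<equiv> Cone \<delta> - x3_axis"

lemma open_S: "open S"
  using open_Cone closed_x3_axis by (simp add: open_Diff)

lemma S_borel [measurable]: "S \<in> sets borel"
  using open_S by (rule borel_open)

lemma borel_measurable_on_S: "continuous_on S h \<Longrightarrow> (\<lambda>x. indicator S x * h x :: real) \<in> borel_measurable borel"
  using borel_measurable_continuous_on_indicator[OF S_borel, of h] by simp

text \<open>The factor \<open>h\<close> supplies boundedness and compact support in the cone, and
  the weight r^(-3/2) is an integrable majorant up to the axis.\<close>

lemma integrable_on_S:
  assumes "continuous_on S H" "\<And>x. x \<in> S \<Longrightarrow> x \<in> K \<Longrightarrow> \<bar>H x\<bar> \<le> C * radius x powr (- 3 / 2)"
    and "continuous_on UNIV h" "\<And>x. x \<notin> K \<Longrightarrow> h x = 0"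
  shows "integrable lborel (\<lambda>x. indicator S x * (H x * h x :: real))"
proof -
  obtain z0 z1 \<delta>' R where K: "0 < z0" "0 < \<delta>'" "\<delta>' < \<delta>"
    "\<And>x. x \<in> K \<Longrightarrow> z0 \<le> x $ 3 \<and> x $ 3 \<le> z1 \<and> radius x \<le> \<delta>' * x $ 3 \<and> radius x \<le> R"
    using compact_in_cone[OF compact_K K_subset \<delta>_pos] by metis
  obtain B where B: "B \<ge> 0" "\<And>x. \<bar>h x\<bar> \<le> B" using bounded_by[OF assms(3,4)] by metis
  let ?w = "\<lambda>x. (\<bar>C\<bar> * B) * (indicator {x. radius x \<le> R \<and> z0 \<le> x $ 3 \<and> x $ 3 \<le> z1} x * radius x powr (- 3 / 2))"
  have "integrable lborel ?w" by (intro integrable_mult_right integrable_radius_powr)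
  then show ?thesis
  proof (rule Bochner_Integration.integrable_bound)
    show "(\<lambda>x. indicator S x * (H x * h x)) \<in> borel_measurable lborel"
      using borel_measurable_on_S[of "\<lambda>x. H x * h x"] assms(1) continuous_on_subset[OF assms(3)]
      by (auto intro: continuous_on_mult)
    show "AE x in lborel. norm (indicator S x * (H x * h x)) \<le> norm (?w x)"
    proof (intro always_eventually allI)
      fix x
      show "norm (indicator S x * (H x * h x)) \<le> norm (?w x)"
      proof (cases "x \<in> S \<and> x \<in> K")
        case True
        then have "\<bar>H x\<bar> \<le> \<bar>C\<bar> * radius x powr (- 3 / 2)"
          using assms(2)[of x] by (smt (verit) mult_right_mono powr_ge_zero)
        then have "\<bar>H x\<bar> * \<bar>h x\<bar> \<le> (\<bar>C\<bar> * radius x powr (- 3 / 2)) * B"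
          using B by (intro mult_mono) auto
        then show ?thesis using True K(4)[of x] B(1) by (simp add: abs_mult algebra_simps)
      next
        case False
        then show ?thesis using assms(4) by (cases "x \<in> S") auto
      qed
    qed
  qed
qed

text \<open>\<open>N\<close> stands for 1/\<epsilon>: the cutoff vanishes where r \<le> 1/N. Its
  gradient is \<open>D N x\<close> times the vector (x1, x2, 0), so that pairing it with a field
  brings out the radial part of the field.\<close>

definition cutoff :: "real \<Rightarrow> real ^ 3 \<Rightarrow> real" where "cutoff N x = ramp (N\<^sup>2 * ((x $ 1)\<^sup>2 + (x $ 2)\<^sup>2))"
definition D :: "real \<Rightarrow> real ^ 3 \<Rightarrow> real" where "D N x = 2 * N\<^sup>2 * ramp' (N\<^sup>2 * ((x $ 1)\<^sup>2 + (x $ 2)\<^sup>2))"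

lemma cutoff_has_derivative: "(cutoff N has_derivative (\<lambda>h. D N x * (x $ 1 * h $ 1 + x $ 2 * h $ 2))) (at x)"
proof -
  have "((\<lambda>x :: real ^ 3. N\<^sup>2 * ((x $ 1)\<^sup>2 + (x $ 2)\<^sup>2)) has_derivative
      (\<lambda>h. N\<^sup>2 * (2 * x $ 1 * h $ 1 + 2 * x $ 2 * h $ 2))) (at x)"
    by (auto intro!: derivative_eq_intros bounded_linear.has_derivative[OF bounded_linear_vec_nth] simp: algebra_simps)
  from has_derivative_compose[OF this DERIV_ramp[unfolded has_field_derivative_def]]
  have "((\<lambda>x. cutoff N x) has_derivative (\<lambda>h. ramp' (N\<^sup>2 * ((x $ 1)\<^sup>2 + (x $ 2)\<^sup>2)) * (N\<^sup>2 * (2 * x $ 1 * h $ 1 + 2 * x $ 2 * h $ 2)))) (at x)"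
    by (simp add: cutoff_def[abs_def])
  then show ?thesis by (rule has_derivative_eq_rhs) (auto simp: D_def fun_eq_iff algebra_simps)
qed

lemma continuous_cutoff: "continuous_on A (cutoff N)"
  by (intro continuous_at_imp_continuous_on ballI has_derivative_continuous[OF cutoff_has_derivative])

lemma continuous_D: "continuous_on A (D N)"
proof -
  have "continuous_on A (\<lambda>x :: real ^ 3. ramp' (N\<^sup>2 * ((x $ 1)\<^sup>2 + (x $ 2)\<^sup>2)))"
    by (rule continuous_on_compose2[OF continuous_on_ramp' _ subset_UNIV]) (intro continuous_intros)
  then show ?thesis unfolding D_def[abs_def] by (intro continuous_on_mult continuous_on_const)
qed

text \<open>The function \<open>\<phi>\<close> times the cutoff is supported off the axis, so a
  divergence-free field tested against it gives 0. \<open>A\<close> collects the derivatives that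
  fall on \<phi>, and \<open>B\<close> those that fall on the cutoff.\<close>

lemma cutoff_flux:
  fixes \<Phi> :: "3 \<Rightarrow> real ^ 3 \<Rightarrow> real"
  assumes dif: "\<And>i x. x \<in> S \<Longrightarrow> \<Phi> i differentiable (at x)"
    and cont: "\<And>i. continuous_on S (partial_deriv i (\<Phi> i))"
    and div: "\<And>x. x \<in> S \<Longrightarrow> (\<Sum>i\<in>UNIV. partial_deriv i (\<Phi> i) x) = 0"
    and N: "N > 0"
  defines "A \<equiv> \<lambda>x. indicator S x * (cutoff N x * (\<Sum>i\<in>UNIV. \<Phi> i x * partial_deriv i \<phi> x))"
    and "B \<equiv> \<lambda>x. indicator S x * (\<phi> x * D N x * (x $ 1 * \<Phi> 1 x + x $ 2 * \<Phi> 2 x))"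
  shows "integrable lborel (\<lambda>x. A x + B x)" and "(\<integral>x. A x + B x \<partial>lborel) = 0"
proof -
  define w where "w x = \<phi> x * cutoff N x" for x
  define w' where "w' x h = \<phi> x * (D N x * (x $ 1 * h $ 1 + x $ 2 * h $ 2)) + (\<Sum>i\<in>UNIV. h $ i *\<^sub>R partial_deriv i \<phi> x) * cutoff N x"
    for x h :: "real ^ 3"
  have w: "(w has_derivative w' x) (at x)" for x
    unfolding w_def[abs_def] w'_def[abs_def] by (rule has_derivative_mult[OF \<phi>_has_derivative cutoff_has_derivative])
  have cw': "continuous_on UNIV (\<lambda>x. w' x e)" for e
    unfolding w'_def by (intro continuous_intros continuous_\<phi> continuous_d\<phi> continuous_cutoff continuous_D)
  \<comment> \<open>Closed in \<open>K\<close> and at distance at least 1/N from the axis, hence a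
    compact subset of the punctured cone; off this set the product is zero.\<close>
  define T where "T = K \<inter> {x. 1 \<le> N\<^sup>2 * ((x $ 1)\<^sup>2 + (x $ 2)\<^sup>2)}"
  have T: "compact T" unfolding T_def
    by (intro compact_Int_closed compact_K closed_Collect_le continuous_intros)
  have TS: "T \<subseteq> S"
    using K_subset by (auto simp: T_def x3_axis_def)
  have w0: "w x = 0" if "x \<notin> T" for x
    using that \<phi>_eq_0[of x] by (auto simp: T_def w_def cutoff_def ramp_le1)
  have \<Phi>': "(\<Phi> i has_derivative (\<lambda>h. \<Sum>k\<in>UNIV. h $ k *\<^sub>R partial_deriv k (\<Phi> i) x)) (at x)" if "x \<in> S" for i x
    using has_derivative_partial_deriv[OF dif[OF that]] .
  have ax: "(\<Sum>k\<in>UNIV. axis i 1 $ k *\<^sub>R v k) = (v i :: real)" for i :: 3 and v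
    by (simp add: axis_def if_distrib[of "\<lambda>a. a * _"] cong: if_cong)
  note ibp = integral_by_parts_open[OF open_S \<Phi>' _ w cw' T TS w0, where e = "axis i 1" for i, unfolded ax, OF _ cont]
  have i1: "integrable lborel (\<lambda>x. indicator S x * (\<Phi> i x * w' x (axis i 1)))"
   and i2: "integrable lborel (\<lambda>x. indicator S x * (partial_deriv i (\<Phi> i) x * w x))"
   and i3: "(\<integral>x. indicator S x * (\<Phi> i x * w' x (axis i 1)) \<partial>lborel)
       = - (\<integral>x. indicator S x * (partial_deriv i (\<Phi> i) x * w x) \<partial>lborel)" for i
    using ibp by auto
  have eq: "A x + B x = (\<Sum>i\<in>UNIV. indicator S x * (\<Phi> i x * w' x (axis i 1)))" for x
    unfolding A_def B_def w'_def ax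
    by (simp add: sum_3 axis_def algebra_simps)
  show "integrable lborel (\<lambda>x. A x + B x)"
    unfolding eq by (intro Bochner_Integration.integrable_sum i1)
  have "(\<integral>x. A x + B x \<partial>lborel) = - (\<Sum>i\<in>UNIV. \<integral>x. indicator S x * (partial_deriv i (\<Phi> i) x * w x) \<partial>lborel)"
    unfolding eq by (subst Bochner_Integration.integral_sum[OF i1]) (simp add: i3 sum_negf)
  also have "(\<Sum>i\<in>UNIV. \<integral>x. indicator S x * (partial_deriv i (\<Phi> i) x * w x) \<partial>lborel)
    = (\<integral>x. (\<Sum>i\<in>UNIV. indicator S x * (partial_deriv i (\<Phi> i) x * w x)) \<partial>lborel)"
    by (rule Bochner_Integration.integral_sum[OF i2, symmetric])
  also have "(\<lambda>x. \<Sum>i\<in>UNIV. indicator S x * (partial_deriv i (\<Phi> i) x * w x)) = (\<lambda>_. 0)"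
  proof
    fix x
    show "(\<Sum>i\<in>UNIV. indicator S x * (partial_deriv i (\<Phi> i) x * w x)) = 0"
      using div[of x] by (cases "x \<in> S") (auto simp flip: sum_distrib_right)
  qed
  finally show "(\<integral>x. A x + B x \<partial>lborel) = 0" by simp
qed

text \<open>The support of \<phi> is compact in the cone and therefore misses the tip, so along the
  axis it is compact in the open half-line, where \<open>ln\<close> is smooth. The third statement
  is the one-dimensional integration by parts that trades 1/z for ln z.\<close>

lemma axis_profile_integrable:
  "integrable lborel (\<lambda>z. indicator {0<..} z * (\<phi> (vector [0, 0, z]) / z))"
  "integrable lborel (\<lambda>z. indicator {0<..} z * (ln \<bar>z\<bar> * partial_deriv 3 \<phi> (vector [0, 0, z])))"
  "(\<integral>z. indicator {0<..} z * (ln \<bar>z\<bar> * partial_deriv 3 \<phi> (vector [0, 0, z])) \<partial>lborel)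
     = - (\<integral>z. indicator {0<..} z * (\<phi> (vector [0, 0, z]) / z) \<partial>lborel)"
proof -
  define T where "T = (\<lambda>x. x $ 3) ` K"
  have T: "compact T" unfolding T_def by (intro compact_continuous_image continuous_intros compact_K)
  have T0: "T \<subseteq> {0<..}" using K_subset by (auto simp: T_def Cone_def)
  have out: "vector [0, 0, z] \<notin> K" if "z \<notin> T" for z
    using that imageI[of "vector [0, 0, z]" K "\<lambda>x. x $ 3"] by (auto simp: T_def)
  have line: "((\<lambda>z. vector [0, 0, z] :: real ^ 3) has_derivative (\<lambda>h. h *\<^sub>R axis 3 1)) (at z)" for z
    unfolding vector_3_axis by (auto intro!: derivative_eq_intros)
  have w: "((\<lambda>z. \<phi> (vector [0, 0, z])) has_derivative (\<lambda>h. h * partial_deriv 3 \<phi> (vector [0, 0, z]))) (at z)" for z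
    using has_derivative_compose[OF line \<phi>_has_derivative]
    by (rule has_derivative_eq_rhs) (simp add: sum_3 axis_def)
  have cl: "continuous_on A (\<lambda>z. vector [0, 0, z] :: real ^ 3)" for A
    unfolding vector_3_axis by (intro continuous_intros)
  have w': "continuous_on UNIV (\<lambda>z. 1 * partial_deriv 3 \<phi> (vector [0, 0, z]))"
    by (intro continuous_intros continuous_on_compose2[OF continuous_d\<phi> cl]) auto
  have a: "(ln has_derivative (\<lambda>h. h / z)) (at z)" if "z \<in> {0<..}" for z :: real
  proof -
    have "(*) (1 / z) = (\<lambda>h. h / z)" by auto
    then show ?thesis using that DERIV_ln_divide[of z] by (simp add: has_field_derivative_def)
  qed
  have a': "continuous_on {0<..} (\<lambda>z. 1 / z :: real)"
    by (intro continuous_intros) auto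
  note ibp = integral_by_parts_open[OF open_greaterThan a a' w w' T T0 \<phi>_eq_0[OF out]]
  have abs: "indicator {0<..} z * (ln \<bar>z\<bar> * v) = indicator {0<..} z * (ln z * (1 * v))" for z v :: real
    by (auto simp: indicator_def)
  show "integrable lborel (\<lambda>z. indicator {0<..} z * (\<phi> (vector [0, 0, z]) / z))"
    using ibp(2) by simp
  show "integrable lborel (\<lambda>z. indicator {0<..} z * (ln \<bar>z\<bar> * partial_deriv 3 \<phi> (vector [0, 0, z])))"
    unfolding abs by (rule ibp(1))
  show "(\<integral>z. indicator {0<..} z * (ln \<bar>z\<bar> * partial_deriv 3 \<phi> (vector [0, 0, z])) \<partial>lborel)
     = - (\<integral>z. indicator {0<..} z * (\<phi> (vector [0, 0, z]) / z) \<partial>lborel)"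
    unfolding abs using ibp(3) by simp
qed

text \<open>Let \<open>N\<close> tend to infinity in the cutoff identity. The integrals of
  \<open>A\<close> converge by the integrable weight. In those of \<open>B\<close> the substitution
  x' = y'/N has Jacobian N^(-2), which cancels the N^2 in \<open>D\<close>; what remains is
  \<open>2 * ramp'\<close> at |y'|^2, of mass 2 \<pi> over the plane, times \<phi> on the axis and
  the limiting radial flux l/z. The minus sign appears because \<open>A\<close> and \<open>B\<close>
  cancel.\<close>

lemma flux_through_axis:
  fixes \<Phi> :: "3 \<Rightarrow> real ^ 3 \<Rightarrow> real"
  assumes dif: "\<And>i x. x \<in> S \<Longrightarrow> \<Phi> i differentiable (at x)"
    and cont: "\<And>i. continuous_on S (partial_deriv i (\<Phi> i))"
    and div: "\<And>x. x \<in> S \<Longrightarrow> (\<Sum>i\<in>UNIV. partial_deriv i (\<Phi> i) x) = 0"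
    and bound: "\<And>i x. x \<in> S \<Longrightarrow> x \<in> K \<Longrightarrow> \<bar>\<Phi> i x\<bar> \<le> C * radius x powr (- 3 / 2)"
    and radial_bound: "\<And>x. x \<in> S \<Longrightarrow> x \<in> K \<Longrightarrow> \<bar>x $ 1 * \<Phi> 1 x + x $ 2 * \<Phi> 2 x\<bar> \<le> C"
    and radial_limit: "\<And>y. y $ 3 > 0 \<Longrightarrow> y \<notin> x3_axis \<Longrightarrow>
      ((\<lambda>\<epsilon>. \<epsilon> * y $ 1 * \<Phi> 1 (vector [\<epsilon> * y $ 1, \<epsilon> * y $ 2, y $ 3])
          + \<epsilon> * y $ 2 * \<Phi> 2 (vector [\<epsilon> * y $ 1, \<epsilon> * y $ 2, y $ 3])) \<longlongrightarrow> l / y $ 3) (at_right 0)"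
  shows "integrable lborel (\<lambda>x. indicator S x * (\<Sum>i\<in>UNIV. \<Phi> i x * partial_deriv i \<phi> x))"
    and "(\<integral>x. indicator S x * (\<Sum>i\<in>UNIV. \<Phi> i x * partial_deriv i \<phi> x) \<partial>lborel)
      = - 2 * pi * l * (\<integral>z. indicator {0<..} z * (\<phi> (vector [0, 0, z]) / z) \<partial>lborel)"
proof -
  have c\<Phi>: "continuous_on S (\<Phi> i)" for i
    using dif by (meson continuous_at_imp_continuous_on differentiable_imp_continuous_within)
  define G where "G x = indicator S x * (\<Sum>i\<in>UNIV. \<Phi> i x * partial_deriv i \<phi> x)" for x
  have "integrable lborel (\<lambda>x. \<Sum>i\<in>UNIV. indicator S x * (\<Phi> i x * partial_deriv i \<phi> x))"
    by (intro Bochner_Integration.integrable_sum integrable_on_S[where C = C] c\<Phi> continuous_d\<phi> bound d\<phi>_eq_0)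
  then show G: "integrable lborel G"
    unfolding G_def by (simp add: sum_distrib_left)
  have [measurable]: "G \<in> borel_measurable borel" using G by (simp add: borel_measurable_integrable)
  define N where "N n = real (Suc n)" for n
  have N: "N n > 0" for n by (simp add: N_def)
  have N_top: "filterlim N at_top sequentially"
    unfolding N_def by (rule filterlim_compose[OF filterlim_real_sequentially filterlim_Suc])
  define \<Psi> where "\<Psi> x = x $ 1 * \<Phi> 1 x + x $ 2 * \<Phi> 2 x" for x
  have c\<Psi>: "continuous_on S \<Psi>" unfolding \<Psi>_def[abs_def] by (intro continuous_intros c\<Phi>)
  define A where "A n x = indicator S x * (cutoff (N n) x * (\<Sum>i\<in>UNIV. \<Phi> i x * partial_deriv i \<phi> x))" for n x
  define B where "B n x = indicator S x * (\<phi> x * D (N n) x * \<Psi> x)" for n x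
  have AG: "A n x = cutoff (N n) x * G x" for n x by (simp add: A_def G_def)
  note cf = cutoff_flux[OF dif cont div N, folded \<Psi>_def, folded A_def B_def]
  have [measurable]: "cutoff (N n) \<in> borel_measurable borel" for n
    using continuous_cutoff by (rule borel_measurable_continuous_onI)
  have cutoff1: "\<bar>cutoff M x\<bar> \<le> 1" for M x using ramp_bounds by (simp add: cutoff_def)
  have intA: "integrable lborel (A n)" for n
    unfolding AG[abs_def]
  proof (rule Bochner_Integration.integrable_bound[OF G])
    show "AE x in lborel. norm (cutoff (N n) x * G x) \<le> norm (G x)"
      using cutoff1 by (intro always_eventually allI) (simp add: abs_mult mult_left_le_one_le)
  qed measurable
  have s_pos: "(x $ 1)\<^sup>2 + (x $ 2)\<^sup>2 > 0" if "x \<notin> x3_axis" for x :: "real ^ 3"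
    using that by (auto simp: x3_axis_def sum_power2_gt_zero_iff)
  have limA: "(\<lambda>n. \<integral>x. A n x \<partial>lborel) \<longlonglongrightarrow> (\<integral>x. G x \<partial>lborel)"
  proof (rule integral_dominated_convergence[where w = "\<lambda>x. norm (G x)"])
    show "integrable lborel (\<lambda>x. norm (G x))" using G by simp
    show "AE x in lborel. norm (A n x) \<le> norm (G x)" for n
      using cutoff1 by (intro always_eventually allI) (simp add: AG abs_mult mult_left_le_one_le)
    show "AE x in lborel. (\<lambda>n. A n x) \<longlonglongrightarrow> G x"
      using AE_off_x3_axis
    proof eventually_elim
      case (elim x)
      have "filterlim (\<lambda>n. ((x $ 1)\<^sup>2 + (x $ 2)\<^sup>2) * (N n)\<^sup>2) at_top sequentially"
        by (rule filterlim_tendsto_pos_mult_at_top[OF tendsto_const s_pos[OF elim] filterlim_pow_at_top[OF _ N_top]]) simp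
      then have "filterlim (\<lambda>n. (N n)\<^sup>2 * ((x $ 1)\<^sup>2 + (x $ 2)\<^sup>2)) at_top sequentially"
        by (simp only: mult.commute)
      from filterlim_compose[OF ramp_tendsto this]
      have "(\<lambda>n. cutoff (N n) x) \<longlonglongrightarrow> 1" by (simp add: cutoff_def)
      from tendsto_mult_right[OF this, of "G x"] show ?case by (simp add: AG)
    qed
  qed (use borel_measurable_integrable[OF intA] in auto)
  have B_eq: "(\<integral>x. B n x \<partial>lborel) = - (\<integral>x. A n x \<partial>lborel)" for n
  proof -
    have "(\<integral>x. (A n x + B n x) - A n x \<partial>lborel) = (\<integral>x. A n x + B n x \<partial>lborel) - (\<integral>x. A n x \<partial>lborel)"
      by (rule Bochner_Integration.integral_diff[OF cf(1) intA])
    then show ?thesis using cf(2) by simp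
  qed
  define sc where "sc n y = (vector [y $ 1 / N n, y $ 2 / N n, y $ 3] :: real ^ 3)" for n and y :: "real ^ 3"
  \<comment> \<open>The integrand \<open>B n\<close> in the rescaled variable; the index survives
    only through the point \<open>sc n y\<close>.\<close>
  define s where "s n y = indicator S (sc n y) * (\<phi> (sc n y) * \<Psi> (sc n y)) * (2 * ramp' ((y $ 1)\<^sup>2 + (y $ 2)\<^sup>2))" for n y
  have cB: "continuous_on S (\<lambda>x. \<phi> x * D (N n) x * \<Psi> x)" for n
    by (intro continuous_intros continuous_\<phi> continuous_D c\<Psi>)
  have mB [measurable]: "B n \<in> borel_measurable borel" for n
    unfolding B_def by (rule borel_measurable_on_S[OF cB])
  have Bs: "(\<integral>x. B n x \<partial>lborel) = (\<integral>y. s n y \<partial>lborel)" for n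
  proof -
    have "(\<integral>x. B n x \<partial>lborel) = (1 / N n)\<^sup>2 * (\<integral>y. B n (vector [1 / N n * y $ 1, 1 / N n * y $ 2, y $ 3]) \<partial>(lborel :: (real ^ 3) measure))"
      using N[of n] by (intro integral_scale_horizontal) auto
    also have "\<dots> = (\<integral>y. (1 / N n)\<^sup>2 * B n (sc n y) \<partial>lborel)" by (simp add: sc_def)
    also have "(\<lambda>y. (1 / N n)\<^sup>2 * B n (sc n y)) = s n"
    proof
      fix y
      have "(N n)\<^sup>2 * ((sc n y $ 1)\<^sup>2 + (sc n y $ 2)\<^sup>2) = (y $ 1)\<^sup>2 + (y $ 2)\<^sup>2"
        using N[of n] by (simp add: sc_def field_simps)
      then show "(1 / N n)\<^sup>2 * B n (sc n y) = s n y"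
        using N[of n] by (simp add: B_def s_def D_def field_simps)
    qed
    finally show ?thesis .
  qed
  define \<kappa> where "\<kappa> z = indicator {0<..} z * (\<phi> (vector [0, 0, z]) / z)" for z
  have \<kappa>: "integrable lborel \<kappa>" unfolding \<kappa>_def by (rule axis_profile_integrable)
  have mr [measurable]: "ramp' \<in> borel_measurable borel"
    using continuous_on_ramp' by (rule borel_measurable_continuous_onI)
  have [measurable]: "\<kappa> \<in> borel_measurable borel" using \<kappa> by (simp add: borel_measurable_integrable)
  obtain z0 z1 \<delta>' R where K: "0 < z0" "\<And>x. x \<in> K \<Longrightarrow> z0 \<le> x $ 3 \<and> x $ 3 \<le> z1"
    using compact_in_cone[OF compact_K K_subset \<delta>_pos] by metis
  obtain M where M: "M \<ge> 0" "\<And>x. \<bar>\<phi> x\<bar> \<le> M" using bounded_by[OF continuous_\<phi> \<phi>_eq_0] by metis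
  have lim_s: "(\<lambda>n. \<integral>y. s n y \<partial>lborel) \<longlonglongrightarrow> (\<integral>y. ramp' ((y $ 1)\<^sup>2 + (y $ 2)\<^sup>2) * (2 * l * \<kappa> (y $ 3)) \<partial>(lborel :: (real ^ 3) measure))"
  \<comment> \<open>The majorant is independent of \<open>n\<close>: the radial flux is bounded by
    \<open>C\<close> on the support, and the rescaling does not touch the height, so
    \<open>y $ 3\<close> remains in \<open>{z0..z1}\<close>.\<close>
  proof (rule integral_dominated_convergence[where w = "\<lambda>y. ramp' ((y $ 1)\<^sup>2 + (y $ 2)\<^sup>2) * (2 * M * \<bar>C\<bar> * indicator {z0..z1} (y $ 3))"])
    show "integrable lborel (\<lambda>y :: real ^ 3. ramp' ((y $ 1)\<^sup>2 + (y $ 2)\<^sup>2) * (2 * M * \<bar>C\<bar> * indicator {z0..z1} (y $ 3)))"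
      by (rule integral_axisymmetric(1)[OF integral_ramp'(1) _ mr])
         (intro integrable_mult_right integrable_real_indicator emeasure_bounded_finite, auto)
    show "(\<lambda>y :: real ^ 3. ramp' ((y $ 1)\<^sup>2 + (y $ 2)\<^sup>2) * (2 * l * \<kappa> (y $ 3))) \<in> borel_measurable lborel"
      by measurable
    have [measurable]: "sc n \<in> borel \<rightarrow>\<^sub>M borel" for n
      unfolding sc_def[abs_def] vector_3_axis
      by (intro borel_measurable_continuous_onI) (auto intro!: continuous_intros simp: divide_inverse)
    have mS [measurable]: "(\<lambda>x. indicator S x * (\<phi> x * \<Psi> x)) \<in> borel_measurable borel"
      by (intro borel_measurable_on_S continuous_intros continuous_\<phi> c\<Psi>)
    show "s n \<in> borel_measurable lborel" for n
      unfolding s_def[abs_def] using measurable_compose[of "sc n" borel borel, OF _ mS] by measurable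
    show "AE y in lborel. norm (s n y) \<le> ramp' ((y $ 1)\<^sup>2 + (y $ 2)\<^sup>2) * (2 * M * \<bar>C\<bar> * indicator {z0..z1} (y $ 3))" for n
    proof (intro always_eventually allI)
      fix y :: "real ^ 3"
      show "norm (s n y) \<le> ramp' ((y $ 1)\<^sup>2 + (y $ 2)\<^sup>2) * (2 * M * \<bar>C\<bar> * indicator {z0..z1} (y $ 3))"
      proof (cases "sc n y \<in> S \<and> sc n y \<in> K")
        case True
        then have "\<bar>\<phi> (sc n y)\<bar> * \<bar>\<Psi> (sc n y)\<bar> \<le> M * \<bar>C\<bar>"
          using M radial_bound[of "sc n y"] by (intro mult_mono) (auto simp: \<Psi>_def)
        then have "ramp' ((y $ 1)\<^sup>2 + (y $ 2)\<^sup>2) * (2 * (\<bar>\<phi> (sc n y)\<bar> * \<bar>\<Psi> (sc n y)\<bar>))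
          \<le> ramp' ((y $ 1)\<^sup>2 + (y $ 2)\<^sup>2) * (2 * (M * \<bar>C\<bar>))"
          using ramp'_nonneg by (intro mult_left_mono) auto
        moreover have "y $ 3 \<in> {z0..z1}" using K(2)[of "sc n y"] True by (simp add: sc_def)
        ultimately show ?thesis using True ramp'_nonneg by (simp add: s_def abs_mult algebra_simps)
      next
        case False
        then have "s n y = 0" using \<phi>_eq_0[of "sc n y"] by (auto simp: s_def)
        then show ?thesis using M ramp'_nonneg by simp
      qed
    qed
    show "AE y in lborel. (\<lambda>n. s n y) \<longlonglongrightarrow> ramp' ((y $ 1)\<^sup>2 + (y $ 2)\<^sup>2) * (2 * l * \<kappa> (y $ 3))"
      using AE_off_x3_axis
    proof eventually_elim
      case (elim y)
      show ?case
      proof (cases "y $ 3 > 0")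
        case False
        have "s n y = 0" for n
        proof -
          have "sc n y \<notin> S" using False by (auto simp: sc_def Cone_def)
          then show ?thesis by (simp add: s_def)
        qed
        then show ?thesis using False by (simp add: \<kappa>_def)
      next
        case True
        have inv: "filterlim (\<lambda>n. 1 / N n) (at_right 0) sequentially"
          using N filterlim_compose[OF filterlim_inverse_at_right_top N_top] by (simp add: divide_inverse)
        then have inv0: "(\<lambda>n. 1 / N n) \<longlonglongrightarrow> 0" by (simp add: filterlim_at)
        have scl: "(\<lambda>n. sc n y) \<longlonglongrightarrow> vector [0, 0, y $ 3]"
        proof -
          have "(\<lambda>n. (1 / N n * y $ 1) *\<^sub>R axis 1 1 + (1 / N n * y $ 2) *\<^sub>R axis 2 1 + y $ 3 *\<^sub>R (axis 3 1 :: real ^ 3))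
             \<longlonglongrightarrow> (0 * y $ 1) *\<^sub>R axis 1 1 + (0 * y $ 2) *\<^sub>R axis 2 1 + y $ 3 *\<^sub>R axis 3 1"
            by (intro tendsto_intros inv0)
          then show ?thesis by (simp add: sc_def vector_3_axis)
        qed
        \<comment> \<open>The rescaled points converge to a point of the axis inside the cone; as
          the cone is open they eventually lie in it, and the indicator in \<open>s\<close> becomes
          1.\<close>
        have "vector [0, 0, y $ 3] \<in> Cone \<delta>" using True \<delta>_pos by (simp add: Cone_def radius_def)
        then have evC: "\<forall>\<^sub>F n in sequentially. sc n y \<in> Cone \<delta>"
          using scl open_Cone topological_tendstoD by blast
        have notax: "sc n y \<notin> x3_axis" for n
          using elim N[of n] by (auto simp: sc_def x3_axis_def)
        have \<phi>l: "(\<lambda>n. \<phi> (sc n y)) \<longlonglongrightarrow> \<phi> (vector [0, 0, y $ 3])"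
          using continuous_on_tendsto_compose[OF continuous_\<phi>[of UNIV] scl] by auto
        have "(\<lambda>n. \<Psi> (sc n y)) \<longlonglongrightarrow> l / y $ 3"
          using filterlim_compose[OF radial_limit[OF True elim] inv] by (simp add: \<Psi>_def sc_def)
        then have "(\<lambda>n. \<phi> (sc n y) * \<Psi> (sc n y) * (2 * ramp' ((y $ 1)\<^sup>2 + (y $ 2)\<^sup>2)))
          \<longlonglongrightarrow> \<phi> (vector [0, 0, y $ 3]) * (l / y $ 3) * (2 * ramp' ((y $ 1)\<^sup>2 + (y $ 2)\<^sup>2))"
          by (intro tendsto_intros \<phi>l)
        moreover have "\<phi> (vector [0, 0, y $ 3]) * (l / y $ 3) * (2 * ramp' ((y $ 1)\<^sup>2 + (y $ 2)\<^sup>2))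
            = ramp' ((y $ 1)\<^sup>2 + (y $ 2)\<^sup>2) * (2 * l * \<kappa> (y $ 3))"
          using True by (simp add: \<kappa>_def)
        moreover have "\<forall>\<^sub>F n in sequentially. \<phi> (sc n y) * \<Psi> (sc n y) * (2 * ramp' ((y $ 1)\<^sup>2 + (y $ 2)\<^sup>2)) = s n y"
          using evC by eventually_elim (simp add: s_def notax)
        ultimately show ?thesis by (auto intro: Lim_transform_eventually)
      qed
    qed
  qed
  have "(\<integral>y. ramp' ((y $ 1)\<^sup>2 + (y $ 2)\<^sup>2) * (2 * l * \<kappa> (y $ 3)) \<partial>(lborel :: (real ^ 3) measure)) = pi * 1 * (2 * l * (\<integral>z. \<kappa> z \<partial>lborel))"
    using integral_axisymmetric(2)[OF integral_ramp'(1) integrable_mult_right[OF \<kappa>, of "2 * l"] mr]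
    unfolding integral_ramp'(2) by simp
  with lim_s have "(\<lambda>n. \<integral>x. B n x \<partial>lborel) \<longlonglongrightarrow> pi * 1 * (2 * l * (\<integral>z. \<kappa> z \<partial>lborel))"
    by (simp only: Bs)
  then have "(\<lambda>n. - (\<integral>x. A n x \<partial>lborel)) \<longlonglongrightarrow> pi * 1 * (2 * l * (\<integral>z. \<kappa> z \<partial>lborel))"
    by (simp only: B_eq)
  from LIMSEQ_unique[OF this tendsto_minus[OF limA]]
  have "(\<integral>x. G x \<partial>lborel) = - 2 * pi * l * (\<integral>z. \<kappa> z \<partial>lborel)" by simp
  then show "(\<integral>x. indicator S x * (\<Sum>i\<in>UNIV. \<Phi> i x * partial_deriv i \<phi> x) \<partial>lborel)
      = - 2 * pi * l * (\<integral>z. indicator {0<..} z * (\<phi> (vector [0, 0, z]) / z) \<partial>lborel)"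
    by (simp add: G_def \<kappa>_def)
qed

end

subsection \<open>The stress of the flow\<close>

text \<open>On a bounded set a milder singularity r^(-a) is dominated by the common weight r^(-3/2),
  at the price of a factor R^(3/2 - a).\<close>

lemma powr_weight_bound:
  fixes r R a X C :: real
  assumes "0 < r" "r \<le> R" "a \<le> 3 / 2" "C \<ge> 0" "r powr a * X \<le> C"
  shows "X \<le> C * R powr (3 / 2 - a) * r powr (- 3 / 2)"
proof -
  have "X = r powr (- a) * (r powr a * X)"
    using assms(1) by (simp add: powr_minus)
  also have "\<dots> \<le> r powr (- a) * C"
    using assms by (intro mult_left_mono) auto
  also have "r powr (- a) = r powr (3 / 2 - a) * r powr (- 3 / 2)"
    by (simp flip: powr_add)
  also have "\<dots> * C \<le> R powr (3 / 2 - a) * r powr (- 3 / 2) * C"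
    using assms by (intro mult_right_mono powr_mono2) auto
  finally show ?thesis by (simp add: algebra_simps)
qed

section \<open>Bounds for the flow on compact subsets of the cone\<close>

context parametrised_flow
begin

text \<open>The exponent 1/4 is chosen with its consequences in mind: |u|^2 then costs 1/2 and the
  gradient 1 + 1/4, both below the admissible 3/2. The bounds hold away from the lateral boundary
  only, hence \<open>\<delta>' < \<delta>\<close>.\<close>

lemma profile_bounds:
  assumes "\<delta>' < \<delta>"
  obtains C where "C > 0"
    "\<And>\<rho>. 0 < \<rho> \<Longrightarrow> \<rho> \<le> \<delta>' \<Longrightarrow> \<rho> powr (1 / 4) * norm (f \<rho>) \<le> C"
    "\<And>\<rho>. 0 < \<rho> \<Longrightarrow> \<rho> \<le> \<delta>' \<Longrightarrow> norm (g \<rho>) \<le> C"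
    "\<And>\<rho>. 0 < \<rho> \<Longrightarrow> \<rho> \<le> \<delta>' \<Longrightarrow> \<rho> powr (1 / 2) * \<bar>P \<rho>\<bar> \<le> C"
proof -
  have cont: "continuous_on {0<..<\<delta>} h"
    if ex: "\<And>\<rho>. 0 < \<rho> \<Longrightarrow> \<rho> < \<delta> \<Longrightarrow> \<exists>h'. (h has_vector_derivative h') (at \<rho>)"
    for h :: "real \<Rightarrow> 'c::real_normed_vector"
  proof (rule continuous_at_imp_continuous_on, rule ballI)
    fix \<rho> assume "\<rho> \<in> {0<..<\<delta>}"
    then obtain h' where "(h has_vector_derivative h') (at \<rho>)" using ex by fastforce
    then show "isCont h \<rho>" by (rule has_vector_derivative_continuous)
  qed
  have cf: "continuous_on {0<..<\<delta>} f" and cg: "continuous_on {0<..<\<delta>} g" and cP: "continuous_on {0<..<\<delta>} P"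
    by (rule cont; use has_vector_derivative_f has_vector_derivative_g has_vector_derivative_P in blast)+
  have "continuous_on {0<..<\<delta>} (\<lambda>\<rho>. \<rho> powr (1 / 4) *\<^sub>R f \<rho>)"
    by (intro continuous_intros cf) auto
  from bounded_near_0[OF this f_powr_tendsto_0(2) assms] obtain C1 where
    C1: "C1 > 0" "\<And>\<rho>. 0 < \<rho> \<Longrightarrow> \<rho> \<le> \<delta>' \<Longrightarrow> norm (\<rho> powr (1 / 4) *\<^sub>R f \<rho>) \<le> C1" by auto
  from bounded_near_0[OF cg g_tendsto assms] obtain C2 where
    C2: "C2 > 0" "\<And>\<rho>. 0 < \<rho> \<Longrightarrow> \<rho> \<le> \<delta>' \<Longrightarrow> norm (g \<rho>) \<le> C2" by auto
  have "continuous_on {0<..<\<delta>} (\<lambda>\<rho>. \<rho> powr (1 / 2) * P \<rho>)"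
    by (intro continuous_intros cP) auto
  from bounded_near_0[OF this f_powr_tendsto_0(3) assms] obtain C3 where
    C3: "C3 > 0" "\<And>\<rho>. 0 < \<rho> \<Longrightarrow> \<rho> \<le> \<delta>' \<Longrightarrow> norm (\<rho> powr (1 / 2) * P \<rho>) \<le> C3" by auto
  show thesis
  proof (rule that[of "C1 + C2 + C3"])
    fix \<rho> assume \<rho>: "0 < \<rho>" "\<rho> \<le> \<delta>'"
    show "\<rho> powr (1 / 4) * norm (f \<rho>) \<le> C1 + C2 + C3"
      using C1(2)[OF \<rho>] C1(1) C2(1) C3(1) by simp
    show "norm (g \<rho>) \<le> C1 + C2 + C3"
      using C2(2)[OF \<rho>] C1(1) C2(1) C3(1) by simp
    show "\<rho> powr (1 / 2) * \<bar>P \<rho>\<bar> \<le> C1 + C2 + C3"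
      using C3(2)[OF \<rho>] C1(1) C2(1) C3(1) by (simp add: abs_mult)
  qed (use C1 C2 C3 in auto)
qed

definition radial :: "real ^ 3 \<Rightarrow> real ^ 3"
  where "radial x = x $ 1 *\<^sub>R partial_deriv 1 u x + x $ 2 *\<^sub>R partial_deriv 2 u x"

text \<open>The radial and the angular derivative determine both horizontal ones, and the angular
  derivative is just \<open>turn3 (u x)\<close>. Solving the 2 by 2 system has determinant r^2 and
  coefficients of size r, which leaves one factor r on the left.\<close>

lemma horizontal_derivative_bound:
  assumes x: "x \<in> S" and i: "i = 1 \<or> i = 2"
  shows "radius x * norm (partial_deriv i u x) \<le> norm (radial x) + norm (u x)"
proof -
  have r: "radius x > 0" using x by (simp add: S_iff)
  have b: "\<bar>x $ 1\<bar> \<le> radius x" "\<bar>x $ 2\<bar> \<le> radius x" by (rule abs_nth_le_radius)+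
  have "(radius x)\<^sup>2 *\<^sub>R partial_deriv 1 u x = x $ 1 *\<^sub>R radial x - x $ 2 *\<^sub>R turn3 (u x)"
    unfolding rotation_identity[OF x, symmetric] radial_def radius_squared
    by (simp add: algebra_simps power2_eq_square)
  moreover have "(radius x)\<^sup>2 *\<^sub>R partial_deriv 2 u x = x $ 2 *\<^sub>R radial x + x $ 1 *\<^sub>R turn3 (u x)"
    unfolding rotation_identity[OF x, symmetric] radial_def radius_squared
    by (simp add: algebra_simps power2_eq_square)
  ultimately obtain a b where ab: "\<bar>a\<bar> \<le> radius x" "\<bar>b\<bar> \<le> radius x"
    "(radius x)\<^sup>2 *\<^sub>R partial_deriv i u x = a *\<^sub>R radial x + b *\<^sub>R turn3 (u x)"
    using i b by (metis abs_minus_cancel diff_conv_add_uminus scaleR_minus_left)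
  have "(radius x)\<^sup>2 * norm (partial_deriv i u x) = norm (a *\<^sub>R radial x + b *\<^sub>R turn3 (u x))"
    unfolding ab(3)[symmetric] by simp
  also have "\<dots> \<le> \<bar>a\<bar> * norm (radial x) + \<bar>b\<bar> * norm (turn3 (u x))"
    using norm_triangle_ineq[of "a *\<^sub>R radial x" "b *\<^sub>R turn3 (u x)"] by simp
  also have "\<dots> \<le> radius x * norm (radial x) + radius x * norm (u x)"
    using ab norm_turn3_le by (intro add_mono mult_mono) auto
  finally have "radius x * (radius x * norm (partial_deriv i u x)) \<le> radius x * (norm (radial x) + norm (u x))"
    by (simp add: algebra_simps power2_eq_square)
  then show ?thesis using r by simp
qed

lemma flow_bounds:
  assumes z0: "z0 > 0" and \<delta>': "\<delta>' < \<delta>" and R: "R > 0"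
  obtains C where "C > 0"
    "\<And>x. x \<in> S \<Longrightarrow> z0 \<le> x $ 3 \<Longrightarrow> radius x \<le> \<delta>' * x $ 3 \<Longrightarrow> radius x \<le> R \<Longrightarrow>
      radius x powr (1 / 4) * norm (u x) \<le> C \<and> radius x powr (1 / 2) * \<bar>p x\<bar> \<le> C \<and>
      norm (radial x) \<le> C \<and> (\<forall>i. radius x powr (5 / 4) * norm (partial_deriv i u x) \<le> C)"
proof -
  obtain C0 where C0: "C0 > 0"
    "\<And>\<rho>. 0 < \<rho> \<Longrightarrow> \<rho> \<le> \<delta>' \<Longrightarrow> \<rho> powr (1 / 4) * norm (f \<rho>) \<le> C0"
    "\<And>\<rho>. 0 < \<rho> \<Longrightarrow> \<rho> \<le> \<delta>' \<Longrightarrow> norm (g \<rho>) \<le> C0"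
    "\<And>\<rho>. 0 < \<rho> \<Longrightarrow> \<rho> \<le> \<delta>' \<Longrightarrow> \<rho> powr (1 / 2) * \<bar>P \<rho>\<bar> \<le> C0"
    using profile_bounds[OF \<delta>'] by metis
  \<comment> \<open>The exponents of \<open>z0\<close> come from scaling: with r = \<rho> z, the
    quantity for \<open>u\<close> equals z^(1/4 - 1) times that of the profile, and the one for
    \<open>p\<close> equals z^(1/2 - 2) times it. Negative powers of z are largest at
    \<open>z0\<close>.\<close>
  define Cu where "Cu = z0 powr (- 3 / 4) * C0"
  define Cp where "Cp = z0 powr (- 3 / 2) * C0"
  define Cr where "Cr = C0 / z0"
  define C12 where "C12 = R powr (1 / 4) * Cr + Cu"
  define C3 where "C3 = (R * Cu + R powr (5 / 4) * Cr) / z0"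
  have pos: "Cu \<ge> 0" "Cp \<ge> 0" "Cr > 0" "C12 \<ge> 0" "C3 \<ge> 0"
    using C0(1) z0 R by (auto simp: Cu_def Cp_def Cr_def C12_def C3_def intro!: add_nonneg_nonneg divide_nonneg_nonneg mult_nonneg_nonneg)
  show thesis
  proof (rule that[of "Cu + Cp + Cr + C12 + C3"])
    show "Cu + Cp + Cr + C12 + C3 > 0" using pos by linarith
    fix x assume x: "x \<in> S" "z0 \<le> x $ 3" "radius x \<le> \<delta>' * x $ 3" "radius x \<le> R"
    define r z where "r = radius x" and "z = x $ 3"
    obtain \<theta> where xc: "x = cyl r \<theta> z" unfolding r_def z_def by (rule polar_form)
    have rz: "0 < r" "r < \<delta> * z" using x(1) by (auto simp: S_iff r_def z_def)
    have z: "z0 \<le> z" "z > 0" using x(2) z0 by (auto simp: z_def)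
    define \<rho> where "\<rho> = r / z"
    have \<rho>: "0 < \<rho>" "\<rho> \<le> \<delta>'" using rz z x(3) by (auto simp: \<rho>_def r_def z_def field_simps)
    have r\<rho>: "r = \<rho> * z" using z by (simp add: \<rho>_def)
    have u: "norm (u x) = (1 / z) * norm (f \<rho>)"
      unfolding xc u_cyl[OF rz] using z by (simp add: \<rho>_def)
    have p: "\<bar>p x\<bar> = (1 / z\<^sup>2) * \<bar>P \<rho>\<bar>"
      unfolding xc p_cyl[OF rz] by (simp add: \<rho>_def abs_mult)
    have bu: "r powr (1 / 4) * norm (u x) \<le> Cu"
    proof -
      have "r powr (1 / 4) * norm (u x) = (z powr (1 / 4) * z powr (- 1)) * (\<rho> powr (1 / 4) * norm (f \<rho>))"
        unfolding u r\<rho> using z \<rho> by (simp add: powr_mult powr_minus_divide)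
      also have "z powr (1 / 4) * z powr (- 1) = z powr (- 3 / 4)"
        unfolding powr_add[symmetric] by simp
      also have "\<dots> * (\<rho> powr (1 / 4) * norm (f \<rho>)) \<le> z0 powr (- 3 / 4) * C0"
        using C0(2)[OF \<rho>] z z0 C0(1) by (intro mult_mono powr_mono2') auto
      finally show ?thesis by (simp add: Cu_def)
    qed
    have bp: "r powr (1 / 2) * \<bar>p x\<bar> \<le> Cp"
    proof -
      have "r powr (1 / 2) * \<bar>p x\<bar> = (z powr (1 / 2) * z powr (- 2)) * (\<rho> powr (1 / 2) * \<bar>P \<rho>\<bar>)"
        unfolding p r\<rho> using z \<rho> by (simp add: powr_mult powr_minus_divide powr_numeral)
      also have "z powr (1 / 2) * z powr (- 2) = z powr (- 3 / 2)"
        unfolding powr_add[symmetric] by simp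
      also have "\<dots> * (\<rho> powr (1 / 2) * \<bar>P \<rho>\<bar>) \<le> z0 powr (- 3 / 2) * C0"
        using C0(4)[OF \<rho>] z z0 C0(1) by (intro mult_mono powr_mono2') auto
      finally show ?thesis by (simp add: Cp_def)
    qed
    have br: "norm (radial x) \<le> Cr"
    proof -
      have "norm (radial x) = (1 / z) * norm (g \<rho>)"
        unfolding radial_def xc radial_derivative[OF rz] using z by (simp add: \<rho>_def)
      also have "\<dots> \<le> (1 / z0) * C0"
        using C0(3)[OF \<rho>] z z0 C0(1) by (intro mult_mono divide_left_mono) auto
      finally show ?thesis by (simp add: Cr_def)
    qed
    have rR: "r powr a \<le> R powr a" if "a \<ge> 0" for a
      using rz x(4) that by (intro powr_mono2) (auto simp: r_def)
    have split: "r powr (5 / 4) = r powr (1 / 4) * r"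
      using rz powr_add[of r "1 / 4" 1] by simp
    have b12: "r powr (5 / 4) * norm (partial_deriv i u x) \<le> C12" if "i = 1 \<or> i = 2" for i
    proof -
      have "r powr (5 / 4) * norm (partial_deriv i u x) = r powr (1 / 4) * (r * norm (partial_deriv i u x))"
        by (simp add: split)
      also have "\<dots> \<le> r powr (1 / 4) * (norm (radial x) + norm (u x))"
        using horizontal_derivative_bound[OF x(1) that] by (intro mult_left_mono) (auto simp: r_def)
      also have "\<dots> = r powr (1 / 4) * norm (radial x) + r powr (1 / 4) * norm (u x)"
        by (simp add: distrib_left)
      also have "\<dots> \<le> R powr (1 / 4) * Cr + Cu"
        using rR[of "1 / 4"] br bu by (intro add_mono mult_mono) auto
      finally show ?thesis by (simp add: C12_def)
    qed
    have b3: "r powr (5 / 4) * norm (partial_deriv 3 u x) \<le> C3"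
    proof -
      \<comment> \<open>The vertical derivative is not differentiated from the profile again:
        Euler's relation expresses it through \<open>u\<close> and \<open>radial\<close>, and z
        \<ge> \<open>z0\<close> permits the division.\<close>
      have "z *\<^sub>R partial_deriv 3 u x = - u x - radial x"
        using Euler_identity[OF x(1)] by (simp add: radial_def z_def algebra_simps)
      then have "z * norm (partial_deriv 3 u x) = norm (- u x - radial x)"
        using z by (metis abs_of_pos norm_scaleR)
      also have "\<dots> \<le> norm (u x) + norm (radial x)"
        using norm_triangle_ineq4[of "- u x" "radial x"] by simp
      finally have "z0 * norm (partial_deriv 3 u x) \<le> norm (u x) + norm (radial x)"
        using mult_right_mono[OF z(1) norm_ge_zero[of "partial_deriv 3 u x"]] by linarith
      then have "r powr (5 / 4) * (z0 * norm (partial_deriv 3 u x)) \<le> r powr (5 / 4) * (norm (u x) + norm (radial x))"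
        by (intro mult_left_mono) auto
      also have "\<dots> = r * (r powr (1 / 4) * norm (u x)) + r powr (5 / 4) * norm (radial x)"
        by (simp add: split algebra_simps)
      also have "\<dots> \<le> R * Cu + R powr (5 / 4) * Cr"
        using rR[of "5 / 4"] br bu rz x(4) R by (intro add_mono mult_mono) (auto simp: r_def)
      finally show ?thesis using z0 by (simp add: C3_def field_simps)
    qed
    have "r powr (5 / 4) * norm (partial_deriv i u x) \<le> C12 + C3" for i
      using exhaust_3[of i] b12[of i] b3 pos by auto
    then have "r powr (5 / 4) * norm (partial_deriv i u x) \<le> Cu + Cp + Cr + C12 + C3" for i
      using pos by (smt (verit))
    then show "radius x powr (1 / 4) * norm (u x) \<le> Cu + Cp + Cr + C12 + C3 \<and>
      radius x powr (1 / 2) * \<bar>p x\<bar> \<le> Cu + Cp + Cr + C12 + C3 \<and>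
      norm (radial x) \<le> Cu + Cp + Cr + C12 + C3 \<and>
      (\<forall>i. radius x powr (5 / 4) * norm (partial_deriv i u x) \<le> Cu + Cp + Cr + C12 + C3)"
      using bu bp br pos by (auto simp flip: r_def)
  qed
qed

text \<open>The first four estimates are the majorants that make the weak integrals exist; the last
  four bound the parts of the radial flux uniformly up to the axis.\<close>

lemma flow_bounds_on_compact:
  assumes "compact K" "K \<subseteq> Cone \<delta>"
  obtains C where
    "\<And>x i j. x \<in> S \<Longrightarrow> x \<in> K \<Longrightarrow> \<bar>partial_deriv i u x $ j\<bar> \<le> C * radius x powr (- 3 / 2)"
    "\<And>x i j. x \<in> S \<Longrightarrow> x \<in> K \<Longrightarrow> \<bar>u x $ i * u x $ j\<bar> \<le> C * radius x powr (- 3 / 2)"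
    "\<And>x i. x \<in> S \<Longrightarrow> x \<in> K \<Longrightarrow> \<bar>u x $ i\<bar> \<le> C * radius x powr (- 3 / 2)"
    "\<And>x. x \<in> S \<Longrightarrow> x \<in> K \<Longrightarrow> \<bar>p x\<bar> \<le> C * radius x powr (- 3 / 2)"
    "\<And>x j. x \<in> S \<Longrightarrow> x \<in> K \<Longrightarrow> \<bar>radial x $ j\<bar> \<le> C"
    "\<And>x j. x \<in> S \<Longrightarrow> x \<in> K \<Longrightarrow> \<bar>(x $ 1 * u x $ 1 + x $ 2 * u x $ 2) * u x $ j\<bar> \<le> C"
    "\<And>x. x \<in> S \<Longrightarrow> x \<in> K \<Longrightarrow> \<bar>x $ 1 * u x $ 1 + x $ 2 * u x $ 2\<bar> \<le> C"
    "\<And>x. x \<in> S \<Longrightarrow> x \<in> K \<Longrightarrow> radius x * \<bar>p x\<bar> \<le> C"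
proof -
  obtain z0 z1 \<delta>' R0 where K: "0 < z0" "0 < \<delta>'" "\<delta>' < \<delta>"
    "\<And>x. x \<in> K \<Longrightarrow> z0 \<le> x $ 3 \<and> x $ 3 \<le> z1 \<and> radius x \<le> \<delta>' * x $ 3 \<and> radius x \<le> R0"
    using compact_in_cone[OF assms \<delta>_pos] by metis
  \<comment> \<open>With \<open>R \<ge> 1\<close> the powers of \<open>R\<close> increase with the
    exponent, so the single constant \<open>M\<close> can absorb all of them.\<close>
  define R where "R = max 1 R0"
  have R: "R \<ge> 1" "R > 0" by (auto simp: R_def)
  obtain C where C: "C > 0" "\<And>x. x \<in> S \<Longrightarrow> z0 \<le> x $ 3 \<Longrightarrow> radius x \<le> \<delta>' * x $ 3 \<Longrightarrow> radius x \<le> R \<Longrightarrow>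
      radius x powr (1 / 4) * norm (u x) \<le> C \<and> radius x powr (1 / 2) * \<bar>p x\<bar> \<le> C \<and>
      norm (radial x) \<le> C \<and> (\<forall>i. radius x powr (5 / 4) * norm (partial_deriv i u x) \<le> C)"
    using flow_bounds[OF K(1) K(3) R(2)] by metis
  define M where "M = (C + C\<^sup>2 + 2 * C + 2 * C\<^sup>2) * R powr (3 / 2)"
  have R1: "R powr a \<le> R powr (3 / 2)" if "a \<le> 3 / 2" for a
    using R that by (intro powr_mono) auto
  have R0: "1 \<le> R powr (3 / 2)" using R by (simp add: ge_one_powr_ge_zero)
  have le_M: "c * R powr a \<le> M" if "c \<in> {C, C\<^sup>2, 2 * C, 2 * C\<^sup>2}" "a \<le> 3 / 2" for c a
    unfolding M_def using that R1[of a] C(1) by (intro mult_mono) auto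
  have weight: "X \<le> M * r powr (- 3 / 2)"
    if "0 < r" "r \<le> R" "0 \<le> a" "a \<le> 3 / 2" "c \<in> {C, C\<^sup>2}" "r powr a * X \<le> c" for r a X c
  proof -
    have "X \<le> c * R powr (3 / 2 - a) * r powr (- 3 / 2)"
      by (rule powr_weight_bound) (use that C(1) in auto)
    also have "\<dots> \<le> M * r powr (- 3 / 2)"
      using that by (intro mult_right_mono le_M) auto
    finally show ?thesis .
  qed
  have B: "0 < radius x" "radius x \<le> R" "radius x powr (1 / 4) * norm (u x) \<le> C" "radius x powr (1 / 2) * \<bar>p x\<bar> \<le> C"
      "norm (radial x) \<le> C" "radius x powr (5 / 4) * norm (partial_deriv i u x) \<le> C"
    if "x \<in> S" "x \<in> K" for x i
    using C(2)[OF that(1)] K(4)[OF that(2)] that(1) by (auto simp: R_def S_iff)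
  have rR: "radius x powr a \<le> R powr a" if "x \<in> S" "x \<in> K" "a \<ge> 0" for x a
    using B(1,2)[OF that(1,2)] that(3) by (intro powr_mono2) auto
  have uu: "radius x powr (1 / 2) * (norm (u x) * norm (u x)) \<le> C\<^sup>2" if "x \<in> S" "x \<in> K" for x
  proof -
    have "radius x powr (1 / 2) = radius x powr (1 / 4) * radius x powr (1 / 4)"
      by (simp flip: powr_add)
    then have "radius x powr (1 / 2) * (norm (u x) * norm (u x)) = (radius x powr (1 / 4) * norm (u x))\<^sup>2"
      by (simp add: power2_eq_square)
    also have "\<dots> \<le> C\<^sup>2" using B(3)[OF that] by (intro power_mono) auto
    finally show ?thesis .
  qed
  have radius_split: "radius x = radius x powr a * radius x powr (1 - a)" if "x \<in> S" "x \<in> K" for x a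
    using B(1)[OF that] by (simp flip: powr_add)
  show thesis
  proof (rule that[of M])
    fix x assume x: "x \<in> S" "x \<in> K"
    note b = B[OF x]
    show "\<bar>partial_deriv i u x $ j\<bar> \<le> M * radius x powr (- 3 / 2)" for i j
    proof (rule order_trans[OF component_le_norm_cart])
      show "norm (partial_deriv i u x) \<le> M * radius x powr (- 3 / 2)"
        by (rule weight[OF b(1,2) _ _ _ b(6)]) auto
    qed
    show "\<bar>u x $ i * u x $ j\<bar> \<le> M * radius x powr (- 3 / 2)" for i j
    proof -
      have "\<bar>u x $ i * u x $ j\<bar> \<le> norm (u x) * norm (u x)"
        unfolding abs_mult by (intro mult_mono component_le_norm_cart) auto
      also have "\<dots> \<le> M * radius x powr (- 3 / 2)"
        by (rule weight[OF b(1,2) _ _ _ uu[OF x]]) auto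
      finally show ?thesis .
    qed
    show "\<bar>u x $ i\<bar> \<le> M * radius x powr (- 3 / 2)" for i
    proof (rule order_trans[OF component_le_norm_cart])
      show "norm (u x) \<le> M * radius x powr (- 3 / 2)"
        by (rule weight[OF b(1,2) _ _ _ b(3)]) auto
    qed
    show "\<bar>p x\<bar> \<le> M * radius x powr (- 3 / 2)"
      by (rule weight[OF b(1,2) _ _ _ b(4)]) auto
    show "\<bar>radial x $ j\<bar> \<le> M" for j
      using component_le_norm_cart[of "radial x" j] b(5) le_M[of C 0] R by simp
    show "\<bar>x $ 1 * u x $ 1 + x $ 2 * u x $ 2\<bar> \<le> M"
    proof -
      have "radius x * norm (u x) = radius x powr (3 / 4) * (radius x powr (1 / 4) * norm (u x))"
        using radius_split[OF x, of "3 / 4"] by simp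
      also have "\<dots> \<le> R powr (3 / 4) * C"
        using b(3) rR[OF x, of "3 / 4"] by (intro mult_mono) auto
      finally have "radius x * norm (u x) \<le> R powr (3 / 4) * C" .
      moreover have "2 * C * R powr (3 / 4) \<le> M" by (rule le_M) auto
      moreover have "2 * C * R powr (3 / 4) = 2 * (R powr (3 / 4) * C)" by simp
      ultimately show ?thesis using abs_horizontal_inner_le[of x "u x"] by linarith
    qed
    show "\<bar>(x $ 1 * u x $ 1 + x $ 2 * u x $ 2) * u x $ j\<bar> \<le> M" for j
    proof -
      have "\<bar>(x $ 1 * u x $ 1 + x $ 2 * u x $ 2) * u x $ j\<bar> \<le> 2 * (radius x * norm (u x)) * norm (u x)"
        unfolding abs_mult by (intro mult_mono abs_horizontal_inner_le component_le_norm_cart) auto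
      also have "\<dots> = 2 * (radius x powr (1 / 2) * (radius x powr (1 / 2) * (norm (u x) * norm (u x))))"
        using radius_split[OF x, of "1 / 2"] by simp
      also have "\<dots> \<le> 2 * (R powr (1 / 2) * C\<^sup>2)"
        using uu[OF x] rR[OF x, of "1 / 2"] by (intro mult_left_mono mult_mono) auto
      also have "\<dots> = 2 * C\<^sup>2 * R powr (1 / 2)" by simp
      also have "\<dots> \<le> M" by (rule le_M) auto
      finally show ?thesis .
    qed
    show "radius x * \<bar>p x\<bar> \<le> M"
    proof -
      have "radius x * \<bar>p x\<bar> = radius x powr (1 / 2) * (radius x powr (1 / 2) * \<bar>p x\<bar>)"
        using radius_split[OF x, of "1 / 2"] by simp
      also have "\<dots> \<le> R powr (1 / 2) * C"
        using b(4) rR[OF x, of "1 / 2"] by (intro mult_mono) auto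
      also have "\<dots> = C * R powr (1 / 2)" by simp
      also have "\<dots> \<le> M" by (rule le_M) auto
      finally show ?thesis .
    qed
  qed
qed

text \<open>Along this path the profile variable \<epsilon> r/z tends to 0 while angle and height
  stay fixed. Rotations fix the vertical vector, so the limit of \<open>radial\<close> does not
  depend on the angle. The remaining limits are 0 because r|u|, r|u|^2 and r|p| are a power of r
  against logarithms.\<close>

lemma axis_limits:
  assumes y: "y $ 3 > 0" "y \<notin> x3_axis"
  defines "\<gamma> \<equiv> \<lambda>\<epsilon>. vector [\<epsilon> * y $ 1, \<epsilon> * y $ 2, y $ 3] :: real ^ 3"
  shows "((\<lambda>\<epsilon>. radial (\<gamma> \<epsilon>)) \<longlongrightarrow> (c0 / y $ 3) *\<^sub>R axis 3 1) (at_right 0)"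
    and "((\<lambda>\<epsilon>. \<gamma> \<epsilon> $ 1 * u (\<gamma> \<epsilon>) $ 1 + \<gamma> \<epsilon> $ 2 * u (\<gamma> \<epsilon>) $ 2) \<longlongrightarrow> 0) (at_right 0)"
    and "((\<lambda>\<epsilon>. (\<gamma> \<epsilon> $ 1 * u (\<gamma> \<epsilon>) $ 1 + \<gamma> \<epsilon> $ 2 * u (\<gamma> \<epsilon>) $ 2) * u (\<gamma> \<epsilon>) $ j) \<longlongrightarrow> 0) (at_right 0)"
    and "((\<lambda>\<epsilon>. \<gamma> \<epsilon> $ 1 * p (\<gamma> \<epsilon>)) \<longlongrightarrow> 0) (at_right 0)"
    and "((\<lambda>\<epsilon>. \<gamma> \<epsilon> $ 2 * p (\<gamma> \<epsilon>)) \<longlongrightarrow> 0) (at_right 0)"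
proof -
  define r z where "r = radius y" and "z = y $ 3"
  have r: "r > 0" using y(2) radius_eq_0_iff[of y] radius_nonneg[of y] by (simp add: r_def less_le)
  have z: "z > 0" using y by (simp add: z_def)
  obtain \<theta> where yc: "y = cyl r \<theta> z" unfolding r_def z_def by (rule polar_form)
  have \<gamma>: "\<gamma> \<epsilon> = cyl (\<epsilon> * r) \<theta> z" for \<epsilon>
    unfolding \<gamma>_def by (simp add: yc vec_eq_iff forall_3)
  define \<rho> where "\<rho> \<epsilon> = \<epsilon> * r / z" for \<epsilon>
  have \<rho>: "filterlim \<rho> (at_right 0) (at_right 0)"
    unfolding filterlim_at
  proof
    have "((\<lambda>\<epsilon>. \<epsilon> * r / z) \<longlongrightarrow> 0 * r / z) (at_right 0)" using z by (intro tendsto_intros) auto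
    then show "(\<rho> \<longlongrightarrow> 0) (at_right 0)" by (simp add: \<rho>_def[abs_def])
    show "\<forall>\<^sub>F \<epsilon> in at_right 0. \<rho> \<epsilon> \<in> {0<..} \<and> \<rho> \<epsilon> \<noteq> 0"
      using r z by (auto simp: eventually_at_filter \<rho>_def intro!: always_eventually)
  qed
  have ev: "\<forall>\<^sub>F \<epsilon> in at_right 0. 0 < \<epsilon> \<and> 0 < \<epsilon> * r \<and> \<epsilon> * r < \<delta> * z"
  proof -
    have "\<forall>\<^sub>F \<epsilon> in at_right 0. 0 < \<rho> \<epsilon> \<and> \<rho> \<epsilon> < \<delta>"
      using eventually_in_profile \<rho> by (rule eventually_compose_filterlim)
    then show ?thesis
      by eventually_elim (use r z in \<open>auto simp: \<rho>_def field_simps zero_less_mult_iff zero_less_divide_iff\<close>)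
  qed
  show "((\<lambda>\<epsilon>. radial (\<gamma> \<epsilon>)) \<longlongrightarrow> (c0 / y $ 3) *\<^sub>R axis 3 1) (at_right 0)"
  proof (rule Lim_transform_eventually)
    have "((\<lambda>\<epsilon>. g (\<rho> \<epsilon>)) \<longlongrightarrow> c0 *\<^sub>R axis 3 1) (at_right 0)"
      by (rule filterlim_compose[OF g_tendsto \<rho>])
    moreover have "bounded_linear (\<lambda>w. (1 / z) *\<^sub>R rotate3 \<theta> w)"
      unfolding linear_conv_bounded_linear[symmetric]
      using z by (intro linearI) (simp_all add: vec_eq_iff forall_3 field_simps)
    ultimately have "((\<lambda>\<epsilon>. (1 / z) *\<^sub>R rotate3 \<theta> (g (\<rho> \<epsilon>))) \<longlongrightarrow> (1 / z) *\<^sub>R rotate3 \<theta> (c0 *\<^sub>R axis 3 1)) (at_right 0)"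
      by (rule bounded_linear.tendsto[rotated])
    moreover have "(1 / z) *\<^sub>R rotate3 \<theta> (c0 *\<^sub>R axis 3 1) = (c0 / y $ 3) *\<^sub>R axis 3 1"
      by (simp add: vec_eq_iff forall_3 axis_def z_def)
    ultimately show "((\<lambda>\<epsilon>. (1 / z) *\<^sub>R rotate3 \<theta> (g (\<rho> \<epsilon>))) \<longlongrightarrow> (c0 / y $ 3) *\<^sub>R axis 3 1) (at_right 0)"
      by simp
    show "\<forall>\<^sub>F \<epsilon> in at_right 0. (1 / z) *\<^sub>R rotate3 \<theta> (g (\<rho> \<epsilon>)) = radial (\<gamma> \<epsilon>)"
      using ev by eventually_elim (simp only: radial_def \<gamma> radial_derivative \<rho>_def)
  qed
  have nu: "\<forall>\<^sub>F \<epsilon> in at_right 0. norm (u (\<gamma> \<epsilon>)) = norm (f (\<rho> \<epsilon>)) / z \<and> \<bar>p (\<gamma> \<epsilon>)\<bar> = \<bar>P (\<rho> \<epsilon>)\<bar> / z\<^sup>2 \<and> radius (\<gamma> \<epsilon>) = \<rho> \<epsilon> * z \<and> \<rho> \<epsilon> > 0"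
    using ev by eventually_elim (use z r in \<open>auto simp: \<gamma> u_cyl p_cyl \<rho>_def abs_mult\<close>)
  have f1: "((\<lambda>\<epsilon>. \<rho> \<epsilon> * norm (f (\<rho> \<epsilon>))) \<longlongrightarrow> 0) (at_right 0)"
  proof -
    have "((\<lambda>\<rho>. norm (\<rho> *\<^sub>R f \<rho>)) \<longlongrightarrow> 0) (at_right 0)" using tendsto_norm_zero[OF rho_f_tendsto_0] .
    from filterlim_compose[OF this \<rho>] have "((\<lambda>\<epsilon>. norm (\<rho> \<epsilon> *\<^sub>R f (\<rho> \<epsilon>))) \<longlongrightarrow> 0) (at_right 0)" .
    then show ?thesis
      by (rule Lim_transform_eventually) (use nu in eventually_elim, simp)
  qed
  have f2: "((\<lambda>\<epsilon>. \<rho> \<epsilon> * (norm (f (\<rho> \<epsilon>)) * norm (f (\<rho> \<epsilon>)))) \<longlongrightarrow> 0) (at_right 0)"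
  proof -
    have "((\<lambda>\<rho>. norm (\<rho> powr (1 / 2) *\<^sub>R f \<rho>)) \<longlongrightarrow> 0) (at_right 0)"
      by (intro tendsto_norm_zero f_powr_tendsto_0) simp
    from filterlim_compose[OF tendsto_mult[OF this this] \<rho>]
    have "((\<lambda>\<epsilon>. norm (\<rho> \<epsilon> powr (1 / 2) *\<^sub>R f (\<rho> \<epsilon>)) * norm (\<rho> \<epsilon> powr (1 / 2) *\<^sub>R f (\<rho> \<epsilon>))) \<longlongrightarrow> 0) (at_right 0)" by simp
    then show ?thesis
    proof (rule Lim_transform_eventually)
      show "\<forall>\<^sub>F \<epsilon> in at_right 0. norm (\<rho> \<epsilon> powr (1 / 2) *\<^sub>R f (\<rho> \<epsilon>)) * norm (\<rho> \<epsilon> powr (1 / 2) *\<^sub>R f (\<rho> \<epsilon>))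
        = \<rho> \<epsilon> * (norm (f (\<rho> \<epsilon>)) * norm (f (\<rho> \<epsilon>)))"
        using nu
      proof eventually_elim
        case (elim \<epsilon>)
        then have "\<rho> \<epsilon> = \<rho> \<epsilon> powr (1 / 2) * \<rho> \<epsilon> powr (1 / 2)" by (simp flip: powr_add)
        then show ?case by (metis (no_types, lifting) abs_of_nonneg mult.assoc mult.left_commute norm_scaleR powr_ge_zero)
      qed
    qed
  qed
  have f3: "((\<lambda>\<epsilon>. \<rho> \<epsilon> * \<bar>P (\<rho> \<epsilon>)\<bar>) \<longlongrightarrow> 0) (at_right 0)"
  proof -
    have "((\<lambda>\<rho>. norm (\<rho> powr 1 * P \<rho>)) \<longlongrightarrow> 0) (at_right 0)"
      by (intro tendsto_norm_zero f_powr_tendsto_0) simp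
    from filterlim_compose[OF this \<rho>]
    have "((\<lambda>\<epsilon>. norm (\<rho> \<epsilon> powr 1 * P (\<rho> \<epsilon>))) \<longlongrightarrow> 0) (at_right 0)" .
    then show ?thesis
      by (rule Lim_transform_eventually) (use nu in eventually_elim, simp add: abs_mult)
  qed
  show "((\<lambda>\<epsilon>. \<gamma> \<epsilon> $ 1 * u (\<gamma> \<epsilon>) $ 1 + \<gamma> \<epsilon> $ 2 * u (\<gamma> \<epsilon>) $ 2) \<longlongrightarrow> 0) (at_right 0)"
  proof (rule Lim_null_comparison)
    show "\<forall>\<^sub>F \<epsilon> in at_right 0. norm (\<gamma> \<epsilon> $ 1 * u (\<gamma> \<epsilon>) $ 1 + \<gamma> \<epsilon> $ 2 * u (\<gamma> \<epsilon>) $ 2) \<le> 2 * (\<rho> \<epsilon> * norm (f (\<rho> \<epsilon>)))"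
      using nu
    proof eventually_elim
      case (elim \<epsilon>)
      then show ?case using abs_horizontal_inner_le[of "\<gamma> \<epsilon>" "u (\<gamma> \<epsilon>)"] z by simp
    qed
    show "((\<lambda>\<epsilon>. 2 * (\<rho> \<epsilon> * norm (f (\<rho> \<epsilon>)))) \<longlongrightarrow> 0) (at_right 0)"
      using tendsto_mult_left[OF f1, of 2] by simp
  qed
  show "((\<lambda>\<epsilon>. (\<gamma> \<epsilon> $ 1 * u (\<gamma> \<epsilon>) $ 1 + \<gamma> \<epsilon> $ 2 * u (\<gamma> \<epsilon>) $ 2) * u (\<gamma> \<epsilon>) $ j) \<longlongrightarrow> 0) (at_right 0)"
  proof (rule Lim_null_comparison)
    show "\<forall>\<^sub>F \<epsilon> in at_right 0. norm ((\<gamma> \<epsilon> $ 1 * u (\<gamma> \<epsilon>) $ 1 + \<gamma> \<epsilon> $ 2 * u (\<gamma> \<epsilon>) $ 2) * u (\<gamma> \<epsilon>) $ j)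
      \<le> 2 / z * (\<rho> \<epsilon> * (norm (f (\<rho> \<epsilon>)) * norm (f (\<rho> \<epsilon>))))"
      using nu
    proof eventually_elim
      case (elim \<epsilon>)
      have "norm ((\<gamma> \<epsilon> $ 1 * u (\<gamma> \<epsilon>) $ 1 + \<gamma> \<epsilon> $ 2 * u (\<gamma> \<epsilon>) $ 2) * u (\<gamma> \<epsilon>) $ j)
        \<le> 2 * (radius (\<gamma> \<epsilon>) * norm (u (\<gamma> \<epsilon>))) * norm (u (\<gamma> \<epsilon>))"
        unfolding real_norm_def abs_mult by (intro mult_mono abs_horizontal_inner_le component_le_norm_cart) auto
      then show ?case using elim z by simp
    qed
    show "((\<lambda>\<epsilon>. 2 / z * (\<rho> \<epsilon> * (norm (f (\<rho> \<epsilon>)) * norm (f (\<rho> \<epsilon>))))) \<longlongrightarrow> 0) (at_right 0)"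
      using tendsto_mult_left[OF f2, of "2 / z"] by simp
  qed
  have xp: "((\<lambda>\<epsilon>. h \<epsilon> * p (\<gamma> \<epsilon>)) \<longlongrightarrow> 0) (at_right 0)" if h: "\<And>\<epsilon>. \<bar>h \<epsilon>\<bar> \<le> radius (\<gamma> \<epsilon>)" for h
  proof (rule Lim_null_comparison)
    show "\<forall>\<^sub>F \<epsilon> in at_right 0. norm (h \<epsilon> * p (\<gamma> \<epsilon>)) \<le> 1 / z * (\<rho> \<epsilon> * \<bar>P (\<rho> \<epsilon>)\<bar>)"
      using nu
    proof eventually_elim
      case (elim \<epsilon>)
      have "norm (h \<epsilon> * p (\<gamma> \<epsilon>)) \<le> radius (\<gamma> \<epsilon>) * \<bar>p (\<gamma> \<epsilon>)\<bar>"
        unfolding real_norm_def abs_mult by (intro mult_right_mono h) auto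
      then show ?case using elim z by (simp add: power2_eq_square)
    qed
    show "((\<lambda>\<epsilon>. 1 / z * (\<rho> \<epsilon> * \<bar>P (\<rho> \<epsilon>)\<bar>)) \<longlongrightarrow> 0) (at_right 0)"
      using tendsto_mult_left[OF f3, of "1 / z"] by simp
  qed
  show "((\<lambda>\<epsilon>. \<gamma> \<epsilon> $ 1 * p (\<gamma> \<epsilon>)) \<longlongrightarrow> 0) (at_right 0)"
    "((\<lambda>\<epsilon>. \<gamma> \<epsilon> $ 2 * p (\<gamma> \<epsilon>)) \<longlongrightarrow> 0) (at_right 0)"
    by (intro xp abs_nth_le_radius)+
qed

section \<open>The stress and the weak equations\<close>

definition stress :: "3 \<Rightarrow> 3 \<Rightarrow> real ^ 3 \<Rightarrow> real"
  where "stress j i x = partial_deriv i u x $ j - u x $ i * u x $ j - (if i = j then p x else 0)"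

lemma has_derivative_nth_partial:
  assumes "h differentiable (at x)"
  shows "((\<lambda>x. h x $ j) has_derivative (\<lambda>v. frechet_derivative h (at x) v $ j)) (at x)"
  using assms by (intro bounded_linear.has_derivative[OF bounded_linear_vec_nth]) (simp add: frechet_derivative_works)

lemma stress_derivative:
  assumes x: "x \<in> S"
  shows "stress j i differentiable (at x)"
    and "partial_deriv k (stress j i) x = partial_deriv k (partial_deriv i u) x $ j
      - (u x $ i * partial_deriv k u x $ j + partial_deriv k u x $ i * u x $ j)
      - (if i = j then partial_deriv k p x else 0)"
proof -
  have p: "((\<lambda>x. if i = j then p x else 0) has_derivative (\<lambda>v. if i = j then frechet_derivative p (at x) v else 0)) (at x)"
    using x by (cases "i = j") (simp_all add: frechet_derivative_works[symmetric])
  have D: "(stress j i has_derivative (\<lambda>v. frechet_derivative (partial_deriv i u) (at x) v $ j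
      - (u x $ i * frechet_derivative u (at x) v $ j + frechet_derivative u (at x) v $ i * u x $ j)
      - (if i = j then frechet_derivative p (at x) v else 0))) (at x)"
    unfolding stress_def[abs_def]
    by (intro has_derivative_diff has_derivative_mult has_derivative_nth_partial p differentiable_u differentiable_du x)
  then show "stress j i differentiable (at x)"
    by (auto simp: differentiable_def)
  show "partial_deriv k (stress j i) x = partial_deriv k (partial_deriv i u) x $ j
      - (u x $ i * partial_deriv k u x $ j + partial_deriv k u x $ i * u x $ j)
      - (if i = j then partial_deriv k p x else 0)"
    unfolding partial_deriv_eqI[OF D] by (simp add: partial_deriv_def)
qed

text \<open>The momentum equation in conservative form: \<open>divergence u x = 0\<close> is what
  makes the convection term the divergence of the products of components.\<close>

lemma stress_divergence_free:
  assumes x: "x \<in> S"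
  shows "(\<Sum>i\<in>UNIV. partial_deriv i (stress j i) x) = 0"
proof -
  have "(- laplacian u x + convection u x + grad p x) $ j = 0" and d: "divergence u x = 0"
    using flow_S(6) x by (auto simp: navier_stokes_on_def)
  then have ns: "- (\<Sum>i\<in>UNIV. partial_deriv i (partial_deriv i u) x $ j) + (\<Sum>i\<in>UNIV. u x $ i * partial_deriv i u x $ j)
      + partial_deriv j p x = 0"
    by (simp add: laplacian_def convection_def grad_def sum_component)
  have "(\<Sum>i\<in>UNIV. partial_deriv i (stress j i) x) =
     (\<Sum>i\<in>UNIV. partial_deriv i (partial_deriv i u) x $ j) - (\<Sum>i\<in>UNIV. u x $ i * partial_deriv i u x $ j)
      - (\<Sum>i\<in>UNIV. partial_deriv i u x $ i) * u x $ j - partial_deriv j p x"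
    by (simp add: stress_derivative[OF x] sum_subtractf sum.distrib sum_distrib_right)
  then show ?thesis using ns d by (simp add: divergence_def)
qed

lemma continuous_on_flow:
  "continuous_on S u" "continuous_on S (partial_deriv i u)" "continuous_on S (partial_deriv k (partial_deriv i u))"
  "continuous_on S p" "continuous_on S (partial_deriv i p)"
  using flow_S(1,2) by (blast intro: smooth_on_continuous smooth_on_partial_deriv)+

lemma continuous_on_stress_derivative: "continuous_on S (partial_deriv k (stress j i))"
proof -
  have "continuous_on S (\<lambda>x. partial_deriv k (partial_deriv i u) x $ j
      - (u x $ i * partial_deriv k u x $ j + partial_deriv k u x $ i * u x $ j)
      - (if i = j then partial_deriv k p x else 0))"
    by (cases "i = j") (auto intro!: continuous_intros continuous_on_flow)
  then show ?thesis by (rule continuous_on_eq) (simp add: stress_derivative)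
qed

text \<open>The flux lemma is used twice: for the field \<open>u\<close> with \<open>l = 0\<close>,
  which gives the continuity equation, and for the row \<open>stress j\<close> with
  \<open>l = c0\<close> when \<open>j = 3\<close> and \<open>l = 0\<close> otherwise, which gives
  the momentum equation.\<close>

lemma lborel_weak_formulation:
  assumes test: "\<phi> \<in> test_functions (Cone \<delta>)"
  defines "I F \<equiv> integrable lborel (\<lambda>x. indicator S x * (F x :: real))"
  defines "J F \<equiv> (\<integral>x. indicator S x * (F x :: real) \<partial>lborel)"
  shows "I (\<lambda>x. grad (\<lambda>y. u y $ j) x \<bullet> grad \<phi> x)"
    and "I (\<lambda>x. \<Sum>i\<in>UNIV. u x $ i * u x $ j * partial_deriv i \<phi> x)"
    and "I (\<lambda>x. p x * partial_deriv j \<phi> x)"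
    and "I (\<lambda>x. u x \<bullet> grad \<phi> x)"
    and "J (\<lambda>x. u x \<bullet> grad \<phi> x) = 0"
    and "I (\<lambda>x. grad (\<lambda>y. u y $ j) x \<bullet> grad \<phi> x - (\<Sum>i\<in>UNIV. u x $ i * u x $ j * partial_deriv i \<phi> x)
          - p x * partial_deriv j \<phi> x)"
    and "J (\<lambda>x. grad (\<lambda>y. u y $ j) x \<bullet> grad \<phi> x - (\<Sum>i\<in>UNIV. u x $ i * u x $ j * partial_deriv i \<phi> x)
          - p x * partial_deriv j \<phi> x)
       = - 2 * pi * (if j = 3 then c0 else 0) * (\<integral>z. indicator {0<..} z * (\<phi> (vector [0, 0, z]) / z) \<partial>lborel)"
proof -
  interpret T: cone_test_function \<delta> \<phi> by unfold_locales (use \<delta>_pos test in auto)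
  obtain C where C:
    "\<And>x i j. x \<in> S \<Longrightarrow> x \<in> T.K \<Longrightarrow> \<bar>partial_deriv i u x $ j\<bar> \<le> C * radius x powr (- 3 / 2)"
    "\<And>x i j. x \<in> S \<Longrightarrow> x \<in> T.K \<Longrightarrow> \<bar>u x $ i * u x $ j\<bar> \<le> C * radius x powr (- 3 / 2)"
    "\<And>x i. x \<in> S \<Longrightarrow> x \<in> T.K \<Longrightarrow> \<bar>u x $ i\<bar> \<le> C * radius x powr (- 3 / 2)"
    "\<And>x. x \<in> S \<Longrightarrow> x \<in> T.K \<Longrightarrow> \<bar>p x\<bar> \<le> C * radius x powr (- 3 / 2)"
    "\<And>x j. x \<in> S \<Longrightarrow> x \<in> T.K \<Longrightarrow> \<bar>radial x $ j\<bar> \<le> C"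
    "\<And>x j. x \<in> S \<Longrightarrow> x \<in> T.K \<Longrightarrow> \<bar>(x $ 1 * u x $ 1 + x $ 2 * u x $ 2) * u x $ j\<bar> \<le> C"
    "\<And>x. x \<in> S \<Longrightarrow> x \<in> T.K \<Longrightarrow> \<bar>x $ 1 * u x $ 1 + x $ 2 * u x $ 2\<bar> \<le> C"
    "\<And>x. x \<in> S \<Longrightarrow> x \<in> T.K \<Longrightarrow> radius x * \<bar>p x\<bar> \<le> C"
    using flow_bounds_on_compact[OF T.compact_K T.K_subset] by blast
  note S = S_def
  have on_S: "indicator S x * F x = indicator S x * G x" if "x \<in> S \<Longrightarrow> F x = G x" for F G :: "real ^ 3 \<Rightarrow> real" and x
    using that by (auto simp: indicator_def)
  note int = T.integrable_on_S[folded S, where C = C, OF _ _ T.continuous_d\<phi> T.d\<phi>_eq_0]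
  have grad_u: "grad (\<lambda>y. u y $ j) x \<bullet> grad \<phi> x = (\<Sum>i\<in>UNIV. partial_deriv i u x $ j * partial_deriv i \<phi> x)" if "x \<in> S" for x
    using that by (simp add: grad_def inner_vec_def partial_deriv_nth)
  have "integrable lborel (\<lambda>x. \<Sum>i\<in>UNIV. indicator S x * (partial_deriv i u x $ j * partial_deriv i \<phi> x))"
    by (intro Bochner_Integration.integrable_sum int C(1) continuous_intros continuous_on_flow)
  then have int1: "integrable lborel (\<lambda>x. indicator S x * (\<Sum>i\<in>UNIV. partial_deriv i u x $ j * partial_deriv i \<phi> x))"
    by (simp add: sum_distrib_left)
  show i1: "I (\<lambda>x. grad (\<lambda>y. u y $ j) x \<bullet> grad \<phi> x)"
  proof -
    have "(\<lambda>x. indicator S x * (grad (\<lambda>y. u y $ j) x \<bullet> grad \<phi> x))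
       = (\<lambda>x. indicator S x * (\<Sum>i\<in>UNIV. partial_deriv i u x $ j * partial_deriv i \<phi> x))"
      by (intro ext on_S grad_u)
    then show ?thesis using int1 unfolding I_def by simp
  qed
  have "integrable lborel (\<lambda>x. \<Sum>i\<in>UNIV. indicator S x * (u x $ i * u x $ j * partial_deriv i \<phi> x))"
    by (intro Bochner_Integration.integrable_sum int C(2) continuous_intros continuous_on_flow)
  then show i2: "I (\<lambda>x. \<Sum>i\<in>UNIV. u x $ i * u x $ j * partial_deriv i \<phi> x)"
    unfolding I_def by (simp add: sum_distrib_left)
  show i3: "I (\<lambda>x. p x * partial_deriv j \<phi> x)"
    unfolding I_def by (intro int C(4) continuous_on_flow)
  have "integrable lborel (\<lambda>x. (indicator S x * (grad (\<lambda>y. u y $ j) x \<bullet> grad \<phi> x)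
      - indicator S x * (\<Sum>i\<in>UNIV. u x $ i * u x $ j * partial_deriv i \<phi> x)) - indicator S x * (p x * partial_deriv j \<phi> x))"
    using i1 i2 i3 unfolding I_def by (intro Bochner_Integration.integrable_diff)
  then show "I (\<lambda>x. grad (\<lambda>y. u y $ j) x \<bullet> grad \<phi> x - (\<Sum>i\<in>UNIV. u x $ i * u x $ j * partial_deriv i \<phi> x)
          - p x * partial_deriv j \<phi> x)"
    unfolding I_def by (simp add: right_diff_distrib)
  have inner_u: "u x \<bullet> grad \<phi> x = (\<Sum>i\<in>UNIV. u x $ i * partial_deriv i \<phi> x)" for x
    by (simp add: grad_def inner_vec_def)
  \<comment> \<open>The stress has three terms, viscous, convective and pressure, each bounded
    through \<open>C\<close>; hence the factor 3.\<close>
  note flux = T.flux_through_axis[folded S, where C = "3 * C"]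
  \<comment> \<open>The estimates say nothing about \<open>C\<close> if no point lies in both sets,
    so its sign is obtained from a point at hand.\<close>
  have C0: "C \<ge> 0" if "x \<in> S" "x \<in> T.K" for x
    using C(5)[OF that, of 1] by linarith
  have le3: "a \<le> 3 * C * r powr (- 3 / 2)" if "a \<le> C * r powr (- 3 / 2)" "C \<ge> 0" for a r
  proof -
    have "0 \<le> C * r powr (- 3 / 2)" using that(2) by simp
    then show ?thesis using that(1) by (simp only: mult.assoc)
  qed
  have u_dif: "(\<lambda>x. u x $ i) differentiable at x" if "x \<in> S" for i x
    using has_derivative_nth_partial[OF differentiable_u[OF that]] by (auto simp: differentiable_def)
  have pd: "partial_deriv k (\<lambda>x. u x $ i) x = partial_deriv k u x $ i" if "x \<in> S" for i k x
    using that by (simp add: partial_deriv_nth)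
  have u_cont: "continuous_on S (partial_deriv i (\<lambda>x. u x $ i))" for i
  proof (rule continuous_on_eq)
    show "continuous_on S (\<lambda>x. partial_deriv i u x $ i)" by (intro continuous_intros continuous_on_flow)
  qed (simp add: pd)
  have u_div: "(\<Sum>i\<in>UNIV. partial_deriv i (\<lambda>x. u x $ i) x) = 0" if "x \<in> S" for x
    using flow_S(6) that by (simp add: pd navier_stokes_on_def divergence_def)
  have u_bound: "\<bar>u x $ i\<bar> \<le> 3 * C * radius x powr (- 3 / 2)" if "x \<in> S" "x \<in> T.K" for i x
    by (rule le3[OF C(3)[OF that] C0[OF that]])
  have u_radial: "\<bar>x $ 1 * u x $ 1 + x $ 2 * u x $ 2\<bar> \<le> 3 * C" if "x \<in> S" "x \<in> T.K" for x
    using C(7)[OF that] by linarith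
  have u_lim: "((\<lambda>\<epsilon>. \<epsilon> * y $ 1 * u (vector [\<epsilon> * y $ 1, \<epsilon> * y $ 2, y $ 3]) $ 1
      + \<epsilon> * y $ 2 * u (vector [\<epsilon> * y $ 1, \<epsilon> * y $ 2, y $ 3]) $ 2) \<longlongrightarrow> 0 / y $ 3) (at_right 0)"
    if "0 < y $ 3" "y \<notin> x3_axis" for y
    using axis_limits(2)[OF that] by simp
  note u_flux = flux[where \<Phi> = "\<lambda>i x. u x $ i" and l = 0, OF u_dif u_cont u_div u_bound u_radial u_lim]
  show "I (\<lambda>x. u x \<bullet> grad \<phi> x)" "J (\<lambda>x. u x \<bullet> grad \<phi> x) = 0"
    unfolding I_def J_def inner_u using u_flux by simp_all
  define l where "l = (if j = 3 then c0 else 0)"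
  \<comment> \<open>Arranged so that each summand is one of the quantities whose bounds and limits
    at the axis are known; the pressure enters only for \<open>j = 1\<close> and
    \<open>j = 2\<close>.\<close>
  have stress_radial: "x $ 1 * stress j 1 x + x $ 2 * stress j 2 x
     = radial x $ j - (x $ 1 * u x $ 1 + x $ 2 * u x $ 2) * u x $ j
       - ((if j = 1 then x $ 1 else 0) * p x + (if j = 2 then x $ 2 else 0) * p x)" for x
    by (auto simp: stress_def radial_def algebra_simps)
  have s_flux: "(\<integral>x. indicator S x * (\<Sum>i\<in>UNIV. stress j i x * partial_deriv i \<phi> x) \<partial>lborel)
      = - 2 * pi * l * (\<integral>z. indicator {0<..} z * (\<phi> (vector [0, 0, z]) / z) \<partial>lborel)"
  proof (rule flux(2))
    show "stress j i differentiable at x" if "x \<in> S" for i x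
      using that by (rule stress_derivative)
    show "continuous_on S (partial_deriv i (stress j i))" for i
      by (rule continuous_on_stress_derivative)
    show "(\<Sum>i\<in>UNIV. partial_deriv i (stress j i) x) = 0" if "x \<in> S" for x
      using that by (rule stress_divergence_free)
    show "\<bar>stress j i x\<bar> \<le> 3 * C * radius x powr (- 3 / 2)" if "x \<in> S" "x \<in> T.K" for i x
    proof -
      have "\<bar>if i = j then p x else 0\<bar> \<le> C * radius x powr (- 3 / 2)"
        using C(4)[OF that] by (auto intro: order_trans[OF abs_ge_zero])
      then show ?thesis
        using C(1)[OF that, of i j] C(2)[OF that, of i j] unfolding stress_def mult.assoc by linarith
    qed
    show "\<bar>x $ 1 * stress j 1 x + x $ 2 * stress j 2 x\<bar> \<le> 3 * C" if x: "x \<in> S" "x \<in> T.K" for x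
    proof -
      have "\<bar>x $ 1 * p x\<bar> \<le> radius x * \<bar>p x\<bar>" "\<bar>x $ 2 * p x\<bar> \<le> radius x * \<bar>p x\<bar>"
        unfolding abs_mult by (intro mult_right_mono abs_nth_le_radius; simp)+
      then have "\<bar>(if j = 1 then x $ 1 else 0) * p x + (if j = 2 then x $ 2 else 0) * p x\<bar> \<le> C"
        using C(8)[OF x] C0[OF x] by auto
      then show ?thesis
        unfolding stress_radial using C(5)[OF x, of j] C(6)[OF x, of j] by linarith
    qed
    show "((\<lambda>\<epsilon>. \<epsilon> * y $ 1 * stress j 1 (vector [\<epsilon> * y $ 1, \<epsilon> * y $ 2, y $ 3])
        + \<epsilon> * y $ 2 * stress j 2 (vector [\<epsilon> * y $ 1, \<epsilon> * y $ 2, y $ 3])) \<longlongrightarrow> l / y $ 3) (at_right 0)"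
      if y: "0 < y $ 3" "y \<notin> x3_axis" for y
    proof -
      define \<gamma> where "\<gamma> \<epsilon> = (vector [\<epsilon> * y $ 1, \<epsilon> * y $ 2, y $ 3] :: real ^ 3)" for \<epsilon>
      note lims = axis_limits[OF y, folded \<gamma>_def]
      have p1: "((\<lambda>\<epsilon>. (if j = 1 then \<gamma> \<epsilon> $ 1 else 0) * p (\<gamma> \<epsilon>)) \<longlongrightarrow> 0) (at_right 0)"
        using lims(4) by (cases "j = 1") simp_all
      have p2: "((\<lambda>\<epsilon>. (if j = 2 then \<gamma> \<epsilon> $ 2 else 0) * p (\<gamma> \<epsilon>)) \<longlongrightarrow> 0) (at_right 0)"
        using lims(5) by (cases "j = 2") simp_all
      have "((\<lambda>\<epsilon>. radial (\<gamma> \<epsilon>) $ j - (\<gamma> \<epsilon> $ 1 * u (\<gamma> \<epsilon>) $ 1 + \<gamma> \<epsilon> $ 2 * u (\<gamma> \<epsilon>) $ 2) * u (\<gamma> \<epsilon>) $ j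
          - ((if j = 1 then \<gamma> \<epsilon> $ 1 else 0) * p (\<gamma> \<epsilon>) + (if j = 2 then \<gamma> \<epsilon> $ 2 else 0) * p (\<gamma> \<epsilon>)))
         \<longlongrightarrow> ((c0 / y $ 3) *\<^sub>R axis 3 1 :: real ^ 3) $ j - 0 - (0 + 0)) (at_right 0)"
        by (intro tendsto_diff tendsto_add tendsto_vec_nth lims p1 p2)
      moreover have "((c0 / y $ 3) *\<^sub>R axis 3 1 :: real ^ 3) $ j - 0 - (0 + 0) = l / y $ 3"
        by (simp add: l_def axis_def)
      ultimately have "((\<lambda>\<epsilon>. \<gamma> \<epsilon> $ 1 * stress j 1 (\<gamma> \<epsilon>) + \<gamma> \<epsilon> $ 2 * stress j 2 (\<gamma> \<epsilon>)) \<longlongrightarrow> l / y $ 3) (at_right 0)"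
        unfolding stress_radial by (simp only:)
      then show ?thesis by (simp add: \<gamma>_def)
    qed
  qed
  have "J (\<lambda>x. grad (\<lambda>y. u y $ j) x \<bullet> grad \<phi> x - (\<Sum>i\<in>UNIV. u x $ i * u x $ j * partial_deriv i \<phi> x)
          - p x * partial_deriv j \<phi> x)
     = (\<integral>x. indicator S x * (\<Sum>i\<in>UNIV. stress j i x * partial_deriv i \<phi> x) \<partial>lborel)"
    unfolding J_def
  proof (intro Bochner_Integration.integral_cong refl on_S)
    fix x assume x: "x \<in> S"
    have "(\<Sum>i\<in>UNIV. (if i = j then p x else 0) * partial_deriv i \<phi> x) = p x * partial_deriv j \<phi> x"
      by (simp add: if_distrib[of "\<lambda>a. a * _"] cong: if_cong)
    then show "grad (\<lambda>y. u y $ j) x \<bullet> grad \<phi> x - (\<Sum>i\<in>UNIV. u x $ i * u x $ j * partial_deriv i \<phi> x)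
          - p x * partial_deriv j \<phi> x = (\<Sum>i\<in>UNIV. stress j i x * partial_deriv i \<phi> x)"
      by (simp add: grad_u[OF x] stress_def left_diff_distrib sum_subtractf)
  qed
  then show "J (\<lambda>x. grad (\<lambda>y. u y $ j) x \<bullet> grad \<phi> x - (\<Sum>i\<in>UNIV. u x $ i * u x $ j * partial_deriv i \<phi> x)
          - p x * partial_deriv j \<phi> x)
       = - 2 * pi * (if j = 3 then c0 else 0) * (\<integral>z. indicator {0<..} z * (\<phi> (vector [0, 0, z]) / z) \<partial>lborel)"
    using s_flux by (simp add: l_def)
qed

text \<open>Two minus signs cancel: the flux contributes -2 \<pi> \<open>c0\<close> times the
  integral of \<phi>/z, and integration by parts on the axis turns that integral into minus the one
  with ln z. Otherwise this is the passage from the punctured cone and Borel measure to the cone and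
  Lebesgue measure.\<close>

lemma weak_formulation:
  assumes test: "\<phi> \<in> test_functions (Cone \<delta>)"
  shows "set_integrable lebesgue (Cone \<delta>) (\<lambda>x. grad (\<lambda>y. u y $ j) x \<bullet> grad \<phi> x)"
    and "set_integrable lebesgue (Cone \<delta>) (\<lambda>x. \<Sum>i\<in>UNIV. u x $ i * u x $ j * partial_deriv i \<phi> x)"
    and "set_integrable lebesgue (Cone \<delta>) (\<lambda>x. p x * partial_deriv j \<phi> x)"
    and "set_integrable lebesgue {0<..} (\<lambda>z. ln \<bar>z\<bar> * partial_deriv 3 \<phi> (vector [0, 0, z]))"
    and "(LINT x:Cone \<delta>|lebesgue.
         grad (\<lambda>y. u y $ j) x \<bullet> grad \<phi> x
         - (\<Sum>i\<in>UNIV. u x $ i * u x $ j * partial_deriv i \<phi> x)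
         - p x * partial_deriv j \<phi> x) =
      2 * pi * c0 * (if j = 3 then 1 else 0) *
        (LINT z:{0<..}|lebesgue. ln \<bar>z\<bar> * partial_deriv 3 \<phi> (vector [0, 0, z]))"
    and "set_integrable lebesgue (Cone \<delta>) (\<lambda>x. u x \<bullet> grad \<phi> x)"
    and "(LINT x:Cone \<delta>|lebesgue. u x \<bullet> grad \<phi> x) = 0"
proof -
  interpret T: cone_test_function \<delta> \<phi> by unfold_locales (fact \<delta>_pos, fact test)
  note eqs = lborel_weak_formulation[OF test, unfolded S_def]
  note conv = lebesgue_off_axis[where \<delta> = \<delta>]
  let ?w = "\<lambda>z. ln \<bar>z\<bar> * partial_deriv 3 \<phi> (vector [0, 0, z])"
  show "set_integrable lebesgue (Cone \<delta>) (\<lambda>x. grad (\<lambda>y. u y $ j) x \<bullet> grad \<phi> x)"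
    "set_integrable lebesgue (Cone \<delta>) (\<lambda>x. \<Sum>i\<in>UNIV. u x $ i * u x $ j * partial_deriv i \<phi> x)"
    "set_integrable lebesgue (Cone \<delta>) (\<lambda>x. p x * partial_deriv j \<phi> x)"
    "set_integrable lebesgue (Cone \<delta>) (\<lambda>x. u x \<bullet> grad \<phi> x)"
    by (rule conv(1)[OF eqs(1)], rule conv(1)[OF eqs(2)], rule conv(1)[OF eqs(3)], rule conv(1)[OF eqs(4)])
  show "set_integrable lebesgue {0<..} ?w"
    using T.axis_profile_integrable(2) borel_measurable_integrable[OF T.axis_profile_integrable(2)]
    by (simp add: set_integrable_def integrable_completion)
  have "(LINT z:{0<..}|lebesgue. ?w z) = (\<integral>z. indicator {0<..} z * ?w z \<partial>lborel)"
    using borel_measurable_integrable[OF T.axis_profile_integrable(2)]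
    by (simp add: set_lebesgue_integral_def integral_completion)
  then have w: "(LINT z:{0<..}|lebesgue. ?w z) = - (\<integral>z. indicator {0<..} z * (\<phi> (vector [0, 0, z]) / z) \<partial>lborel)"
    using T.axis_profile_integrable(3) by simp
  show "(LINT x:Cone \<delta>|lebesgue.
         grad (\<lambda>y. u y $ j) x \<bullet> grad \<phi> x
         - (\<Sum>i\<in>UNIV. u x $ i * u x $ j * partial_deriv i \<phi> x)
         - p x * partial_deriv j \<phi> x) =
      2 * pi * c0 * (if j = 3 then 1 else 0) * (LINT z:{0<..}|lebesgue. ?w z)"
    unfolding conv(2)[OF eqs(6)] eqs(7) w by simp
  show "(LINT x:Cone \<delta>|lebesgue. u x \<bullet> grad \<phi> x) = 0"
    unfolding conv(2)[OF eqs(4)] by (rule eqs(5))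
qed

end

theorem proposition1p2:
  fixes c0 d0 b0\<rho> b0\<phi> \<delta> :: real
    and u :: "real ^ 3 \<Rightarrow> real ^ 3"
    and p :: "real ^ 3 \<Rightarrow> real"
  assumes "\<delta> > 0"
    and "smooth_on (Cone \<delta> - x3_axis) u"
    and "smooth_on (Cone \<delta> - x3_axis) p"
    and "homogeneous_on (-1) (Cone \<delta> - x3_axis) u"
    and "homogeneous_on (-2) (Cone \<delta> - x3_axis) p"
    and "axisymmetric_on (Cone \<delta> - x3_axis) u p"
    and "navier_stokes_on (Cone \<delta> - x3_axis) u p"
    and "\<And>z. z > 0 \<Longrightarrow>
      (\<lambda>x. norm (u x)) \<in> o[at (vector [0, 0, z]) within {x. x $ 3 = z}](\<lambda>x. inverse (radius x))"
    and "has_parameter u p (c0, d0, b0\<rho>, b0\<phi>)"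
  shows "\<forall>\<phi> \<in> test_functions (Cone \<delta>).
    (\<forall>j.
      set_integrable lebesgue (Cone \<delta>) (\<lambda>x. grad (\<lambda>y. u y $ j) x \<bullet> grad \<phi> x) \<and>
      set_integrable lebesgue (Cone \<delta>) (\<lambda>x. \<Sum>i\<in>UNIV. u x $ i * u x $ j * partial_deriv i \<phi> x) \<and>
      set_integrable lebesgue (Cone \<delta>) (\<lambda>x. p x * partial_deriv j \<phi> x) \<and>
      set_integrable lebesgue {0<..} (\<lambda>z. ln \<bar>z\<bar> * partial_deriv 3 \<phi> (vector [0, 0, z])) \<and>
      (LINT x:Cone \<delta>|lebesgue.
         grad (\<lambda>y. u y $ j) x \<bullet> grad \<phi> x
         - (\<Sum>i\<in>UNIV. u x $ i * u x $ j * partial_deriv i \<phi> x)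
         - p x * partial_deriv j \<phi> x) =
      2 * pi * c0 * (if j = 3 then 1 else 0) *
        (LINT z:{0<..}|lebesgue. ln \<bar>z\<bar> * partial_deriv 3 \<phi> (vector [0, 0, z]))) \<and>
    set_integrable lebesgue (Cone \<delta>) (\<lambda>x. u x \<bullet> grad \<phi> x) \<and>
    (LINT x:Cone \<delta>|lebesgue. u x \<bullet> grad \<phi> x) = 0"
proof -
  interpret parametrised_flow \<delta> u p c0 d0 b0\<rho> b0\<phi>
    by unfold_locales (fact assms)+
  show ?thesis by (intro ballI conjI allI weak_formulation)
qed

end
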